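(* Let $G$ be a finite group, $\mathcal S\subseteq G\setminus\{e\}$ a union of conjugacy classes and $\Omega^1_{\mathcal S}$ the corresponding bicovariant calculus on $\mathbb C(G)$. Let $L^*:\mathbb C(G)\to\mathbb C(G)$ be the linear map with $L^*(\rho^i{}_j)=\lambda^*_\rho\,\rho^i{}_j$ for all $\rho\in\mathrm{Irr}(G)$, for not necessarily distinct $\lambda^*_\rho\in\mathbb C$ such that $\lambda^*_1=0$, and consider the bicovariant bimodule inner product $(\ ,\ )$ on $\Omega^1_{\mathcal S}$ given by data $\{l^*_{\mathcal C}\in\mathbb C\}_{\mathcal C\subseteq\mathcal S^+}$. Then $L^*$ is a bicovariant 2nd order Laplacian with respect to $(\ ,\ )$ if and only if $$\sum_{\rho\in\mathrm{Irr}(G)}\frac{\dim(V_\rho)^2}{|G|}\lambda^*_\rho\,\chi_\rho(\mathcal C)=0$$ for all conjugacy classes $\mathcal C\subset G\setminus\{e\}$ not contained in $\mathcal S^+$, and $$\sum_{\mathcal C\subseteq\mathcal S^+}\ \sum_{\rho\in\mathrm{Irr}(G)}\frac{\dim(V_\rho)^2}{|G|}\lambda^*_\rho\big(1+\chi_\rho(\mathcal C)|\mathcal C|\big)=0,\qquad l^*_{\mathcal C}=-\frac12\sum_{\rho\in\mathrm{Irr}(G)}\frac{\dim(V_\rho)^2}{|G|}\lambda^*_\rho\,\overline{\chi_\rho(\mathcal C)}\quad(\mathcal C\subseteq\mathcal S^+).$$ In this case, $$\lambda^*_\rho=2\sum_{\mathcal C\subseteq\mathcal S^+}l^*_{\mathcal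 C}\,(1-\chi_\rho(\mathcal C))\,|\mathcal C|.$$
   Context: $\mathbb C(G)$ is the algebra of functions on $G$ with basis $\delta_g$. $\mathrm{Irr}(G)$ is the set of (isomorphism classes of) complex irreducible representations $\rho:G\to\mathrm{End}(V_\rho)$, $1$ is the trivial representation, $\rho^i{}_j\in\mathbb C(G)$ are the matrix coefficient functions $\rho^i{}_j(g)=\rho(g)^i{}_j$ (together a basis of $\mathbb C(G)$), and $\chi_\rho(\mathcal C)=\mathrm{Tr}\,\rho(c)/\dim V_\rho$, $c\in\mathcal C$, is the normalised character. The bar denotes complex conjugation. $\Omega^1_{\mathcal S}=\mathbb C(G)\otimes\mathrm{span}\{e_c\}_{c\in\mathcal S}$ with free left module structure, $e_c\,\delta_g=\delta_{gc^{-1}}e_c$ and $d\delta_g=\sum_{c\in\mathcal S}(\delta_{gc^{-1}}-\delta_g)e_c$. $\mathcal S^+\subseteq\mathcal S$ is the union of the conjugacy classes $\mathcal C\subseteq\mathcal S$ with $\mathcal C^{-1}\subseteq\mathcal S$. A bimodule inner product is a bimodule map $(\ ,\ ):\Omega^1_{\mathcal S}\otimes_{\mathbb C(G)}\Omega^1_{\mathcal S}\to\mathbb C(G)$; the bicovariant ones correspond to data $\{l^*_{\mathcal C}\}_{\mathcal C\subseteq\mathcal S^+}$, with $(e_c,e_d)=\delta_{c,d^{-1}}l^*_{\mathcal C}$ for $c\in\mathcal C\subseteq\mathcal S^+$, $d\in\mathcal C^{-1}\subseteq\mathcal S^+$, and $(e_c,e_d)=0$ otherwise. A linear map $\square:\mathbb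 C(G)\to\mathbb C(G)$ is a 2nd order Laplacian with respect to $(\ ,\ )$ if $\square(ab)=\square(a)b+a\square(b)+2(da,db)$ for all $a,b\in\mathbb C(G)$; it is bicovariant if it is a $\mathbb C(G)$-bicomodule map for the left and right coactions given by the coproduct $\Delta\delta_g=\sum_{ab=g}\delta_a\otimes\delta_b$.
   Formalization: The middle condition is corrected to Σ_ρ (dim²/|G|) λ*_ρ (1 + Σ_{C⊆S⁺} χ_ρ(C)|C|) = 0, with the 1 counted once instead of once per class; as printed the "only if" fails, e.g. for G = Z/3, S = {1,2}, l* = 1, where the printed sum is 4. *)

theory Defs
  imports
    "HOL-Algebra.Group_Action"
    "HOL-Library.Indicator_Function"
    "Jordan_Normal_Form.VS_Connect"
begin

section \<open>Conjugacy classes\<close>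

definition conj_classes :: "('a, 'b) monoid_scheme \<Rightarrow> 'a set set"
  where "conj_classes G =
    orbits G (carrier G) (\<lambda>g. \<lambda>h\<in>carrier G. g \<otimes>\<^bsub>G\<^esub> h \<otimes>\<^bsub>G\<^esub> inv\<^bsub>G\<^esub> g)"

definition sym_part :: "('a, 'b) monoid_scheme \<Rightarrow> 'a set \<Rightarrow> 'a set"
  where "sym_part G S = \<Union> {C \<in> conj_classes G. C \<subseteq> S \<and> set_inv\<^bsub>G\<^esub> C \<subseteq> S}"


section \<open>Complex matrix representations\<close>

definition degree_rep :: "('a, 'b) monoid_scheme \<Rightarrow> ('a \<Rightarrow> complex mat) \<Rightarrow> nat"
  where "degree_rep G \<rho> = dim_row (\<rho> \<one>\<^bsub>G\<^esub>)"

definition representation :: "('a, 'b) monoid_scheme \<Rightarrow> ('a \<Rightarrow> complex mat) \<Rightarrow> bool"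
  where "representation G \<rho> \<longleftrightarrow>
    (\<forall>g\<in>carrier G. \<rho> g \<in> carrier_mat (degree_rep G \<rho>) (degree_rep G \<rho>)) \<and>
    \<rho> \<one>\<^bsub>G\<^esub> = 1\<^sub>m (degree_rep G \<rho>) \<and>
    (\<forall>g\<in>carrier G. \<forall>h\<in>carrier G. \<rho> (g \<otimes>\<^bsub>G\<^esub> h) = \<rho> g * \<rho> h)"

definition irreducible_rep :: "('a, 'b) monoid_scheme \<Rightarrow> ('a \<Rightarrow> complex mat) \<Rightarrow> bool"
  where "irreducible_rep G \<rho> \<longleftrightarrow>
    representation G \<rho> \<and> 0 < degree_rep G \<rho> \<and>
    (\<forall>W. VectorSpace.subspace class_ring W (module_vec TYPE(complex) (degree_rep G \<rho>)) \<and>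
         (\<forall>g\<in>carrier G. \<forall>w\<in>W. \<rho> g *\<^sub>v w \<in> W) \<longrightarrow>
         W = {0\<^sub>v (degree_rep G \<rho>)} \<or> W = carrier_vec (degree_rep G \<rho>))"

definition iso_rep ::
    "('a, 'b) monoid_scheme \<Rightarrow> ('a \<Rightarrow> complex mat) \<Rightarrow> ('a \<Rightarrow> complex mat) \<Rightarrow> bool"
  where "iso_rep G \<rho> \<sigma> \<longleftrightarrow>
    degree_rep G \<rho> = degree_rep G \<sigma> \<and>
    (\<exists>P\<in>carrier_mat (degree_rep G \<rho>) (degree_rep G \<rho>). invertible_mat P \<and>
       (\<forall>g\<in>carrier G. P * \<rho> g = \<sigma> g * P))"

definition trivial_rep :: "'a \<Rightarrow> complex mat"
  where "trivial_rep = (\<lambda>_. 1\<^sub>m 1)"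

text \<open>The set of isomorphism classes of irreducible representations is rendered by a complete
  system of representatives, each with a chosen basis; this choice is what makes the matrix
  coefficient functions meaningful.\<close>

definition irrep_system :: "('a, 'b) monoid_scheme \<Rightarrow> ('a \<Rightarrow> complex mat) set \<Rightarrow> bool"
  where "irrep_system G R \<longleftrightarrow>
    (\<forall>\<rho>\<in>R. irreducible_rep G \<rho>) \<and>
    (\<forall>\<sigma>. irreducible_rep G \<sigma> \<longrightarrow> (\<exists>!\<rho>. \<rho> \<in> R \<and> iso_rep G \<sigma> \<rho>))"

text \<open>The normalised character; by \<open>norm_char_eq\<close> below it does not depend on the element
  chosen in the conjugacy class.\<close>

definition norm_char :: "('a, 'b) monoid_scheme \<Rightarrow> ('a \<Rightarrow> complex mat) \<Rightarrow> 'a set \<Rightarrow> complex"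
  where "norm_char G \<rho> C =
    (\<Sum>i<degree_rep G \<rho>. \<rho> (SOME c. c \<in> C) $$ (i, i)) / of_nat (degree_rep G \<rho>)"


section \<open>The function algebra of a finite group\<close>

text \<open>A function on \<open>G\<close> is a function on the ambient type that vanishes off the carrier.  All
  algebra operations are pointwise, the basis element $\delta_g$ is \<open>indicator {g}\<close> and the unit is
  \<open>indicator (carrier G)\<close>.\<close>

definition fun_alg :: "'a set \<Rightarrow> ('a \<Rightarrow> complex) set"
  where "fun_alg A = {f. \<forall>x. x \<notin> A \<longrightarrow> f x = 0}"

definition matrix_coeff ::
    "('a, 'b) monoid_scheme \<Rightarrow> ('a \<Rightarrow> complex mat) \<Rightarrow> nat \<Rightarrow> nat \<Rightarrow> 'a \<Rightarrow> complex"
  where "matrix_coeff G \<rho> i j = (\<lambda>g. if g \<in> carrier G then \<rho> g $$ (i, j) else 0)"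

definition linear_on_fun_alg ::
    "('a, 'b) monoid_scheme \<Rightarrow> (('a \<Rightarrow> complex) \<Rightarrow> ('a \<Rightarrow> complex)) \<Rightarrow> bool"
  where "linear_on_fun_alg G L \<longleftrightarrow>
    L \<in> fun_alg (carrier G) \<rightarrow> fun_alg (carrier G) \<and>
    (\<forall>a\<in>fun_alg (carrier G). \<forall>b\<in>fun_alg (carrier G).
       L (\<lambda>x. a x + b x) = (\<lambda>x. L a x + L b x)) \<and>
    (\<forall>k. \<forall>a\<in>fun_alg (carrier G). L (\<lambda>x. k * a x) = (\<lambda>x. k * L a x))"

text \<open>The tensor square of the function algebra is identified with the functions on
  \<open>carrier G \<times> carrier G\<close>, where $a \otimes b$ is \<open>\<lambda>(x, y). a x * b y\<close>.\<close>

definition coproduct ::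
    "('a, 'b) monoid_scheme \<Rightarrow> ('a \<Rightarrow> complex) \<Rightarrow> 'a \<times> 'a \<Rightarrow> complex"
  where "coproduct G f =
    (\<lambda>(x, y). if x \<in> carrier G \<and> y \<in> carrier G then f (x \<otimes>\<^bsub>G\<^esub> y) else 0)"

definition tensor_id_left ::
    "(('a \<Rightarrow> complex) \<Rightarrow> ('a \<Rightarrow> complex)) \<Rightarrow> ('a \<times> 'a \<Rightarrow> complex) \<Rightarrow> 'a \<times> 'a \<Rightarrow> complex"
  \<comment> \<open>$\mathrm{id} \otimes L$\<close>
  where "tensor_id_left L F = (\<lambda>(x, y). L (\<lambda>y'. F (x, y')) y)"

definition tensor_id_right ::
    "(('a \<Rightarrow> complex) \<Rightarrow> ('a \<Rightarrow> complex)) \<Rightarrow> ('a \<times> 'a \<Rightarrow> complex) \<Rightarrow> 'a \<times> 'a \<Rightarrow> complex"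
  \<comment> \<open>$L \otimes \mathrm{id}$\<close>
  where "tensor_id_right L F = (\<lambda>(x, y). L (\<lambda>x'. F (x', y)) x)"

definition bicovariant ::
    "('a, 'b) monoid_scheme \<Rightarrow> (('a \<Rightarrow> complex) \<Rightarrow> ('a \<Rightarrow> complex)) \<Rightarrow> bool"
  where "bicovariant G L \<longleftrightarrow> (\<forall>f\<in>fun_alg (carrier G).
    coproduct G (L f) = tensor_id_left L (coproduct G f) \<and>
    coproduct G (L f) = tensor_id_right L (coproduct G f))"


section \<open>The calculus\<close>

text \<open>A one-form $\sum_{c \in S} \omega_c\, e_c$ is represented by its family of coefficient
  functions \<open>\<omega>\<close>.\<close>

definition one_forms :: "('a, 'b) monoid_scheme \<Rightarrow> 'a set \<Rightarrow> ('a \<Rightarrow> 'a \<Rightarrow> complex) set"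
  where "one_forms G S =
    {\<omega>. (\<forall>c\<in>S. \<omega> c \<in> fun_alg (carrier G)) \<and> (\<forall>c. c \<notin> S \<longrightarrow> \<omega> c = (\<lambda>_. 0))}"

definition basis_form :: "('a, 'b) monoid_scheme \<Rightarrow> 'a \<Rightarrow> 'a \<Rightarrow> 'a \<Rightarrow> complex"
  where "basis_form G c = (\<lambda>d. if d = c then indicator (carrier G) else (\<lambda>_. 0))"

text \<open>The right translation $R_c$, which satisfies $R_c \delta_g = \delta_{g c^{-1}}$
  (\<open>shift_delta\<close>), so that $e_c\, f = R_c(f)\, e_c$.\<close>

definition shift :: "('a, 'b) monoid_scheme \<Rightarrow> 'a \<Rightarrow> ('a \<Rightarrow> complex) \<Rightarrow> 'a \<Rightarrow> complex"
  where "shift G c f = (\<lambda>x. if x \<in> carrier G then f (x \<otimes>\<^bsub>G\<^esub> c) else 0)"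

definition left_mult :: "('a \<Rightarrow> complex) \<Rightarrow> ('a \<Rightarrow> 'a \<Rightarrow> complex) \<Rightarrow> 'a \<Rightarrow> 'a \<Rightarrow> complex"
  where "left_mult f \<omega> = (\<lambda>c x. f x * \<omega> c x)"

definition right_mult ::
    "('a, 'b) monoid_scheme \<Rightarrow> ('a \<Rightarrow> 'a \<Rightarrow> complex) \<Rightarrow> ('a \<Rightarrow> complex) \<Rightarrow> 'a \<Rightarrow> 'a \<Rightarrow> complex"
  where "right_mult G \<omega> f = (\<lambda>c x. \<omega> c x * shift G c f x)"

definition exterior_d ::
    "('a, 'b) monoid_scheme \<Rightarrow> 'a set \<Rightarrow> ('a \<Rightarrow> complex) \<Rightarrow> 'a \<Rightarrow> 'a \<Rightarrow> complex"
  where "exterior_d G S f = (\<lambda>c. if c \<in> S then (\<lambda>x. shift G c f x - f x) else (\<lambda>_. 0))"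

text \<open>A bimodule map out of the tensor square over the function algebra is given as a
  biadditive balanced map; complex bilinearity follows from the left module property.\<close>

definition bimodule_inner_product ::
    "('a, 'b) monoid_scheme \<Rightarrow> 'a set \<Rightarrow>
     (('a \<Rightarrow> 'a \<Rightarrow> complex) \<Rightarrow> ('a \<Rightarrow> 'a \<Rightarrow> complex) \<Rightarrow> 'a \<Rightarrow> complex) \<Rightarrow> bool"
  where "bimodule_inner_product G S ip \<longleftrightarrow>
    (\<forall>\<omega>\<in>one_forms G S. \<forall>\<eta>\<in>one_forms G S. ip \<omega> \<eta> \<in> fun_alg (carrier G)) \<and>
    (\<forall>\<omega>\<in>one_forms G S. \<forall>\<omega>'\<in>one_forms G S. \<forall>\<eta>\<in>one_forms G S.
       ip (\<lambda>c x. \<omega> c x + \<omega>' c x) \<eta> = (\<lambda>x. ip \<omega> \<eta> x + ip \<omega>' \<eta> x) \<and>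
       ip \<eta> (\<lambda>c x. \<omega> c x + \<omega>' c x) = (\<lambda>x. ip \<eta> \<omega> x + ip \<eta> \<omega>' x)) \<and>
    (\<forall>f\<in>fun_alg (carrier G). \<forall>\<omega>\<in>one_forms G S. \<forall>\<eta>\<in>one_forms G S.
       ip (right_mult G \<omega> f) \<eta> = ip \<omega> (left_mult f \<eta>) \<and>
       ip (left_mult f \<omega>) \<eta> = (\<lambda>x. f x * ip \<omega> \<eta> x) \<and>
       ip \<omega> (right_mult G \<eta> f) = (\<lambda>x. ip \<omega> \<eta> x * f x))"

definition given_by_data ::
    "('a, 'b) monoid_scheme \<Rightarrow> 'a set \<Rightarrow> ('a set \<Rightarrow> complex) \<Rightarrow>
     (('a \<Rightarrow> 'a \<Rightarrow> complex) \<Rightarrow> ('a \<Rightarrow> 'a \<Rightarrow> complex) \<Rightarrow> 'a \<Rightarrow> complex) \<Rightarrow> bool"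
  where "given_by_data G S l ip \<longleftrightarrow>
    (\<forall>C\<in>conj_classes G. C \<subseteq> sym_part G S \<longrightarrow>
       (\<forall>c\<in>C. \<forall>d\<in>S. ip (basis_form G c) (basis_form G d) =
          (\<lambda>x. if c = inv\<^bsub>G\<^esub> d then l C * indicator (carrier G) x else 0))) \<and>
    (\<forall>c\<in>S - sym_part G S. \<forall>d\<in>S. ip (basis_form G c) (basis_form G d) = (\<lambda>_. 0))"

definition second_order_laplacian ::
    "('a, 'b) monoid_scheme \<Rightarrow> 'a set \<Rightarrow>
     (('a \<Rightarrow> 'a \<Rightarrow> complex) \<Rightarrow> ('a \<Rightarrow> 'a \<Rightarrow> complex) \<Rightarrow> 'a \<Rightarrow> complex) \<Rightarrow>
     (('a \<Rightarrow> complex) \<Rightarrow> ('a \<Rightarrow> complex)) \<Rightarrow> bool"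
  where "second_order_laplacian G S ip L \<longleftrightarrow>
    linear_on_fun_alg G L \<and>
    (\<forall>a\<in>fun_alg (carrier G). \<forall>b\<in>fun_alg (carrier G).
       L (\<lambda>x. a x * b x) =
         (\<lambda>x. L a x * b x + a x * L b x + 2 * ip (exterior_d G S a) (exterior_d G S b) x))"


section \<open>Agreement with the formulas on the basis\<close>

context group
begin

lemma shift_delta:
  assumes "g \<in> carrier G" "c \<in> carrier G"
  shows "shift G c (indicator {g}) = indicator {g \<otimes> inv c}"
proof
  fix x
  show "shift G c (indicator {g}) x = indicator {g \<otimes> inv c} x"
  proof (cases "x \<in> carrier G")
    case True
    then have "x \<otimes> c = g \<longleftrightarrow> x = g \<otimes> inv c"
      using inv_solve_right[of x g c] assms by metis
    with True show ?thesis by (simp only: shift_def indicator_def singleton_iff if_True)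
  next
    case False
    then have "x \<noteq> g \<otimes> inv c" using assms by blast
    with False show ?thesis by (simp add: shift_def)
  qed
qed

lemma basis_form_mult_delta:
  assumes "g \<in> carrier G" "c \<in> carrier G"
  shows "right_mult G (basis_form G c) (indicator {g}) =
    left_mult (indicator {g \<otimes> inv c}) (basis_form G c)"
proof -
  have "shift G c (indicator {g}) x * indicator (carrier G) x =
      indicator {g \<otimes> inv c} x * (indicator (carrier G) x :: complex)" for x
    by (simp only: shift_delta[OF assms])
  then show ?thesis
    by (simp add: right_mult_def left_mult_def basis_form_def fun_eq_iff mult.commute)
qed

lemma exterior_d_delta:
  assumes "finite (carrier G)" "g \<in> carrier G" "S \<subseteq> carrier G"
  shows "exterior_d G S (indicator {g}) =
    (\<lambda>d x. \<Sum>c\<in>S. left_mult (\<lambda>y. indicator {g \<otimes> inv c} y - indicator {g} y) (basis_form G c) d x)"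
proof (intro ext)
  fix d x
  have fin: "finite S" using assms finite_subset by blast
  have "(\<Sum>c\<in>S. left_mult (\<lambda>y. indicator {g \<otimes> inv c} y - indicator {g} y) (basis_form G c) d x)
    = (\<Sum>c\<in>S. if d = c
        then (indicator {g \<otimes> inv d} x - indicator {g} x) * indicator (carrier G) x else 0)"
    by (intro sum.cong) (auto simp: left_mult_def basis_form_def)
  also have "\<dots> = (if d \<in> S
        then (indicator {g \<otimes> inv d} x - indicator {g} x) * indicator (carrier G) x else 0)"
    using fin by (simp add: sum.delta')
  also have "\<dots> = exterior_d G S (indicator {g}) d x"
  proof (cases "d \<in> S")
    case True
    then have d: "d \<in> carrier G" using assms(3) by blast
    have "x \<in> carrier G" if "x = g \<or> x = g \<otimes> inv d" using that assms(2) d by blast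
    then have "(indicator {g \<otimes> inv d} x - indicator {g} x) * indicator (carrier G) x =
        (indicator {g \<otimes> inv d} x - indicator {g} x :: complex)"
      by (cases "x \<in> carrier G") (auto simp: indicator_def)
    with True show ?thesis
      by (simp add: exterior_d_def shift_delta[OF assms(2) d])
  qed (simp add: exterior_d_def)
  finally show "exterior_d G S (indicator {g}) d x =
    (\<Sum>c\<in>S. left_mult (\<lambda>y. indicator {g \<otimes> inv c} y - indicator {g} y) (basis_form G c) d x)"
    by simp
qed

lemma coproduct_delta:
  assumes "finite (carrier G)" "g \<in> carrier G"
  shows "coproduct G (indicator {g}) =
    (\<lambda>(x, y). \<Sum>(a, b)\<in>{(a, b) \<in> carrier G \<times> carrier G. a \<otimes> b = g}.
       indicator {a} x * indicator {b} y)"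
proof
  fix p :: "'a \<times> 'a"
  obtain x y where p: "p = (x, y)" by (cases p)
  let ?A = "{(a, b) \<in> carrier G \<times> carrier G. a \<otimes> b = g}"
  have fin: "finite ?A"
    by (rule finite_subset[of _ "carrier G \<times> carrier G"]) (use assms in auto)
  have "(\<Sum>(a, b)\<in>?A. indicator {a} x * indicator {b} y :: complex) =
      (\<Sum>q\<in>?A. if p = q then 1 else 0)"
    by (intro sum.cong) (auto simp: p indicator_def)
  also have "\<dots> = (if p \<in> ?A then 1 else 0)" using fin by simp
  finally show "coproduct G (indicator {g}) p =
     (\<lambda>(x, y). \<Sum>(a, b)\<in>?A. indicator {a} x * indicator {b} y) p"
    by (auto simp: p coproduct_def indicator_def)
qed

lemma norm_char_eq:
  assumes \<rho>: "representation G \<rho>" and C: "C \<in> conj_classes G" and c: "c \<in> C"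
  shows "norm_char G \<rho> C = (\<Sum>i<degree_rep G \<rho>. \<rho> c $$ (i, i)) / of_nat (degree_rep G \<rho>)"
proof -
  let ?n = "degree_rep G \<rho>"
  define s where "s = (SOME c. c \<in> C)"
  have s: "s \<in> C" unfolding s_def using c by (rule someI)
  from C obtain h where h: "h \<in> carrier G" "C = {g \<otimes> h \<otimes> inv g | g. g \<in> carrier G}"
    by (auto simp: conj_classes_def orbits_def orbit_def)
  have dims: "\<rho> g \<in> carrier_mat ?n ?n" if "g \<in> carrier G" for g
    using \<rho> that by (auto simp: representation_def)
  have hom: "\<rho> (g \<otimes> k) = \<rho> g * \<rho> k" if "g \<in> carrier G" "k \<in> carrier G" for g k
    using \<rho> that by (auto simp: representation_def)
  have comm: "(\<Sum>i<?n. (A * B) $$ (i, i)) = (\<Sum>i<?n. (B * A) $$ (i, i))"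
    if "A \<in> carrier_mat ?n ?n" "B \<in> carrier_mat ?n ?n" for A B :: "complex mat"
  proof -
    have "(\<Sum>i<?n. (A * B) $$ (i, i)) = (\<Sum>i<?n. \<Sum>j<?n. A $$ (i, j) * B $$ (j, i))"
      using that by (intro sum.cong) (auto simp: scalar_prod_def atLeast0LessThan)
    also have "\<dots> = (\<Sum>j<?n. \<Sum>i<?n. A $$ (i, j) * B $$ (j, i))" by (rule sum.swap)
    also have "\<dots> = (\<Sum>i<?n. (B * A) $$ (i, i))"
      using that by (intro sum.cong) (auto simp: scalar_prod_def atLeast0LessThan mult.commute)
    finally show ?thesis .
  qed
  have "(\<Sum>i<?n. \<rho> x $$ (i, i)) = (\<Sum>i<?n. \<rho> h $$ (i, i))" if x: "x \<in> C" for x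
  proof -
    from x h obtain g where g: "g \<in> carrier G" "x = g \<otimes> h \<otimes> inv g" by auto
    have "(\<Sum>i<?n. \<rho> x $$ (i, i)) = (\<Sum>i<?n. (\<rho> (g \<otimes> h) * \<rho> (inv g)) $$ (i, i))"
      using g h by (simp add: hom)
    also have "\<dots> = (\<Sum>i<?n. (\<rho> (inv g) * \<rho> (g \<otimes> h)) $$ (i, i))"
      using g h by (intro comm dims) auto
    also have "\<dots> = (\<Sum>i<?n. \<rho> (inv g \<otimes> (g \<otimes> h)) $$ (i, i))"
      using g h hom[of "inv g" "g \<otimes> h"] by simp
    also have "inv g \<otimes> (g \<otimes> h) = h" using g h by (simp add: m_assoc[symmetric])
    finally show ?thesis .
  qed
  from this[OF s] this[OF c] show ?thesis
    by (simp add: norm_char_def s_def)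
qed

end

end

theory Submission
  imports Defs "HOL-Library.Function_Algebras" "Jordan_Normal_Form.Spectral_Radius"
begin

text \<open>The delta function at the unit is $\sum_\rho \frac{\dim V_\rho}{|G|} \mathrm{Tr}\,\rho$, so an
  operator that is diagonal on the matrix coefficients is a convolution
  $(L f)(x) = \sum_y \psi(y) f(xy)$ with the class function
  $\psi(y) = \sum_\rho \frac{\dim V_\rho}{|G|} \lambda_\rho \mathrm{Tr}\,\rho(y^{-1})$, and is
  therefore bicovariant.  Since $\sum_y \psi(y) = \lambda_1 = 0$, the defect $L(ab) - L(a)b - aL(b)$
  is $\sum_y \psi(y) (a(xy) - a(x)) (b(xy) - b(x))$, while $2(da, db)$ is the same expression with
  $-2 l_{\mathcal C}$ on $\mathcal C \subseteq \mathcal S^+$ and $0$ elsewhere in place of $\psi$.  Hence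
  $L$ is a Laplacian iff these two functions agree away from the unit; read off in terms of characters,
  this is the first and third condition, and the second one follows from the first.\<close>


section \<open>Matrices\<close>

text \<open>\<open>L\<close> is prescribed on matrix coefficients only, so its kernel is known once
  \<open>indicator {h}\<close> has been expanded in them; the bulk of the work is therefore the
  completeness of \<open>Irr\<close>, built up from Schur's lemma. Two facts have to come before
  that expansion: \<open>Irr\<close> is finite (a sum over an infinite set is 0 by convention), and
  Tr \<rho>(inv y) is the conjugate of Tr \<rho>(y) although the representatives need not be
  unitary. The latter also separates the two kinds of conditions: a character sum without bar is
  \<psi>(inv c), one with bar is \<psi>(c). Both fit together because the symmetric part of
  \<open>S\<close>, hence also its complement, is stable under inversion. The total mass of \<psi>
  is the eigenvalue at the constants; its vanishing expresses \<psi>(1) by the values on the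
  symmetric part. This gives the second condition, and it produces the 1 in the factor 1 - \<chi>
  when \<psi> is summed against Tr \<rho> to recover the eigenvalue. The minus sign in -2 l stems
  from e_c pairing with the form of the inverse element.\<close>

lemma mat_mult_entry:
  fixes A B :: "'a :: comm_semiring_1 mat"
  assumes "A \<in> carrier_mat m n" "B \<in> carrier_mat n p" "i < m" "j < p"
  shows "(A * B) $$ (i, j) = (\<Sum>k<n. A $$ (i, k) * B $$ (k, j))"
  using assms by (auto simp: scalar_prod_def atLeast0LessThan)

definition mat_trace :: "'a :: comm_monoid_add mat \<Rightarrow> 'a"
  where "mat_trace A = (\<Sum>i<dim_row A. A $$ (i, i))"

lemma mat_trace_eq: "A \<in> carrier_mat n m \<Longrightarrow> mat_trace A = (\<Sum>i<n. A $$ (i, i))"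
  by (simp add: mat_trace_def)

text \<open>Rectangular factors are allowed on purpose: if \<open>T * U\<close> and
  \<open>U * T\<close> are both identities, equality of their traces forces the two dimensions to
  agree.\<close>

lemma mat_trace_mult_comm:
  fixes A B :: "'a :: comm_semiring_1 mat"
  assumes "A \<in> carrier_mat m n" "B \<in> carrier_mat n m"
  shows "mat_trace (A * B) = mat_trace (B * A)"
proof -
  have "mat_trace (A * B) = (\<Sum>i<m. \<Sum>j<n. A $$ (i, j) * B $$ (j, i))"
    using assms by (simp add: mat_trace_def mat_mult_entry[OF assms] del: index_mult_mat(1))
  also have "\<dots> = (\<Sum>j<n. \<Sum>i<m. A $$ (i, j) * B $$ (j, i))"
    by (rule sum.swap)
  also have "\<dots> = mat_trace (B * A)"
    using assms by (simp add: mat_trace_def mat_mult_entry[OF assms(2,1)] mult.commute del: index_mult_mat(1))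
  finally show ?thesis .
qed

lemma mat_trace_similar:
  fixes A B P Q :: "'a :: comm_ring_1 mat"
  assumes "A \<in> carrier_mat n n" "P \<in> carrier_mat n n" "Q \<in> carrier_mat n n" "Q * P = 1\<^sub>m n"
  shows "mat_trace (P * A * Q) = mat_trace A"
proof -
  have "mat_trace (P * A * Q) = mat_trace (Q * (P * A))"
    using assms by (intro mat_trace_mult_comm) auto
  also have "Q * (P * A) = Q * P * A"
    by (rule assoc_mult_mat[symmetric]) (use assms in auto)
  finally show ?thesis
    using assms by simp
qed

text \<open>Matrices of all dimensions form one type, which is no additive monoid; hence the explicit
  dimensions.\<close>

definition mat_sum :: "nat \<Rightarrow> nat \<Rightarrow> 'b set \<Rightarrow> ('b \<Rightarrow> 'a :: comm_monoid_add mat) \<Rightarrow> 'a mat"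
  where "mat_sum m n I F = mat m n (\<lambda>(i, j). \<Sum>x\<in>I. F x $$ (i, j))"

lemma mat_sum_carrier [simp]: "mat_sum m n I F \<in> carrier_mat m n"
  by (simp add: mat_sum_def)

lemma mat_sum_dim [simp]: "dim_row (mat_sum m n I F) = m" "dim_col (mat_sum m n I F) = n"
  by (simp_all add: mat_sum_def)

lemma mat_sum_entry:
  "i < m \<Longrightarrow> j < n \<Longrightarrow> mat_sum m n I F $$ (i, j) = (\<Sum>x\<in>I. F x $$ (i, j))"
  by (simp add: mat_sum_def)

lemma mat_sum_cong: "(\<And>x. x \<in> I \<Longrightarrow> F x = H x) \<Longrightarrow> mat_sum m n I F = mat_sum m n I H"
  by (simp add: mat_sum_def)

lemma mat_sum_reindex:
  "bij_betw h I J \<Longrightarrow> mat_sum m n I (\<lambda>x. F (h x)) = mat_sum m n J F"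
  by (simp add: mat_sum_def sum.reindex_bij_betw[of h I J "\<lambda>x. F x $$ _"])

lemma mat_sum_mult_left:
  fixes A :: "'a :: comm_semiring_1 mat"
  assumes A: "A \<in> carrier_mat k m" and F: "\<And>x. x \<in> I \<Longrightarrow> F x \<in> carrier_mat m n"
  shows "A * mat_sum m n I F = mat_sum k n I (\<lambda>x. A * F x)"
proof (rule eq_matI)
  fix i j assume "i < dim_row (mat_sum k n I (\<lambda>x. A * F x))" "j < dim_col (mat_sum k n I (\<lambda>x. A * F x))"
  then have i: "i < k" and j: "j < n" by auto
  have "(A * mat_sum m n I F) $$ (i, j) = (\<Sum>l<m. \<Sum>x\<in>I. A $$ (i, l) * F x $$ (l, j))"
    using j by (simp add: mat_mult_entry[OF A mat_sum_carrier i j] mat_sum_entry sum_distrib_left)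
  also have "\<dots> = (\<Sum>x\<in>I. \<Sum>l<m. A $$ (i, l) * F x $$ (l, j))"
    by (rule sum.swap)
  also have "\<dots> = mat_sum k n I (\<lambda>x. A * F x) $$ (i, j)"
    using i j by (simp add: mat_sum_entry mat_mult_entry[OF A F i j])
  finally show "(A * mat_sum m n I F) $$ (i, j) = mat_sum k n I (\<lambda>x. A * F x) $$ (i, j)" .
qed (use A in auto)

lemma mat_sum_mult_right:
  fixes A :: "'a :: comm_semiring_1 mat"
  assumes A: "A \<in> carrier_mat n k" and F: "\<And>x. x \<in> I \<Longrightarrow> F x \<in> carrier_mat m n"
  shows "mat_sum m n I F * A = mat_sum m k I (\<lambda>x. F x * A)"
proof (rule eq_matI)
  fix i j assume "i < dim_row (mat_sum m k I (\<lambda>x. F x * A))" "j < dim_col (mat_sum m k I (\<lambda>x. F x * A))"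
  then have i: "i < m" and j: "j < k" by auto
  have "(mat_sum m n I F * A) $$ (i, j) = (\<Sum>l<n. \<Sum>x\<in>I. F x $$ (i, l) * A $$ (l, j))"
    using i by (simp add: mat_mult_entry[OF mat_sum_carrier A i j] mat_sum_entry sum_distrib_right)
  also have "\<dots> = (\<Sum>x\<in>I. \<Sum>l<n. F x $$ (i, l) * A $$ (l, j))"
    by (rule sum.swap)
  also have "\<dots> = mat_sum m k I (\<lambda>x. F x * A) $$ (i, j)"
    using i j by (simp add: mat_sum_entry mat_mult_entry[OF F A i j])
  finally show "(mat_sum m n I F * A) $$ (i, j) = mat_sum m k I (\<lambda>x. F x * A) $$ (i, j)" .
qed (use A in auto)

lemma mat_trace_mat_sum:
  assumes "\<And>x. x \<in> I \<Longrightarrow> F x \<in> carrier_mat n n"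
  shows "mat_trace (mat_sum n n I F) = (\<Sum>x\<in>I. mat_trace (F x))"
proof -
  have "mat_trace (mat_sum n n I F) = (\<Sum>i<n. \<Sum>x\<in>I. F x $$ (i, i))"
    by (simp add: mat_trace_def mat_sum_entry)
  also have "\<dots> = (\<Sum>x\<in>I. \<Sum>i<n. F x $$ (i, i))"
    by (rule sum.swap)
  also have "\<dots> = (\<Sum>x\<in>I. mat_trace (F x))"
    by (rule sum.cong[OF refl]) (rule mat_trace_eq[OF assms, symmetric])
  finally show ?thesis .
qed

section \<open>Subspaces of coordinate space and invertibility of matrices\<close>

lemma subspace_module_vec_iff:
  fixes W :: "'a :: field vec set"
  shows "VectorSpace.subspace class_ring W (module_vec TYPE('a) n) \<longleftrightarrow>
    W \<subseteq> carrier_vec n \<and> 0\<^sub>v n \<in> W \<and> (\<forall>v\<in>W. \<forall>w\<in>W. v + w \<in> W) \<and> (\<forall>c. \<forall>v\<in>W. c \<cdot>\<^sub>v v \<in> W)"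
proof -
  interpret vs: vec_space "TYPE('a)" n .
  show ?thesis
    unfolding VectorSpace.subspace_def submodule_def
    by (auto simp: vs.vectorspace_axioms vs.module_axioms module_vec_simps)
qed

text \<open>Surjectivity provides preimages of the unit vectors, which are the columns of a right
  inverse \<open>U\<close>. Then \<open>T * (U * T) = T\<close>, and injectivity cancels
  \<open>T\<close> column by column, so \<open>U\<close> is a left inverse as well. That the matrix
  is square is part of the conclusion.\<close>

lemma invertible_matI_bij:
  fixes T :: "'a :: field_char_0 mat"
  assumes T: "T \<in> carrier_mat m n"
    and inj: "\<And>v. v \<in> carrier_vec n \<Longrightarrow> T *\<^sub>v v = 0\<^sub>v m \<Longrightarrow> v = 0\<^sub>v n"
    and surj: "\<And>w. w \<in> carrier_vec m \<Longrightarrow> \<exists>v\<in>carrier_vec n. T *\<^sub>v v = w"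
  shows "m = n" "invertible_mat T"
proof -
  have "\<exists>v. v \<in> carrier_vec n \<and> T *\<^sub>v v = unit_vec m i" for i
    using surj[of "unit_vec m i"] by auto
  then obtain s where s: "\<And>i. s i \<in> carrier_vec n \<and> T *\<^sub>v s i = unit_vec m i"
    by metis
  define U where "U = mat n m (\<lambda>(i, j). s j $ i)"
  have U: "U \<in> carrier_mat n m" by (simp add: U_def)
  have colU: "col U j = s j" if "j < m" for j
    using s[of j] that by (intro eq_vecI) (auto simp: U_def)
  have TU: "T * U = 1\<^sub>m m"
  proof (rule mat_col_eqI)
    fix j assume "j < dim_col (1\<^sub>m m :: 'a mat)"
    then have j: "j < m" by simp
    have "col (T * U) j = T *\<^sub>v col U j" by (rule col_mult2[OF T U j])
    then show "col (T * U) j = col (1\<^sub>m m) j" using s j by (simp add: colU)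
  qed (use T U in auto)
  have UT: "U * T = 1\<^sub>m n"
  proof -
    have UT: "U * T \<in> carrier_mat n n" using U T by simp
    have "T * (U * T) = T"
      using assoc_mult_mat[OF T U T] TU T by simp
    show ?thesis
    proof (rule mat_col_eqI)
      fix j assume "j < dim_col (1\<^sub>m n :: 'a mat)"
      then have j: "j < n" by simp
      have c: "col (U * T) j \<in> carrier_vec n" by (rule col_carrier_vec[OF j UT])
      have "T *\<^sub>v (col (U * T) j - unit_vec n j) = T *\<^sub>v col (U * T) j - T *\<^sub>v unit_vec n j"
        using mult_minus_distrib_mat_vec[OF T c] by simp
      also have "T *\<^sub>v col (U * T) j = col (T * (U * T)) j"
        by (rule col_mult2[OF T UT j, symmetric])
      also have "T *\<^sub>v unit_vec n j = col T j"
        using col_mult2[OF T one_carrier_mat j] T j by simp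
      finally have "T *\<^sub>v (col (U * T) j - unit_vec n j) = 0\<^sub>v m"
        unfolding \<open>T * (U * T) = T\<close> using minus_cancel_vec[OF col_carrier_vec[OF j T]] by simp
      then have 0: "col (U * T) j - unit_vec n j = 0\<^sub>v n"
        using c by (intro inj) auto
      have "col (U * T) j = unit_vec n j"
      proof (rule eq_vecI)
        fix i assume "i < dim_vec (unit_vec n j :: 'a vec)"
        then have i: "i < n" by simp
        have "(col (U * T) j - unit_vec n j) $ i = 0" using 0 i by simp
        then show "col (U * T) j $ i = unit_vec n j $ i" using c i by simp
      qed (use c U in auto)
      then show "col (U * T) j = col (1\<^sub>m n) j" using j by simp
    qed (use T U in auto)
  qed
  have tr1: "mat_trace (1\<^sub>m k :: 'a mat) = of_nat k" for k
    by (simp add: mat_trace_def)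
  \<comment> \<open>Both sides are traces of identity matrices; characteristic zero makes
    \<open>of_nat\<close> injective.\<close>
  have "(of_nat m :: 'a) = of_nat n"
    using mat_trace_mult_comm[OF T U] TU UT tr1 by metis
  then show mn: "m = n" by simp
  show "invertible_mat T"
    using T U TU UT mn unfolding invertible_mat_def inverts_mat_def square_mat.simps by auto
qed

text \<open>\<open>inverts_mat\<close> sizes its identity matrix by its left factor, so the shape of
  the inverse has to be recovered by comparing dimensions in the two products.\<close>

lemma invertible_matE:
  assumes "invertible_mat P" "P \<in> carrier_mat n n"
  obtains Q where "Q \<in> carrier_mat n n" "P * Q = 1\<^sub>m n" "Q * P = 1\<^sub>m n"
proof -
  from assms obtain Q where Q: "inverts_mat P Q" "inverts_mat Q P"
    by (auto simp: invertible_mat_def)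
  then have 1: "P * Q = 1\<^sub>m n" "Q * P = 1\<^sub>m (dim_row Q)"
    using assms by (auto simp: inverts_mat_def)
  have "dim_col Q = n" using arg_cong[OF 1(1), of dim_col] by simp
  moreover have "dim_row Q = n" using arg_cong[OF 1(2), of dim_col] assms by simp
  ultimately show ?thesis using that 1 by auto
qed


section \<open>Schur's lemma and orthogonality\<close>

context group
begin

section \<open>Permutations of the group and elementary properties of representations\<close>

lemma bij_betw_mult_left: "h \<in> carrier G \<Longrightarrow> bij_betw (\<lambda>g. h \<otimes> g) (carrier G) (carrier G)"
  by (rule bij_betw_byWitness[where f' = "\<lambda>g. inv h \<otimes> g"]) (auto simp: m_assoc[symmetric])

lemma bij_betw_mult_right: "h \<in> carrier G \<Longrightarrow> bij_betw (\<lambda>g. g \<otimes> h) (carrier G) (carrier G)"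
  by (rule bij_betw_byWitness[where f' = "\<lambda>g. g \<otimes> inv h"]) (auto simp: m_assoc)

lemma bij_betw_inv: "bij_betw (\<lambda>g. inv g) (carrier G) (carrier G)"
  by (rule bij_betw_byWitness[where f' = "\<lambda>g. inv g"]) auto

lemma rep_carrier:
  "representation G \<rho> \<Longrightarrow> g \<in> carrier G \<Longrightarrow> \<rho> g \<in> carrier_mat (degree_rep G \<rho>) (degree_rep G \<rho>)"
  by (auto simp: representation_def)

lemma rep_mult:
  "representation G \<rho> \<Longrightarrow> g \<in> carrier G \<Longrightarrow> h \<in> carrier G \<Longrightarrow> \<rho> (g \<otimes> h) = \<rho> g * \<rho> h"
  by (auto simp: representation_def)

lemma rep_one: "representation G \<rho> \<Longrightarrow> \<rho> \<one> = 1\<^sub>m (degree_rep G \<rho>)"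
  by (auto simp: representation_def)

lemma rep_inv:
  assumes "representation G \<rho>" "g \<in> carrier G"
  shows "\<rho> (inv g) * \<rho> g = 1\<^sub>m (degree_rep G \<rho>)" "\<rho> g * \<rho> (inv g) = 1\<^sub>m (degree_rep G \<rho>)"
  using rep_mult[OF assms(1), of g "inv g"] rep_mult[OF assms(1), of "inv g" g] rep_one assms
  by auto

lemma irreducible_repD:
  assumes "irreducible_rep G \<rho>"
  shows "representation G \<rho>" "0 < degree_rep G \<rho>"
  using assms by (auto simp: irreducible_rep_def)

lemma irreducible_rep_subspace:
  assumes "irreducible_rep G \<rho>"
    and "W \<subseteq> carrier_vec (degree_rep G \<rho>)" "0\<^sub>v (degree_rep G \<rho>) \<in> W"
    and "\<And>v w. v \<in> W \<Longrightarrow> w \<in> W \<Longrightarrow> v + w \<in> W"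
    and "\<And>c v. v \<in> W \<Longrightarrow> c \<cdot>\<^sub>v v \<in> W"
    and "\<And>g w. g \<in> carrier G \<Longrightarrow> w \<in> W \<Longrightarrow> \<rho> g *\<^sub>v w \<in> W"
  shows "W = {0\<^sub>v (degree_rep G \<rho>)} \<or> W = carrier_vec (degree_rep G \<rho>)"
proof -
  have "VectorSpace.subspace class_ring W (module_vec TYPE(complex) (degree_rep G \<rho>))"
    unfolding subspace_module_vec_iff using assms(2-5) by blast
  with assms(1,6) show ?thesis unfolding irreducible_rep_def by blast
qed

text \<open>The kernel of an intertwiner is invariant under \<sigma> and its image under \<rho>, so
  irreducibility leaves only the extreme cases for each. Since \<open>T\<close> is nonzero, the
  kernel is trivial and the image is everything.\<close>

theorem schur_intertwiner:
  assumes \<rho>: "irreducible_rep G \<rho>" and \<sigma>: "irreducible_rep G \<sigma>"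
    and T: "T \<in> carrier_mat (degree_rep G \<rho>) (degree_rep G \<sigma>)"
    and comm: "\<And>g. g \<in> carrier G \<Longrightarrow> \<rho> g * T = T * \<sigma> g"
    and nz: "T \<noteq> 0\<^sub>m (degree_rep G \<rho>) (degree_rep G \<sigma>)"
  shows "degree_rep G \<rho> = degree_rep G \<sigma>" "invertible_mat T"
proof -
  define m n where "m = degree_rep G \<rho>" and "n = degree_rep G \<sigma>"
  note T = T[folded m_def n_def]
  note \<rho>c = rep_carrier[OF irreducible_repD(1)[OF \<rho>], folded m_def]
  note \<sigma>c = rep_carrier[OF irreducible_repD(1)[OF \<sigma>], folded n_def]
  have move: "\<rho> g *\<^sub>v (T *\<^sub>v v) = T *\<^sub>v (\<sigma> g *\<^sub>v v)" if "g \<in> carrier G" "v \<in> carrier_vec n" for g v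
    using assoc_mult_mat_vec[OF \<rho>c[OF that(1)] T that(2)]
      assoc_mult_mat_vec[OF T \<sigma>c[OF that(1)] that(2)] comm[OF that(1)] by simp
  let ?K = "{v \<in> carrier_vec n. T *\<^sub>v v = 0\<^sub>v m}"
  let ?I = "(\<lambda>v. T *\<^sub>v v) ` carrier_vec n"
  have "?K = {0\<^sub>v n} \<or> ?K = carrier_vec n"
    unfolding n_def
  proof (rule irreducible_rep_subspace[OF \<sigma>], unfold n_def[symmetric])
    show "\<And>v w. v \<in> ?K \<Longrightarrow> w \<in> ?K \<Longrightarrow> v + w \<in> ?K"
      using mult_add_distrib_mat_vec[OF T] by auto
    show "\<And>c v. v \<in> ?K \<Longrightarrow> c \<cdot>\<^sub>v v \<in> ?K"
      using mult_mat_vec[OF T] by auto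
    show "\<sigma> g *\<^sub>v w \<in> ?K" if g: "g \<in> carrier G" and w: "w \<in> ?K" for g w
    proof -
      have "\<rho> g *\<^sub>v 0\<^sub>v m = 0\<^sub>v m" using \<rho>c[OF g] by auto
      then show ?thesis using move[OF g, of w] w \<sigma>c[OF g] by auto
    qed
  qed (use T in auto)
  moreover have "?K \<noteq> carrier_vec n"
  proof
    assume K: "?K = carrier_vec n"
    have "T = 0\<^sub>m m n"
    proof (rule mat_col_eqI)
      fix j assume "j < dim_col (0\<^sub>m m n :: complex mat)"
      then have j: "j < n" by simp
      have "unit_vec n j \<in> ?K" unfolding K by simp
      moreover have "T *\<^sub>v unit_vec n j = col T j"
        using col_mult2[OF T one_carrier_mat j] T j by simp
      ultimately show "col T j = col (0\<^sub>m m n) j" using j by simp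
    qed (use T in auto)
    then show False using nz by (simp add: m_def n_def)
  qed
  ultimately have K: "?K = {0\<^sub>v n}" by blast
  have "?I = {0\<^sub>v m} \<or> ?I = carrier_vec m"
    unfolding m_def
  proof (rule irreducible_rep_subspace[OF \<rho>], unfold m_def[symmetric])
    show "0\<^sub>v m \<in> ?I" using T by (intro image_eqI[of _ _ "0\<^sub>v n"]) auto
    show "v + w \<in> ?I" if vw: "v \<in> ?I" "w \<in> ?I" for v w
    proof -
      from vw obtain v' w' where "v' \<in> carrier_vec n" "w' \<in> carrier_vec n" "v = T *\<^sub>v v'" "w = T *\<^sub>v w'"
        by auto
      then show ?thesis
        using mult_add_distrib_mat_vec[OF T, of v' w'] by (intro image_eqI[of _ _ "v' + w'"]) auto
    qed
    show "c \<cdot>\<^sub>v v \<in> ?I" if "v \<in> ?I" for c v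
    proof -
      from that obtain v' where "v' \<in> carrier_vec n" "v = T *\<^sub>v v'" by auto
      then show ?thesis
        using mult_mat_vec[OF T, of v' c] by (intro image_eqI[of _ _ "c \<cdot>\<^sub>v v'"]) auto
    qed
    show "\<rho> g *\<^sub>v w \<in> ?I" if g: "g \<in> carrier G" and w: "w \<in> ?I" for g w
    proof -
      from w obtain v where "v \<in> carrier_vec n" "w = T *\<^sub>v v" by auto
      then show ?thesis
        using move[OF g, of v] \<sigma>c[OF g] by (intro image_eqI[of _ _ "\<sigma> g *\<^sub>v v"]) auto
    qed
  qed (use T in auto)
  moreover have "?I \<noteq> {0\<^sub>v m}"
  proof
    assume "?I = {0\<^sub>v m}"
    \<comment> \<open>Positivity of the degree, part of irreducibility, provides this nonzero
      vector, which would have to lie in the trivial kernel.\<close>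
    then have "unit_vec n 0 \<in> ?K" by auto
    then have "unit_vec n 0 = (0\<^sub>v n :: complex vec)" using K by auto
    moreover have "n > 0" using irreducible_repD[OF \<sigma>] by (simp add: n_def)
    ultimately show False by (metis index_unit_vec(1) index_zero_vec(1) zero_neq_one)
  qed
  ultimately have I: "?I = carrier_vec m" by blast
  have inj: "\<And>v. v \<in> carrier_vec n \<Longrightarrow> T *\<^sub>v v = 0\<^sub>v m \<Longrightarrow> v = 0\<^sub>v n" using K by blast
  have surj: "\<And>w. w \<in> carrier_vec m \<Longrightarrow> \<exists>v\<in>carrier_vec n. T *\<^sub>v v = w"
    unfolding I[symmetric] by blast
  from invertible_matI_bij[OF T inj surj]
  show "degree_rep G \<rho> = degree_rep G \<sigma>" "invertible_mat T" by (auto simp: m_def n_def)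
qed

text \<open>Over the complex numbers \<open>T\<close> has an eigenvalue \<open>c\<close>. The matrix
  \<open>T - c\<close> still commutes with the representation but is singular, so an intertwiner of
  this kind can only be zero.\<close>

theorem schur_scalar:
  assumes \<rho>: "irreducible_rep G \<rho>"
    and T: "T \<in> carrier_mat (degree_rep G \<rho>) (degree_rep G \<rho>)"
    and comm: "\<And>g. g \<in> carrier G \<Longrightarrow> \<rho> g * T = T * \<rho> g"
  obtains c where "T = c \<cdot>\<^sub>m 1\<^sub>m (degree_rep G \<rho>)"
proof -
  define n where "n = degree_rep G \<rho>"
  note T = T[folded n_def]
  note \<rho>c = rep_carrier[OF irreducible_repD(1)[OF \<rho>], folded n_def]
  have "n > 0" using irreducible_repD[OF \<rho>] by (simp add: n_def)
  then obtain c where "eigenvalue T c"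
    using spectrum_non_empty[OF T] by (auto simp: spectrum_def)
  then obtain v where v: "v \<in> carrier_vec n" "v \<noteq> 0\<^sub>v n" "T *\<^sub>v v = c \<cdot>\<^sub>v v"
    using T by (auto simp: eigenvalue_def eigenvector_def)
  define U where "U = T - c \<cdot>\<^sub>m 1\<^sub>m n"
  have U: "U \<in> carrier_mat n n" unfolding U_def by (intro minus_carrier_mat) simp
  have "U *\<^sub>v v = T *\<^sub>v v - (c \<cdot>\<^sub>m 1\<^sub>m n) *\<^sub>v v"
    unfolding U_def using T v by (intro minus_mult_distrib_mat_vec) auto
  also have "(c \<cdot>\<^sub>m 1\<^sub>m n) *\<^sub>v v = c \<cdot>\<^sub>v v"
    using v by (intro eq_vecI) auto
  finally have Uv: "U *\<^sub>v v = 0\<^sub>v n" using v by auto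
  have "\<not> invertible_mat U"
  proof
    assume "invertible_mat U"
    then obtain Q where Q: "Q \<in> carrier_mat n n" "Q * U = 1\<^sub>m n"
      using U by (elim invertible_matE)
    have "Q *\<^sub>v (U *\<^sub>v v) = v" using assoc_mult_mat_vec[OF Q(1) U v(1)] Q v by simp
    then show False using Uv Q v by auto
  qed
  moreover have "\<rho> g * U = U * \<rho> g" if g: "g \<in> carrier G" for g
  proof -
    have "\<rho> g * U = \<rho> g * T - \<rho> g * (c \<cdot>\<^sub>m 1\<^sub>m n)"
      unfolding U_def using \<rho>c[OF g] T by (intro mult_minus_distrib_mat) auto
    also have "\<rho> g * (c \<cdot>\<^sub>m 1\<^sub>m n) = (c \<cdot>\<^sub>m 1\<^sub>m n) * \<rho> g"
      using mult_smult_distrib[OF \<rho>c[OF g] one_carrier_mat] mult_smult_assoc_mat[OF one_carrier_mat \<rho>c[OF g]]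
        \<rho>c[OF g] by simp
    also have "\<rho> g * T - (c \<cdot>\<^sub>m 1\<^sub>m n) * \<rho> g = U * \<rho> g"
      unfolding U_def comm[OF g] using \<rho>c[OF g] T by (intro minus_mult_distrib_mat[symmetric]) auto
    finally show ?thesis .
  qed
  ultimately have "U = 0\<^sub>m n n"
    using schur_intertwiner(2)[OF \<rho> \<rho>, of U] U by (auto simp: n_def)
  have "T = c \<cdot>\<^sub>m 1\<^sub>m n"
  proof (rule eq_matI)
    fix i j assume ij: "i < dim_row (c \<cdot>\<^sub>m 1\<^sub>m n)" "j < dim_col (c \<cdot>\<^sub>m 1\<^sub>m n)"
    have "U $$ (i, j) = 0" using \<open>U = 0\<^sub>m n n\<close> ij by simp
    then show "T $$ (i, j) = (c \<cdot>\<^sub>m 1\<^sub>m n) $$ (i, j)" using ij T by (simp add: U_def)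
  qed (use T in auto)
  then show ?thesis using that by (simp add: n_def)
qed

end

text \<open>The middle factor is a matrix unit. Averaging it over the group will produce an
  intertwiner whose entries are sums of products of two matrix coefficients, which is how Schur's
  lemma turns into orthogonality.\<close>

lemma mat_unit_sandwich:
  fixes A B :: "'a :: comm_semiring_1 mat"
  assumes A: "A \<in> carrier_mat m m" and B: "B \<in> carrier_mat n n"
    and "i < m" "j < m" "k < n" "l < n"
  shows "(A * mat m n (\<lambda>(a, b). if a = j \<and> b = k then 1 else 0) * B) $$ (i, l) = A $$ (i, j) * B $$ (k, l)"
proof -
  let ?E = "mat m n (\<lambda>(a, b). if a = j \<and> b = k then 1 else 0) :: 'a mat"
  have E: "?E \<in> carrier_mat m n" by simp
  have "(A * ?E) $$ (i, b) = (if b = k then A $$ (i, j) else 0)" if b: "b < n" for b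
  proof -
    have "(A * ?E) $$ (i, b) = (\<Sum>a<m. A $$ (i, a) * ?E $$ (a, b))"
      by (rule mat_mult_entry[OF A E \<open>i < m\<close> b])
    also have "\<dots> = (\<Sum>a<m. if a = j then (if b = k then A $$ (i, j) else 0) else 0)"
      using b by (intro sum.cong) auto
    also have "\<dots> = (if b = k then A $$ (i, j) else 0)"
      using assms by simp
    finally show ?thesis .
  qed
  moreover have "(A * ?E * B) $$ (i, l) = (\<Sum>b<n. (A * ?E) $$ (i, b) * B $$ (b, l))"
    by (rule mat_mult_entry[OF _ B \<open>i < m\<close> \<open>l < n\<close>]) (use A E in auto)
  ultimately have "(A * ?E * B) $$ (i, l) = (\<Sum>b<n. (if b = k then A $$ (i, j) else 0) * B $$ (b, l))"
    by simp
  also have "\<dots> = (\<Sum>b<n. if b = k then A $$ (i, j) * B $$ (k, l) else 0)"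
    by (rule sum.cong) auto
  finally show ?thesis using assms by simp
qed

section \<open>Conjugate transposes, and invertibility from injectivity\<close>

definition conj_transpose :: "complex mat \<Rightarrow> complex mat"
  where "conj_transpose A = mat (dim_col A) (dim_row A) (\<lambda>(i, j). cnj (A $$ (j, i)))"

lemma conj_transpose_carrier [simp]:
  "A \<in> carrier_mat m n \<Longrightarrow> conj_transpose A \<in> carrier_mat n m"
  by (auto simp: conj_transpose_def)

lemma conj_transpose_entry:
  "A \<in> carrier_mat m n \<Longrightarrow> i < n \<Longrightarrow> j < m \<Longrightarrow> conj_transpose A $$ (i, j) = cnj (A $$ (j, i))"
  by (auto simp: conj_transpose_def)

lemma conj_transpose_mult:
  assumes A: "A \<in> carrier_mat m n" and B: "B \<in> carrier_mat n p"
  shows "conj_transpose (A * B) = conj_transpose B * conj_transpose A"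
proof (rule eq_matI)
  fix i j assume "i < dim_row (conj_transpose B * conj_transpose A)"
    "j < dim_col (conj_transpose B * conj_transpose A)"
  then have i: "i < p" and j: "j < m"
    using A B by (auto simp: conj_transpose_def)
  have AB: "A * B \<in> carrier_mat m p" using A B by simp
  show "conj_transpose (A * B) $$ (i, j) = (conj_transpose B * conj_transpose A) $$ (i, j)"
    unfolding conj_transpose_entry[OF AB i j] mat_mult_entry[OF A B j i]
      mat_mult_entry[OF conj_transpose_carrier[OF B] conj_transpose_carrier[OF A] i j]
    using i j by (simp add: conj_transpose_entry[OF A] conj_transpose_entry[OF B] mult.commute)
qed (use A B in \<open>auto simp: conj_transpose_def\<close>)

lemma mat_trace_conj_transpose:
  "A \<in> carrier_mat n n \<Longrightarrow> mat_trace (conj_transpose A) = cnj (mat_trace A)"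
  by (auto simp: mat_trace_def conj_transpose_def)

text \<open>For a square matrix the determinant makes injectivity alone sufficient. This suits the
  Gram matrix of an invariant form, for which only definiteness is at hand.\<close>

lemma invertible_matI_inj:
  fixes A :: "'a :: field mat"
  assumes A: "A \<in> carrier_mat n n"
    and inj: "\<And>v. v \<in> carrier_vec n \<Longrightarrow> A *\<^sub>v v = 0\<^sub>v n \<Longrightarrow> v = 0\<^sub>v n"
  shows "invertible_mat A"
proof -
  have "det A \<noteq> 0" using det_0_iff_vec_prod_zero[OF A] inj by blast
  \<comment> \<open>\<open>undefined\<close> instantiates the extension slot of the matrix ring
    record, on which \<open>Units\<close> does not depend.\<close>
  from det_non_zero_imp_unit[OF A this, of undefined]
  obtain B where "B \<in> carrier_mat n n" "B * A = 1\<^sub>m n" "A * B = 1\<^sub>m n"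
    by (auto simp: Units_def ring_mat_simps)
  then show ?thesis
    using A by (auto simp: invertible_mat_def inverts_mat_def)
qed

context group
begin

text \<open>A shift of the summation variable absorbs \<open>h\<close>: the summand \<open>F\<close>
  satisfies \<open>\<rho> h * F g = F (h \<otimes> g) * \<sigma> h\<close>, and left multiplication
  by \<open>h\<close> permutes the group.\<close>

lemma schur_average:
  assumes \<rho>: "representation G \<rho>" and \<sigma>: "representation G \<sigma>"
    and X: "X \<in> carrier_mat (degree_rep G \<rho>) (degree_rep G \<sigma>)" and h: "h \<in> carrier G"
  defines "T \<equiv> mat_sum (degree_rep G \<rho>) (degree_rep G \<sigma>) (carrier G) (\<lambda>g. \<rho> g * X * \<sigma> (inv g))"
  shows "\<rho> h * T = T * \<sigma> h"
proof -
  define m n where "m = degree_rep G \<rho>" and "n = degree_rep G \<sigma>"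
  note X = X[folded m_def n_def]
  note \<rho>c = rep_carrier[OF \<rho>, folded m_def]
  note \<sigma>c = rep_carrier[OF \<sigma>, folded n_def]
  define F where "F = (\<lambda>g. \<rho> g * X * \<sigma> (inv g))"
  have Fc: "F g \<in> carrier_mat m n" if "g \<in> carrier G" for g
    unfolding F_def using \<rho>c[of g] \<sigma>c[of "inv g"] X that by auto
  have T: "T = mat_sum m n (carrier G) F" by (simp add: T_def F_def m_def n_def)
  have step: "\<rho> h * F g = F (h \<otimes> g) * \<sigma> h" if g: "g \<in> carrier G" for g
  proof -
    have c: "\<rho> h * \<rho> g * X \<in> carrier_mat m n"
      using \<rho>c[OF h] \<rho>c[OF g] X by auto
    have "F (h \<otimes> g) * \<sigma> h = \<rho> h * \<rho> g * X * (\<sigma> (inv g) * \<sigma> (inv h)) * \<sigma> h"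
      unfolding F_def using rep_mult[OF \<rho> h g] rep_mult[OF \<sigma>, of "inv g" "inv h"] g h
      by (simp add: inv_mult_group)
    also have "\<dots> = \<rho> h * \<rho> g * X * (\<sigma> (inv g) * \<sigma> (inv h) * \<sigma> h)"
      using g h by (intro assoc_mult_mat[OF c] mult_carrier_mat) (auto intro: \<sigma>c)
    also have "\<sigma> (inv g) * \<sigma> (inv h) * \<sigma> h = \<sigma> (inv g) * (\<sigma> (inv h) * \<sigma> h)"
      using g h by (intro assoc_mult_mat) (auto intro: \<sigma>c)
    also have "\<dots> = \<sigma> (inv g)"
      using \<sigma>c[of "inv g"] g rep_inv(1)[OF \<sigma> h] by (simp add: n_def)
    also have "\<rho> h * \<rho> g * X * \<sigma> (inv g) = \<rho> h * (\<rho> g * X) * \<sigma> (inv g)"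
      by (simp only: assoc_mult_mat[OF \<rho>c[OF h] \<rho>c[OF g] X])
    also have "\<dots> = \<rho> h * F g"
      unfolding F_def using \<rho>c[OF h] \<rho>c[OF g] X \<sigma>c[of "inv g"] g
      by (intro assoc_mult_mat) auto
    finally show ?thesis by simp
  qed
  have "\<rho> h * T = mat_sum m n (carrier G) (\<lambda>g. \<rho> h * F g)"
    unfolding T by (rule mat_sum_mult_left[OF \<rho>c[OF h] Fc])
  also have "\<dots> = mat_sum m n (carrier G) (\<lambda>g. F (h \<otimes> g) * \<sigma> h)"
    by (rule mat_sum_cong) (rule step)
  also have "\<dots> = mat_sum m n (carrier G) (\<lambda>g. F g * \<sigma> h)"
    by (rule mat_sum_reindex[OF bij_betw_mult_left[OF h]])
  also have "\<dots> = T * \<sigma> h"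
    unfolding T by (rule mat_sum_mult_right[OF \<sigma>c[OF h] Fc, symmetric])
  finally show ?thesis .
qed

text \<open>The sum is an entry of the average of a matrix unit. That average intertwines \<sigma>
  with \<rho>; if it were nonzero, it would itself be the isomorphism that is excluded.\<close>

theorem matrix_coeff_orthogonal_noniso:
  assumes \<rho>: "irreducible_rep G \<rho>" and \<sigma>: "irreducible_rep G \<sigma>" and "\<not> iso_rep G \<sigma> \<rho>"
    and ij: "i < degree_rep G \<rho>" "j < degree_rep G \<rho>" and kl: "k < degree_rep G \<sigma>" "l < degree_rep G \<sigma>"
  shows "(\<Sum>g\<in>carrier G. \<rho> g $$ (i, j) * \<sigma> (inv g) $$ (k, l)) = 0"
proof -
  note \<rho>r = irreducible_repD(1)[OF \<rho>] and \<sigma>r = irreducible_repD(1)[OF \<sigma>]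
  define E where "E = mat (degree_rep G \<rho>) (degree_rep G \<sigma>) (\<lambda>(a, b). if a = j \<and> b = k then 1 else 0 :: complex)"
  define T where "T = mat_sum (degree_rep G \<rho>) (degree_rep G \<sigma>) (carrier G) (\<lambda>g. \<rho> g * E * \<sigma> (inv g))"
  have comm: "\<rho> h * T = T * \<sigma> h" if "h \<in> carrier G" for h
    unfolding T_def by (rule schur_average[OF \<rho>r \<sigma>r _ that]) (simp add: E_def)
  have "T = 0\<^sub>m (degree_rep G \<rho>) (degree_rep G \<sigma>)"
  proof (rule ccontr)
    assume "T \<noteq> 0\<^sub>m (degree_rep G \<rho>) (degree_rep G \<sigma>)"
    from schur_intertwiner[OF \<rho> \<sigma> _ comm this] have "degree_rep G \<rho> = degree_rep G \<sigma>" "invertible_mat T"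
      by (auto simp: T_def)
    then have "iso_rep G \<sigma> \<rho>"
      unfolding iso_rep_def using comm by (auto intro!: bexI[of _ T] simp: T_def)
    with assms(3) show False by simp
  qed
  then have "0 = T $$ (i, l)" using ij kl by simp
  also have "\<dots> = (\<Sum>g\<in>carrier G. (\<rho> g * E * \<sigma> (inv g)) $$ (i, l))"
    unfolding T_def using ij kl by (simp add: mat_sum_entry)
  also have "\<dots> = (\<Sum>g\<in>carrier G. \<rho> g $$ (i, j) * \<sigma> (inv g) $$ (k, l))"
    unfolding E_def using ij kl
    by (intro sum.cong mat_unit_sandwich rep_carrier[OF \<rho>r] rep_carrier[OF \<sigma>r]) auto
  finally show ?thesis by simp
qed

text \<open>The average of a matrix unit \<open>E\<close> is a scalar \<open>c\<close>, which the
  trace determines: every summand is similar to \<open>E\<close>, so degree times \<open>c\<close>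
  equals the group order times the trace of \<open>E\<close>, and that trace is 1 or 0 according to
  whether \<open>j = k\<close>.\<close>

theorem matrix_coeff_orthogonal:
  assumes \<rho>: "irreducible_rep G \<rho>"
    and ij: "i < degree_rep G \<rho>" "j < degree_rep G \<rho>" and kl: "k < degree_rep G \<rho>" "l < degree_rep G \<rho>"
  shows "(\<Sum>g\<in>carrier G. \<rho> g $$ (i, j) * \<rho> (inv g) $$ (k, l)) =
    (if i = l \<and> j = k then of_nat (card (carrier G)) / of_nat (degree_rep G \<rho>) else 0)"
proof -
  define n where "n = degree_rep G \<rho>"
  note ij = ij[folded n_def] and kl = kl[folded n_def]
  note \<rho>r = irreducible_repD(1)[OF \<rho>]
  note \<rho>c = rep_carrier[OF \<rho>r, folded n_def]
  have n0: "n > 0" using irreducible_repD(2)[OF \<rho>] by (simp add: n_def)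
  define E where "E = mat n n (\<lambda>(a, b). if a = j \<and> b = k then 1 else 0 :: complex)"
  have Ec: "E \<in> carrier_mat n n" by (simp add: E_def)
  define T where "T = mat_sum n n (carrier G) (\<lambda>g. \<rho> g * E * \<rho> (inv g))"
  have comm: "\<rho> h * T = T * \<rho> h" if "h \<in> carrier G" for h
    unfolding T_def n_def by (rule schur_average[OF \<rho>r \<rho>r _ that]) (simp add: E_def n_def)
  obtain c where c: "T = c \<cdot>\<^sub>m 1\<^sub>m n"
    using schur_scalar[OF \<rho> _ comm] by (auto simp: T_def n_def)
  have "mat_trace E = (\<Sum>a<n. if a = j then (if j = k then 1 else 0) else 0)"
    by (auto simp: mat_trace_def E_def intro!: sum.cong)
  then have trE: "mat_trace E = (if j = k then 1 else 0)"
    using ij by simp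
  have "mat_trace T = (\<Sum>g\<in>carrier G. mat_trace (\<rho> g * E * \<rho> (inv g)))"
    unfolding T_def by (rule mat_trace_mat_sum) (use \<rho>c Ec in \<open>auto intro!: mult_carrier_mat[of _ n n]\<close>)
  also have "\<dots> = (\<Sum>g\<in>carrier G. mat_trace E)"
    using rep_inv(1)[OF \<rho>r] by (intro sum.cong mat_trace_similar[OF Ec] \<rho>c) (auto simp: n_def)
  finally have "of_nat n * c = of_nat (card (carrier G)) * (if j = k then 1 else 0)"
    unfolding c trE by (simp add: mat_trace_def)
  then have c': "c = (if j = k then of_nat (card (carrier G)) / of_nat n else 0)"
    using n0 by (auto simp: field_simps)
  have "(\<Sum>g\<in>carrier G. \<rho> g $$ (i, j) * \<rho> (inv g) $$ (k, l)) =
      (\<Sum>g\<in>carrier G. (\<rho> g * E * \<rho> (inv g)) $$ (i, l))"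
    unfolding E_def using ij kl by (intro sum.cong mat_unit_sandwich[symmetric] \<rho>c) auto
  also have "\<dots> = T $$ (i, l)"
    unfolding T_def using ij kl by (simp add: mat_sum_entry)
  also have "\<dots> = (if i = l \<and> j = k then of_nat (card (carrier G)) / of_nat n else 0)"
    unfolding c c' using ij kl by simp
  finally show ?thesis by (simp add: n_def)
qed

text \<open>Weyl's unitary trick: \<open>P\<close> is the Gram matrix of an invariant inner product.\<close>

lemma rep_conj_transpose:
  assumes fin: "finite (carrier G)" and \<rho>: "representation G \<rho>"
  obtains P Q where "P \<in> carrier_mat (degree_rep G \<rho>) (degree_rep G \<rho>)"
    "Q \<in> carrier_mat (degree_rep G \<rho>) (degree_rep G \<rho>)"
    "P * Q = 1\<^sub>m (degree_rep G \<rho>)" "Q * P = 1\<^sub>m (degree_rep G \<rho>)"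
    "\<And>g. g \<in> carrier G \<Longrightarrow> conj_transpose (\<rho> (inv g)) = P * \<rho> g * Q"
proof -
  define n where "n = degree_rep G \<rho>"
  note \<rho>c = rep_carrier[OF \<rho>, folded n_def]
  define F where "F = (\<lambda>g. conj_transpose (\<rho> g) * \<rho> g)"
  define P where "P = mat_sum n n (carrier G) F"
  have Fc: "F g \<in> carrier_mat n n" if "g \<in> carrier G" for g
    unfolding F_def using \<rho>c[OF that] by (intro mult_carrier_mat[of _ n n]) auto
  have P: "P \<in> carrier_mat n n" by (simp add: P_def)
  have "invertible_mat P"
  proof (rule invertible_matI_inj[OF P])
    fix v assume v: "v \<in> carrier_vec n" and Pv: "P *\<^sub>v v = 0\<^sub>v n"
    define w where "w = (\<lambda>g k. \<Sum>j<n. \<rho> g $$ (k, j) * v $ j)"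
    \<comment> \<open>With \<open>w g\<close> the coordinates of \<open>\<rho> g\<close> applied to
      \<open>v\<close>, the form of one summand is a squared norm; hence the whole form is positive
      semidefinite.\<close>
    have quad: "(\<Sum>i<n. \<Sum>j<n. cnj (v $ i) * F g $$ (i, j) * v $ j) = (\<Sum>k<n. cnj (w g k) * w g k)"
      if g: "g \<in> carrier G" for g
    proof -
      have "F g $$ (i, j) = (\<Sum>k<n. cnj (\<rho> g $$ (k, i)) * \<rho> g $$ (k, j))" if "i < n" "j < n" for i j
        unfolding F_def
          mat_mult_entry[OF conj_transpose_carrier[OF \<rho>c[OF g]] \<rho>c[OF g] that]
        using that by (intro sum.cong) (auto simp: conj_transpose_entry[OF \<rho>c[OF g]])
      then have "(\<Sum>i<n. \<Sum>j<n. cnj (v $ i) * F g $$ (i, j) * v $ j) =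
          (\<Sum>i<n. \<Sum>j<n. \<Sum>k<n. cnj (\<rho> g $$ (k, i) * v $ i) * (\<rho> g $$ (k, j) * v $ j))"
        by (intro sum.cong) (auto simp: sum_distrib_left sum_distrib_right mult_ac intro!: sum.cong)
      also have "\<dots> = (\<Sum>i<n. \<Sum>k<n. \<Sum>j<n. cnj (\<rho> g $$ (k, i) * v $ i) * (\<rho> g $$ (k, j) * v $ j))"
        by (intro sum.cong sum.swap refl)
      also have "\<dots> = (\<Sum>k<n. \<Sum>i<n. \<Sum>j<n. cnj (\<rho> g $$ (k, i) * v $ i) * (\<rho> g $$ (k, j) * v $ j))"
        by (rule sum.swap)
      also have "\<dots> = (\<Sum>k<n. cnj (w g k) * w g k)"
        by (simp add: w_def sum_product)
      finally show ?thesis .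
    qed
    have "0 = (\<Sum>i<n. cnj (v $ i) * (P *\<^sub>v v) $ i)"
      using Pv by simp
    also have "\<dots> = (\<Sum>i<n. \<Sum>j<n. cnj (v $ i) * P $$ (i, j) * v $ j)"
      using P v by (intro sum.cong)
        (auto simp: scalar_prod_def atLeast0LessThan sum_distrib_left mult.assoc)
    also have "\<dots> = (\<Sum>i<n. \<Sum>j<n. \<Sum>g\<in>carrier G. cnj (v $ i) * F g $$ (i, j) * v $ j)"
      by (intro sum.cong) (auto simp: P_def mat_sum_entry sum_distrib_left sum_distrib_right)
    also have "\<dots> = (\<Sum>i<n. \<Sum>g\<in>carrier G. \<Sum>j<n. cnj (v $ i) * F g $$ (i, j) * v $ j)"
      by (intro sum.cong sum.swap refl)
    also have "\<dots> = (\<Sum>g\<in>carrier G. \<Sum>i<n. \<Sum>j<n. cnj (v $ i) * F g $$ (i, j) * v $ j)"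
      by (rule sum.swap)
    also have "\<dots> = (\<Sum>g\<in>carrier G. \<Sum>k<n. cnj (w g k) * w g k)"
      by (intro sum.cong quad refl)
    also have "\<dots> = of_real (\<Sum>g\<in>carrier G. \<Sum>k<n. (cmod (w g k))\<^sup>2)"
      by (simp add: complex_norm_square mult.commute del: of_real_power)
    finally have "(\<Sum>g\<in>carrier G. \<Sum>k<n. (cmod (w g k))\<^sup>2) = 0"
      by (metis of_real_eq_0_iff)
    \<comment> \<open>All summands are nonnegative, so each one vanishes. The one at the unit is the
      squared norm of \<open>v\<close> itself, which gives definiteness.\<close>
    then have "(\<Sum>k<n. (cmod (w \<one> k))\<^sup>2) = 0"
      using fin by (subst (asm) sum_nonneg_eq_0_iff) (auto intro: sum_nonneg)
    then have w0: "w \<one> k = 0" if "k < n" for k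
      using that by (subst (asm) sum_nonneg_eq_0_iff) auto
    have w1: "w \<one> k = v $ k" if "k < n" for k
    proof -
      have "w \<one> k = (\<Sum>j<n. if j = k then v $ j else 0)"
        unfolding w_def rep_one[OF \<rho>] using that by (intro sum.cong) (auto simp: n_def)
      then show ?thesis using that by simp
    qed
    show "v = 0\<^sub>v n"
      by (rule eq_vecI) (use w0 w1 v in auto)
  qed
  then obtain Q where Q: "Q \<in> carrier_mat n n" "P * Q = 1\<^sub>m n" "Q * P = 1\<^sub>m n"
    using P by (elim invertible_matE)
  have *: "conj_transpose (\<rho> (inv g)) = P * \<rho> g * Q" if g: "g \<in> carrier G" for g
  proof -
    let ?A = "conj_transpose (\<rho> (inv g))"
    have A: "?A \<in> carrier_mat n n" using \<rho>c[of "inv g"] g by auto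
    \<comment> \<open>Writing \<open>h\<close> as \<open>(h \<otimes> g) \<otimes> inv g\<close>
      brings the adjoint of \<open>\<rho> (inv g)\<close> out on the left.\<close>
    have step: "F h * \<rho> g = ?A * F (h \<otimes> g)" if h: "h \<in> carrier G" for h
    proof -
      have "\<rho> h = \<rho> (h \<otimes> g) * \<rho> (inv g)"
        using rep_mult[OF \<rho>, of "h \<otimes> g" "inv g"] g h by (simp add: m_assoc)
      then have "conj_transpose (\<rho> h) = ?A * conj_transpose (\<rho> (h \<otimes> g))"
        using conj_transpose_mult[OF \<rho>c[of "h \<otimes> g"] \<rho>c[of "inv g"]] g h by simp
      then have "F h * \<rho> g = ?A * conj_transpose (\<rho> (h \<otimes> g)) * \<rho> h * \<rho> g"
        by (simp add: F_def)
      also have "\<dots> = ?A * conj_transpose (\<rho> (h \<otimes> g)) * (\<rho> h * \<rho> g)"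
        using A \<rho>c[of "h \<otimes> g"] \<rho>c[OF g] \<rho>c[OF h] g h
        by (intro assoc_mult_mat[of _ n n _ n _ n] mult_carrier_mat[of _ n n]) auto
      also have "\<dots> = ?A * (conj_transpose (\<rho> (h \<otimes> g)) * \<rho> (h \<otimes> g))"
        unfolding rep_mult[OF \<rho> h g, symmetric] using A \<rho>c[of "h \<otimes> g"] g h
        by (intro assoc_mult_mat[of _ n n _ n _ n]) auto
      finally show ?thesis by (simp add: F_def)
    qed
    have "P * \<rho> g = mat_sum n n (carrier G) (\<lambda>h. F h * \<rho> g)"
      unfolding P_def by (rule mat_sum_mult_right[OF \<rho>c[OF g] Fc])
    also have "\<dots> = mat_sum n n (carrier G) (\<lambda>h. ?A * F (h \<otimes> g))"
      by (rule mat_sum_cong) (rule step)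
    also have "\<dots> = mat_sum n n (carrier G) (\<lambda>h. ?A * F h)"
      by (rule mat_sum_reindex[OF bij_betw_mult_right[OF g]])
    also have "\<dots> = ?A * P"
      unfolding P_def by (rule mat_sum_mult_left[OF A Fc, symmetric])
    finally have "P * \<rho> g * Q = ?A * P * Q" by simp
    also have "\<dots> = ?A * (P * Q)" by (rule assoc_mult_mat[OF A P Q(1)])
    finally show ?thesis using Q A by simp
  qed
  show ?thesis
    by (rule that[of P Q]) (use P Q * in \<open>auto simp: n_def\<close>)
qed

text \<open>Applied at \<open>inv g\<close>, the invariant form makes the adjoint of
  \<open>\<rho> g\<close> similar to \<open>\<rho> (inv g)\<close>, and similar matrices have equal
  traces.\<close>

lemma rep_trace_inv:
  assumes "finite (carrier G)" and \<rho>: "representation G \<rho>" and g: "g \<in> carrier G"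
  shows "mat_trace (\<rho> (inv g)) = cnj (mat_trace (\<rho> g))"
proof -
  from rep_conj_transpose[OF assms(1,2)] obtain P Q
    where PQ: "P \<in> carrier_mat (degree_rep G \<rho>) (degree_rep G \<rho>)"
      "Q \<in> carrier_mat (degree_rep G \<rho>) (degree_rep G \<rho>)" "Q * P = 1\<^sub>m (degree_rep G \<rho>)"
      "conj_transpose (\<rho> (inv (inv g))) = P * \<rho> (inv g) * Q"
    using g by (metis inv_closed)
  have "mat_trace (\<rho> (inv g)) = mat_trace (P * \<rho> (inv g) * Q)"
    by (rule mat_trace_similar[OF rep_carrier[OF \<rho> inv_closed[OF g]] PQ(1-3), symmetric])
  also have "\<dots> = cnj (mat_trace (\<rho> g))"
    unfolding PQ(4)[symmetric] using mat_trace_conj_transpose[OF rep_carrier[OF \<rho> g]] g by simp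
  finally show ?thesis .
qed

end


section \<open>Completeness of the matrix coefficients\<close>

lemma eq_mat_mult_vecI:
  fixes A B :: "'a :: comm_semiring_1 mat"
  assumes A: "A \<in> carrier_mat m n" and B: "B \<in> carrier_mat m n"
    and eq: "\<And>v. v \<in> carrier_vec n \<Longrightarrow> A *\<^sub>v v = B *\<^sub>v v"
  shows "A = B"
proof (rule mat_col_eqI)
  fix j assume "j < dim_col B"
  then have j: "j < n" using B by simp
  have "C *\<^sub>v unit_vec n j = col C j" if C: "C \<in> carrier_mat m n" for C :: "'a mat"
    using col_mult2[OF C one_carrier_mat j] C j by simp
  then show "col A j = col B j" using A B eq[of "unit_vec n j"] by simp
qed (use A B in auto)

context group
begin

section \<open>The left regular representation and its irreducible subspaces\<close>

definition ltrans :: "'a \<Rightarrow> ('a \<Rightarrow> complex) \<Rightarrow> 'a \<Rightarrow> complex"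
  where "ltrans g f = (\<lambda>x. if x \<in> carrier G then f (inv g \<otimes> x) else 0)"

lemma ltrans_mult:
  "g \<in> carrier G \<Longrightarrow> h \<in> carrier G \<Longrightarrow> ltrans (g \<otimes> h) f = ltrans g (ltrans h f)"
  by (auto simp: ltrans_def inv_mult_group m_assoc)

lemma ltrans_one: "f \<in> fun_alg (carrier G) \<Longrightarrow> ltrans \<one> f = f"
  by (auto simp: ltrans_def fun_alg_def)

text \<open>An invariant subspace of least positive dimension is irreducible.\<close>

lemma irreducible_rep_in_invariant_space:
  assumes fin: "finite (carrier G)" and V: "V \<subseteq> fun_alg (carrier G)" and nz: "\<exists>f\<in>V. f \<noteq> (\<lambda>_. 0)"
    and add: "\<And>f h. f \<in> V \<Longrightarrow> h \<in> V \<Longrightarrow> (\<lambda>x. f x + h x) \<in> V"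
    and scale: "\<And>c f. f \<in> V \<Longrightarrow> (\<lambda>x. c * f x) \<in> V"
    and trans: "\<And>g f. g \<in> carrier G \<Longrightarrow> f \<in> V \<Longrightarrow> ltrans g f \<in> V"
  obtains \<tau> b where "irreducible_rep G \<tau>" "b 0 \<in> V" "b 0 \<noteq> (\<lambda>_. 0)"
    "\<And>g x j. g \<in> carrier G \<Longrightarrow> j < degree_rep G \<tau> \<Longrightarrow>
       ltrans g (b j) x = (\<Sum>i<degree_rep G \<tau>. \<tau> g $$ (i, j) * b i x)"
proof -
  \<comment> \<open>Functions with pointwise addition and this scaling form an abstract vector
    space, which gives access to spans and independent sets.\<close>
  define s :: "complex \<Rightarrow> ('a \<Rightarrow> complex) \<Rightarrow> 'a \<Rightarrow> complex" where "s = (\<lambda>c f x. c * f x)"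
  interpret fs: vector_space s
    by unfold_locales (auto simp: s_def algebra_simps fun_eq_iff)
  have sum_app: "(\<Sum>i\<in>I. F i) x = (\<Sum>i\<in>I. F i x)" for I and F :: "'c \<Rightarrow> 'a \<Rightarrow> complex" and x
    by (induction I rule: infinite_finite_induct) auto
  have subV: "fs.subspace V"
  proof (rule fs.subspaceI)
    obtain f where "f \<in> V" using nz by blast
    then show "0 \<in> V" using scale[of f 0] by (simp add: zero_fun_def)
  qed (use add scale in \<open>auto simp: plus_fun_def s_def\<close>)
  \<comment> \<open>The delta functions are a finite spanning set of the function algebra; they
    bound the size of every independent subset of \<open>V\<close>.\<close>
  define D where "D = (\<lambda>g. indicator {g} :: 'a \<Rightarrow> complex) ` carrier G"
  have finD: "finite D" using fin by (simp add: D_def)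
  have spanD: "f \<in> fs.span D" if f: "f \<in> fun_alg (carrier G)" for f
  proof -
    have "f x = (\<Sum>g\<in>carrier G. s (f g) (indicator {g})) x" for x
    proof -
      have "(\<Sum>g\<in>carrier G. s (f g) (indicator {g})) x = (\<Sum>g\<in>carrier G. if x = g then f g else 0)"
        unfolding sum_app s_def by (intro sum.cong) (auto simp: indicator_def)
      then show ?thesis using fin f by (auto simp: fun_alg_def)
    qed
    then have "f = (\<Sum>g\<in>carrier G. s (f g) (indicator {g}))" by blast
    also have "\<dots> \<in> fs.span D"
      by (intro fs.span_sum fs.span_scale fs.span_base) (simp add: D_def)
    finally show ?thesis .
  qed
  define inv_sub where "inv_sub W \<longleftrightarrow> W \<subseteq> V \<and> (\<forall>g\<in>carrier G. \<forall>f\<in>W. ltrans g f \<in> W)" for W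
  \<comment> \<open>Dimensions are expressed through explicit finite bases, so that the minimum can
    be taken over plain numbers.\<close>
  define P where "P k \<longleftrightarrow>
    (\<exists>B. finite B \<and> card B = k \<and> fs.independent B \<and> inv_sub (fs.span B) \<and> k > 0)" for k
  have PI: "\<exists>B. fs.span B = W \<and> fs.independent B \<and> finite B \<and> P (card B)"
    if W: "fs.subspace W" "inv_sub W" and Wnz: "W \<noteq> {0}" for W
  proof -
    obtain B where B: "B \<subseteq> W" "fs.independent B" "W \<subseteq> fs.span B"
      using fs.maximal_independent_subset[of W] by blast
    have span: "fs.span B = W"
      using fs.span_minimal[OF B(1) W(1)] B(3) by blast
    have "B \<subseteq> fs.span D"
      using B(1) W(2) V spanD by (auto simp: inv_sub_def)
    then have finB: "finite B"
      using fs.independent_span_bound[OF finD B(2)] by blast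
    have "B \<noteq> {}" using span Wnz by auto
    then have "card B > 0" using finB by (simp add: card_gt_0_iff)
    then show ?thesis using finB B span W(2) unfolding P_def by blast
  qed
  have "inv_sub V" using trans by (auto simp: inv_sub_def)
  moreover have "V \<noteq> {0}" using nz by (auto simp: zero_fun_def)
  ultimately have "\<exists>k. P k" using PI[OF subV] by blast
  define k where "k = (LEAST k. P k)"
  have Pk: "P k" unfolding k_def using \<open>\<exists>k. P k\<close> by (rule LeastI_ex)
  have Pmin: "k \<le> k'" if "P k'" for k' unfolding k_def using that by (rule Least_le)
  from Pk obtain B where B: "finite B" "card B = k" "fs.independent B" "inv_sub (fs.span B)" "k > 0"
    by (auto simp: P_def)
  from B(1,2) obtain b where b: "bij_betw b {..<k} B"
    using ex_bij_betw_nat_finite[of B] by (auto simp: atLeast0LessThan)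
  \<comment> \<open>Coordinates with respect to the enumerated basis \<open>b\<close>: a linear
    bijection from \<open>carrier_vec k\<close> onto the span of \<open>B\<close>, along which
    subspaces of coordinate space become subspaces of functions.\<close>
  define comb where "comb v = (\<Sum>i<k. s (v $ i) (b i))" for v
  have comb_app: "comb v x = (\<Sum>i<k. v $ i * b i x)" for v x
    unfolding comb_def sum_app by (simp add: s_def)
  have comb_span: "comb v \<in> fs.span B" for v
    unfolding comb_def using b by (intro fs.span_sum fs.span_scale fs.span_base) (auto simp: bij_betw_def)
  have span_comb: "\<exists>v\<in>carrier_vec k. f = comb v" if "f \<in> fs.span B" for f
  proof -
    from that obtain u where "f = (\<Sum>w\<in>B. s (u w) w)"
      using fs.span_finite[OF B(1)] by auto
    also have "\<dots> = (\<Sum>i<k. s (u (b i)) (b i))"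
      by (rule sum.reindex_bij_betw[OF b, symmetric])
    also have "\<dots> = comb (vec k (\<lambda>i. u (b i)))"
      by (simp add: comb_def)
    finally show ?thesis by auto
  qed
  have comb_add: "comb (v + w) = comb v + comb w" if "v \<in> carrier_vec k" "w \<in> carrier_vec k" for v w
  proof
    fix x
    have "comb (v + w) x = (\<Sum>i<k. v $ i * b i x + w $ i * b i x)"
      unfolding comb_app using that by (intro sum.cong) (auto simp: distrib_right)
    then show "comb (v + w) x = (comb v + comb w) x"
      by (simp add: comb_app sum.distrib)
  qed
  have comb_smult: "comb (c \<cdot>\<^sub>v v) = s c (comb v)" if "v \<in> carrier_vec k" for c v
  proof
    fix x
    have "comb (c \<cdot>\<^sub>v v) x = (\<Sum>i<k. c * (v $ i * b i x))"
      unfolding comb_app using that by (intro sum.cong) auto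
    then show "comb (c \<cdot>\<^sub>v v) x = s c (comb v) x"
      by (simp add: comb_app s_def sum_distrib_left)
  qed
  have comb_0: "comb (0\<^sub>v k) = 0"
    by (simp add: fun_eq_iff comb_app)
  have comb_eq_0: "v = 0\<^sub>v k" if v: "v \<in> carrier_vec k" and 0: "comb v = 0" for v
  proof (rule eq_vecI)
    fix i assume "i < dim_vec (0\<^sub>v k :: complex vec)"
    then have i: "i < k" by simp
    define u where "u w = v $ (inv_into {..<k} b w)" for w
    have ub: "u (b j) = v $ j" if "j < k" for j
      using that b by (simp add: u_def bij_betw_def inv_into_f_f)
    have "(\<Sum>w\<in>B. s (u w) w) = (\<Sum>j<k. s (u (b j)) (b j))"
      by (rule sum.reindex_bij_betw[OF b, symmetric])
    also have "\<dots> = comb v"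
      unfolding comb_def by (intro sum.cong) (auto simp: ub)
    finally have "(\<Sum>w\<in>B. s (u w) w) = 0" using 0 by simp
    then have "\<forall>w\<in>B. u w = 0"
      using B(3) fs.dependent_finite[OF B(1)] by blast
    then show "v $ i = 0\<^sub>v k $ i"
      using ub[OF i] i b by (auto simp: bij_betw_def)
  qed (use v in auto)
  have comb_inj: "v = w" if v: "v \<in> carrier_vec k" and w: "w \<in> carrier_vec k" and eq: "comb v = comb w" for v w
  proof -
    have "comb (v + (-1) \<cdot>\<^sub>v w) = 0"
      using eq v w by (simp add: comb_add comb_smult)
    then have 0: "v + (-1) \<cdot>\<^sub>v w = 0\<^sub>v k"
      using v w by (intro comb_eq_0) auto
    show "v = w"
    proof (rule eq_vecI)
      fix i assume "i < dim_vec w"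
      then have i: "i < k" using w by simp
      have "(v + (-1) \<cdot>\<^sub>v w) $ i = 0" unfolding 0 using i by simp
      then show "v $ i = w $ i" using i v w by simp
    qed (use v w in auto)
  qed
  have "\<exists>t. t \<in> carrier_vec k \<and> ltrans g (b j) = comb t" if "g \<in> carrier G" "j < k" for g j
  proof -
    have "b j \<in> fs.span B" using that b by (auto simp: bij_betw_def intro: fs.span_base)
    then have "ltrans g (b j) \<in> fs.span B" using B(4) that by (auto simp: inv_sub_def)
    then show ?thesis using span_comb by blast
  qed
  then obtain t where t: "\<And>g j. g \<in> carrier G \<Longrightarrow> j < k \<Longrightarrow> t g j \<in> carrier_vec k \<and> ltrans g (b j) = comb (t g j)"
    by metis
  \<comment> \<open>Column \<open>j\<close> holds the coordinates of the translate of
    \<open>b j\<close>, so \<tau> is the translation action written in the basis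
    \<open>b\<close>.\<close>
  define \<tau> where "\<tau> g = mat k k (\<lambda>(i, j). t g j $ i)" for g
  have \<tau>c: "\<tau> g \<in> carrier_mat k k" for g by (simp add: \<tau>_def)
  have deg: "degree_rep G \<tau> = k" by (simp add: degree_rep_def \<tau>_def)
  have tb: "ltrans g (b j) x = (\<Sum>i<k. \<tau> g $$ (i, j) * b i x)" if "g \<in> carrier G" "j < k" for g j x
    using t[OF that] that by (simp add: comb_app \<tau>_def)
  have tcomb: "ltrans g (comb v) = comb (\<tau> g *\<^sub>v v)" if g: "g \<in> carrier G" and v: "v \<in> carrier_vec k" for g v
  proof
    fix x
    have "ltrans g (comb v) x = (\<Sum>j<k. v $ j * ltrans g (b j) x)"
      by (simp add: ltrans_def comb_app)
    also have "\<dots> = (\<Sum>j<k. \<Sum>i<k. v $ j * (\<tau> g $$ (i, j) * b i x))"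
      by (intro sum.cong) (auto simp: tb[OF g] sum_distrib_left)
    also have "\<dots> = (\<Sum>i<k. \<Sum>j<k. v $ j * (\<tau> g $$ (i, j) * b i x))"
      by (rule sum.swap)
    also have "\<dots> = comb (\<tau> g *\<^sub>v v) x"
      unfolding comb_app using v \<tau>c[of g]
      by (intro sum.cong) (auto simp: scalar_prod_def atLeast0LessThan sum_distrib_left sum_distrib_right mult_ac intro!: sum.cong)
    finally show "ltrans g (comb v) x = comb (\<tau> g *\<^sub>v v) x" .
  qed
  have comb_alg: "comb v \<in> fun_alg (carrier G)" for v
    using comb_span[of v] B(4) V by (auto simp: inv_sub_def)
  have \<tau>v: "\<tau> g *\<^sub>v v \<in> carrier_vec k" if "v \<in> carrier_vec k" for g v
    using \<tau>c[of g] that by simp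
  have rep: "representation G \<tau>"
    unfolding representation_def deg
  proof (intro conjI ballI)
    show "\<tau> \<one> = 1\<^sub>m k"
    proof (rule eq_mat_mult_vecI[OF \<tau>c one_carrier_mat])
      fix v :: "complex vec" assume v: "v \<in> carrier_vec k"
      have "comb (\<tau> \<one> *\<^sub>v v) = comb v"
        using tcomb[OF one_closed v] ltrans_one[OF comb_alg] by simp
      then show "\<tau> \<one> *\<^sub>v v = 1\<^sub>m k *\<^sub>v v"
        using comb_inj[OF \<tau>v v] v by simp
    qed
    show "\<tau> (g \<otimes> h) = \<tau> g * \<tau> h" if g: "g \<in> carrier G" and h: "h \<in> carrier G" for g h
    proof (rule eq_mat_mult_vecI[OF \<tau>c mult_carrier_mat[OF \<tau>c \<tau>c]])
      fix v :: "complex vec" assume v: "v \<in> carrier_vec k"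
      have "comb (\<tau> (g \<otimes> h) *\<^sub>v v) = comb (\<tau> g *\<^sub>v (\<tau> h *\<^sub>v v))"
        using tcomb[OF m_closed[OF g h] v] ltrans_mult[OF g h] tcomb[OF h v] tcomb[OF g \<tau>v[OF v]] by simp
      then have "\<tau> (g \<otimes> h) *\<^sub>v v = \<tau> g *\<^sub>v (\<tau> h *\<^sub>v v)"
        using v by (intro comb_inj \<tau>v)
      then show "\<tau> (g \<otimes> h) *\<^sub>v v = \<tau> g * \<tau> h *\<^sub>v v"
        using assoc_mult_mat_vec[OF \<tau>c \<tau>c v] by simp
    qed
  qed (use \<tau>c in auto)
  have "irreducible_rep G \<tau>"
    unfolding irreducible_rep_def deg
  proof (intro conjI allI impI)
    show "representation G \<tau>" by (rule rep)
    show "0 < k" by (rule B(5))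
    fix W
    assume "VectorSpace.subspace class_ring W (module_vec TYPE(complex) k) \<and>
      (\<forall>g\<in>carrier G. \<forall>w\<in>W. \<tau> g *\<^sub>v w \<in> W)"
    then have W: "W \<subseteq> carrier_vec k" "0\<^sub>v k \<in> W" "\<And>v w. v \<in> W \<Longrightarrow> w \<in> W \<Longrightarrow> v + w \<in> W"
      "\<And>c v. v \<in> W \<Longrightarrow> c \<cdot>\<^sub>v v \<in> W" and Winv: "\<And>g w. g \<in> carrier G \<Longrightarrow> w \<in> W \<Longrightarrow> \<tau> g *\<^sub>v w \<in> W"
      by (auto simp: subspace_module_vec_iff)
    show "W = {0\<^sub>v k} \<or> W = carrier_vec k"
    proof (cases "W = {0\<^sub>v k}")
      case False
      let ?W = "comb ` W"
      have "fs.subspace ?W"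
      proof (rule fs.subspaceI)
        show "0 \<in> ?W" using comb_0 W(2) by (metis image_eqI)
        show "x + y \<in> ?W" if "x \<in> ?W" "y \<in> ?W" for x y
        proof -
          from that obtain v w where vw: "v \<in> W" "w \<in> W" "x = comb v" "y = comb w" by auto
          have "comb (v + w) = comb v + comb w"
            by (rule comb_add) (use vw W(1) in auto)
          then have "x + y = comb (v + w)" using vw by simp
          then show ?thesis using W(3) vw by blast
        qed
        show "s c x \<in> ?W" if "x \<in> ?W" for c x
        proof -
          from that obtain v where v: "v \<in> W" "x = comb v" by auto
          then have "s c x = comb (c \<cdot>\<^sub>v v)" using comb_smult[of v c] W(1) by auto
          then show ?thesis using W(4) v by blast
        qed
      qed
      moreover have "inv_sub ?W"
        unfolding inv_sub_def
      proof (intro conjI ballI)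
        show "?W \<subseteq> V" using comb_span B(4) by (auto simp: inv_sub_def)
        show "ltrans g f \<in> ?W" if g: "g \<in> carrier G" and f: "f \<in> ?W" for g f
        proof -
          from f obtain v where v: "v \<in> W" "f = comb v" by auto
          then have "ltrans g f = comb (\<tau> g *\<^sub>v v)" using tcomb[OF g, of v] W(1) by auto
          then show ?thesis using Winv[OF g] v by blast
        qed
      qed
      moreover have "?W \<noteq> {0}"
      proof
        assume "?W = {0}"
        then have "W \<subseteq> {0\<^sub>v k}" using comb_eq_0 W(1) by blast
        then show False using False W(2) by blast
      qed
      ultimately obtain B' where B': "fs.span B' = ?W" "fs.independent B'" "finite B'" "P (card B')"
        using PI by blast
      have B'B: "B' \<subseteq> fs.span B"
      proof
        fix f assume "f \<in> B'"
        then have "f \<in> fs.span B'" by (rule fs.span_base)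
        then show "f \<in> fs.span B" unfolding B'(1) using comb_span by auto
      qed
      \<comment> \<open>The nonzero invariant space \<open>?W\<close> has dimension at least
        \<open>k\<close> by minimality. An element of the span of \<open>B\<close> outside it would
        enlarge its basis to more than \<open>k\<close> independent vectors in a space of dimension
        \<open>k\<close>.\<close>
      have "fs.span B \<subseteq> ?W"
      proof
        fix f assume f: "f \<in> fs.span B"
        show "f \<in> ?W"
        proof (rule ccontr)
          assume "f \<notin> ?W"
          then have f': "f \<notin> fs.span B'" using B'(1) by simp
          have "fs.independent (insert f B')"
            using fs.independent_insertI[OF f' B'(2)] .
          then have "card (insert f B') \<le> k"
            using fs.independent_span_bound[OF B(1), of "insert f B'"] f B'B B(2) by auto
          moreover have "f \<notin> B'" using f' fs.span_base[of f B'] by blast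
          ultimately show False using Pmin[OF B'(4)] B'(3) by simp
        qed
      qed
      have "carrier_vec k \<subseteq> W"
      proof
        fix v :: "complex vec" assume v: "v \<in> carrier_vec k"
        have "comb v \<in> ?W" by (rule subsetD[OF \<open>fs.span B \<subseteq> ?W\<close> comb_span])
        then obtain w where w: "w \<in> W" "comb v = comb w" by auto
        then have "v = w" using comb_inj[OF v, of w] W(1) by blast
        then show "v \<in> W" using w by simp
      qed
      then show ?thesis using W(1) by blast
    qed simp
  qed
  moreover have b0: "b 0 \<in> B" using b B(5) by (auto simp: bij_betw_def)
  then have "b 0 \<in> V" using B(4) fs.span_base by (auto simp: inv_sub_def)
  moreover have "b 0 \<noteq> (\<lambda>_. 0)"
    using b0 B(3) fs.dependent_zero by (auto simp: zero_fun_def)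
  ultimately show ?thesis
    using that[of \<tau> b] tb by (simp add: deg)
qed


section \<open>The matrix-valued Fourier transform on the group algebra\<close>

definition fourier :: "('a \<Rightarrow> complex mat) \<Rightarrow> ('a \<Rightarrow> complex) \<Rightarrow> complex mat"
  where "fourier \<rho> f =
    mat_sum (degree_rep G \<rho>) (degree_rep G \<rho>) (carrier G) (\<lambda>g. f g \<cdot>\<^sub>m \<rho> g)"

lemma fourier_carrier: "fourier \<rho> f \<in> carrier_mat (degree_rep G \<rho>) (degree_rep G \<rho>)"
  by (simp add: fourier_def)

lemma fourier_entry:
  assumes "representation G \<rho>" "i < degree_rep G \<rho>" "j < degree_rep G \<rho>"
  shows "fourier \<rho> f $$ (i, j) = (\<Sum>g\<in>carrier G. f g * \<rho> g $$ (i, j))"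
  unfolding fourier_def mat_sum_entry[OF assms(2,3)]
proof (rule sum.cong[OF refl])
  fix g assume "g \<in> carrier G"
  then show "(f g \<cdot>\<^sub>m \<rho> g) $$ (i, j) = f g * \<rho> g $$ (i, j)"
    using carrier_matD[OF rep_carrier[OF assms(1)]] assms(2,3) by simp
qed

lemma fourier_eq_0_iff:
  assumes "representation G \<rho>"
  shows "fourier \<rho> f = 0\<^sub>m (degree_rep G \<rho>) (degree_rep G \<rho>) \<longleftrightarrow>
    (\<forall>i<degree_rep G \<rho>. \<forall>j<degree_rep G \<rho>. (\<Sum>g\<in>carrier G. f g * \<rho> g $$ (i, j)) = 0)"
  (is "?l \<longleftrightarrow> ?r")
proof
  assume l: ?l
  show ?r
  proof (intro allI impI)
    fix i j assume ij: "i < degree_rep G \<rho>" "j < degree_rep G \<rho>"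
    have "fourier \<rho> f $$ (i, j) = 0" unfolding l using ij by simp
    then show "(\<Sum>g\<in>carrier G. f g * \<rho> g $$ (i, j)) = 0"
      by (simp only: fourier_entry[OF assms ij])
  qed
next
  assume ?r
  then show ?l
    using fourier_carrier[of \<rho> f] by (intro eq_matI) (auto simp: fourier_entry[OF assms])
qed

text \<open>Transfers the vanishing of a Fourier matrix to every family of the form
  \<open>A * \<rho> g * B\<close>. Such families arise as isomorphic representations and as adjoints
  of \<open>\<rho> (inv g)\<close>.\<close>

lemma fourier_sandwich:
  assumes \<rho>: "representation G \<rho>"
    and A: "A \<in> carrier_mat (degree_rep G \<rho>) (degree_rep G \<rho>)"
    and B: "B \<in> carrier_mat (degree_rep G \<rho>) (degree_rep G \<rho>)"
    and ij: "i < degree_rep G \<rho>" "j < degree_rep G \<rho>"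
  shows "(\<Sum>g\<in>carrier G. f g * (A * \<rho> g * B) $$ (i, j)) = (A * fourier \<rho> f * B) $$ (i, j)"
proof -
  define n where "n = degree_rep G \<rho>"
  note AB = A[folded n_def] B[folded n_def] and \<rho>c = rep_carrier[OF \<rho>, folded n_def]
    and ij = ij[folded n_def]
  have 1: "A * (f g \<cdot>\<^sub>m \<rho> g) * B = f g \<cdot>\<^sub>m (A * \<rho> g * B)" if "g \<in> carrier G" for g
    using mult_smult_distrib[OF AB(1) \<rho>c[OF that]]
      mult_smult_assoc_mat[OF mult_carrier_mat[OF AB(1) \<rho>c[OF that]] AB(2)] by simp
  have c: "f g \<cdot>\<^sub>m \<rho> g \<in> carrier_mat n n" if "g \<in> carrier G" for g
    using \<rho>c[OF that] by simp
  have "A * fourier \<rho> f * B = mat_sum n n (carrier G) (\<lambda>g. A * (f g \<cdot>\<^sub>m \<rho> g)) * B"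
    unfolding fourier_def n_def[symmetric] by (simp only: mat_sum_mult_left[OF AB(1) c])
  also have "\<dots> = mat_sum n n (carrier G) (\<lambda>g. A * (f g \<cdot>\<^sub>m \<rho> g) * B)"
    by (rule mat_sum_mult_right[OF AB(2) mult_carrier_mat[OF AB(1) c]])
  also have "\<dots> = mat_sum n n (carrier G) (\<lambda>g. f g \<cdot>\<^sub>m (A * \<rho> g * B))"
    by (rule mat_sum_cong) (rule 1)
  finally show ?thesis
    using ij AB mult_carrier_mat[OF mult_carrier_mat[OF AB(1) \<rho>c] AB(2)]
    by (auto simp: mat_sum_entry intro!: sum.cong)
qed

text \<open>The substitution of \<open>h \<otimes> g\<close> for \<open>g\<close>. It makes the
  common kernel of all Fourier transforms translation invariant, so that an irreducible subspace can
  be found inside it.\<close>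

lemma fourier_ltrans:
  assumes \<rho>: "representation G \<rho>" and h: "h \<in> carrier G"
  shows "fourier \<rho> (ltrans h f) = \<rho> h * fourier \<rho> f"
proof -
  define n where "n = degree_rep G \<rho>"
  note \<rho>c = rep_carrier[OF \<rho>, folded n_def]
  have "fourier \<rho> (ltrans h f) = mat_sum n n (carrier G) (\<lambda>g. ltrans h f (h \<otimes> g) \<cdot>\<^sub>m \<rho> (h \<otimes> g))"
    unfolding fourier_def n_def by (rule mat_sum_reindex[OF bij_betw_mult_left[OF h], symmetric])
  also have "\<dots> = mat_sum n n (carrier G) (\<lambda>g. \<rho> h * (f g \<cdot>\<^sub>m \<rho> g))"
  proof (rule mat_sum_cong)
    fix g assume g: "g \<in> carrier G"
    show "ltrans h f (h \<otimes> g) \<cdot>\<^sub>m \<rho> (h \<otimes> g) = \<rho> h * (f g \<cdot>\<^sub>m \<rho> g)"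
      using g h mult_smult_distrib[OF \<rho>c[OF h] \<rho>c[OF g]] rep_mult[OF \<rho> h g]
      by (simp add: ltrans_def m_assoc[symmetric])
  qed
  also have "\<dots> = \<rho> h * fourier \<rho> f"
    unfolding fourier_def n_def[symmetric]
    by (rule mat_sum_mult_left[OF \<rho>c[OF h], symmetric]) (use \<rho>c in auto)
  finally show ?thesis .
qed

text \<open>The functions killed by all irreducible representations form a two-sided ideal of the group
  algebra that is closed under the involution \<open>f\<^sup>*(g) = cnj (f (inv g))\<close> and acts as zero on any
  irreducible subspace it contains.  So \<open>f\<^sup>* * f = 0\<close> there, and the value at the unit is the
  squared norm of \<open>f\<close>.\<close>

theorem fourier_injective:
  assumes fin: "finite (carrier G)" and f: "f \<in> fun_alg (carrier G)"
    and zero: "\<And>\<rho>. irreducible_rep G \<rho> \<Longrightarrow> fourier \<rho> f = 0\<^sub>m (degree_rep G \<rho>) (degree_rep G \<rho>)"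
  shows "f = (\<lambda>_. 0)"
proof (rule ccontr)
  assume nz: "f \<noteq> (\<lambda>_. 0)"
  define N where "N = {f \<in> fun_alg (carrier G). \<forall>\<rho>. irreducible_rep G \<rho> \<longrightarrow>
    fourier \<rho> f = 0\<^sub>m (degree_rep G \<rho>) (degree_rep G \<rho>)}"
  have N: "f \<in> N \<longleftrightarrow> f \<in> fun_alg (carrier G) \<and> (\<forall>\<rho>. irreducible_rep G \<rho> \<longrightarrow>
      (\<forall>i<degree_rep G \<rho>. \<forall>j<degree_rep G \<rho>. (\<Sum>g\<in>carrier G. f g * \<rho> g $$ (i, j)) = 0))" for f
    unfolding N_def using fourier_eq_0_iff[OF irreducible_repD(1)] by blast
  have Nalg: "N \<subseteq> fun_alg (carrier G)" by (auto simp: N_def)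
  have Nnz: "\<exists>f\<in>N. f \<noteq> (\<lambda>_. 0)" using f zero nz by (auto simp: N_def)
  have Nadd: "(\<lambda>x. f x + h x) \<in> N" if "f \<in> N" "h \<in> N" for f h
    using that by (auto simp: N fun_alg_def distrib_right sum.distrib)
  have Nscale: "(\<lambda>x. c * f x) \<in> N" if "f \<in> N" for c f
    using that by (auto simp: N fun_alg_def mult.assoc sum_distrib_left[symmetric])
  have Ntrans: "ltrans g f \<in> N" if "g \<in> carrier G" "f \<in> N" for g f
  proof -
    have "fourier \<rho> (ltrans g f) = 0\<^sub>m (degree_rep G \<rho>) (degree_rep G \<rho>)"
      if \<rho>: "irreducible_rep G \<rho>" for \<rho>
      unfolding fourier_ltrans[OF irreducible_repD(1)[OF \<rho>] \<open>g \<in> carrier G\<close>]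
      using \<open>f \<in> N\<close> \<rho> rep_carrier[OF irreducible_repD(1)[OF \<rho>] \<open>g \<in> carrier G\<close>]
      by (simp add: N_def)
    then show ?thesis by (auto simp: N_def fun_alg_def ltrans_def)
  qed
  obtain \<tau> b where \<tau>: "irreducible_rep G \<tau>" and b0: "b 0 \<in> N" "b 0 \<noteq> (\<lambda>_. 0)"
    and act: "\<And>g x j. g \<in> carrier G \<Longrightarrow> j < degree_rep G \<tau> \<Longrightarrow>
       ltrans g (b j) x = (\<Sum>i<degree_rep G \<tau>. \<tau> g $$ (i, j) * b i x)"
    by (rule irreducible_rep_in_invariant_space[OF fin Nalg Nnz Nadd Nscale Ntrans]) (assumption | rule that)+
  define f' where "f' = (\<lambda>g. if g \<in> carrier G then cnj (b 0 (inv g)) else 0)"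
  have "f' \<in> N"
    unfolding N
  proof (intro conjI allI impI)
    show "f' \<in> fun_alg (carrier G)" by (auto simp: f'_def fun_alg_def)
    fix \<rho> i j assume \<rho>: "irreducible_rep G \<rho>" and ij: "i < degree_rep G \<rho>" "j < degree_rep G \<rho>"
    note \<rho>r = irreducible_repD(1)[OF \<rho>]
    obtain P Q where P: "P \<in> carrier_mat (degree_rep G \<rho>) (degree_rep G \<rho>)"
      and Q: "Q \<in> carrier_mat (degree_rep G \<rho>) (degree_rep G \<rho>)"
      and PQ: "\<And>g. g \<in> carrier G \<Longrightarrow> conj_transpose (\<rho> (inv g)) = P * \<rho> g * Q"
      using rep_conj_transpose[OF fin \<rho>r] by metis
    \<comment> \<open>After inverting the summation variable, the entry of
      \<open>\<rho> (inv g)\<close> is a conjugated entry of its adjoint, which equals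
      \<open>P * \<rho> g * Q\<close>. So the Fourier matrix of \<open>f'\<close> is obtained from
      that of \<open>b 0\<close>, which is zero.\<close>
    have "(\<Sum>g\<in>carrier G. f' g * \<rho> g $$ (i, j)) = (\<Sum>g\<in>carrier G. f' (inv g) * \<rho> (inv g) $$ (i, j))"
      by (rule sum.reindex_bij_betw[OF bij_betw_inv, symmetric])
    also have "\<dots> = (\<Sum>g\<in>carrier G. cnj (b 0 g * (P * \<rho> g * Q) $$ (j, i)))"
      using ij by (intro sum.cong)
        (auto simp: f'_def PQ[symmetric] conj_transpose_entry[OF rep_carrier[OF \<rho>r]])
    also have "\<dots> = cnj ((P * fourier \<rho> (b 0) * Q) $$ (j, i))"
      by (simp only: cnj_sum[symmetric] fourier_sandwich[OF \<rho>r P Q ij(2,1)])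
    also have "\<dots> = 0"
      using b0(1) \<rho> P Q ij by (simp add: N_def)
    finally show "(\<Sum>g\<in>carrier G. f' g * \<rho> g $$ (i, j)) = 0" .
  qed
  \<comment> \<open>This is the convolution of \<open>f'\<close> with \<open>b 0\<close> at the
    unit. Expanding the translates of \<open>b 0\<close> in the basis \<open>b\<close> leaves
    Fourier coefficients of \<open>f'\<close> at \<tau>, which vanish because \<tau> is
    irreducible.\<close>
  have "(\<Sum>g\<in>carrier G. f' g * b 0 (inv g)) = (\<Sum>g\<in>carrier G. f' g * ltrans g (b 0) \<one>)"
    by (intro sum.cong) (auto simp: ltrans_def)
  also have "\<dots> = (\<Sum>g\<in>carrier G. \<Sum>i<degree_rep G \<tau>. f' g * \<tau> g $$ (i, 0) * b i \<one>)"
    using irreducible_repD(2)[OF \<tau>] by (intro sum.cong) (auto simp: act sum_distrib_left mult.assoc)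
  also have "\<dots> = (\<Sum>i<degree_rep G \<tau>. (\<Sum>g\<in>carrier G. f' g * \<tau> g $$ (i, 0)) * b i \<one>)"
    by (subst sum.swap) (simp add: sum_distrib_right)
  also have "\<dots> = 0"
    using \<open>f' \<in> N\<close> \<tau> irreducible_repD(2)[OF \<tau>] by (simp add: N)
  finally have "(\<Sum>g\<in>carrier G. f' g * b 0 (inv g)) = 0" .
  moreover have "f' g * b 0 (inv g) = of_real ((cmod (b 0 (inv g)))\<^sup>2)" if "g \<in> carrier G" for g
    using that by (simp add: f'_def complex_norm_square mult.commute del: of_real_power)
  ultimately have "(\<Sum>g\<in>carrier G. of_real ((cmod (b 0 (inv g)))\<^sup>2)) = (0 :: complex)"
    by simp
  then have "(\<Sum>g\<in>carrier G. (cmod (b 0 (inv g)))\<^sup>2) = 0"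
    by (simp only: of_real_sum[symmetric] of_real_eq_0_iff)
  then have "\<forall>g\<in>carrier G. b 0 (inv g) = 0"
    using fin by (simp add: sum_nonneg_eq_0_iff)
  then have "b 0 g = 0" if "g \<in> carrier G" for g
    using that by (metis inv_closed inv_inv)
  moreover have "b 0 g = 0" if "g \<notin> carrier G" for g
    using b0(1) that by (auto simp: N fun_alg_def)
  ultimately show False using b0(2) by blast
qed

section \<open>Complete systems of irreducible representations and orthogonality of
  characters\<close>

lemma iso_rep_refl:
  assumes "representation G \<rho>"
  shows "iso_rep G \<rho> \<rho>"
proof -
  have "invertible_mat (1\<^sub>m (degree_rep G \<rho>) :: complex mat)"
    by (auto simp: invertible_mat_def inverts_mat_def intro!: exI[of _ "1\<^sub>m (degree_rep G \<rho>)"])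
  then show ?thesis
    unfolding iso_rep_def
    using left_mult_one_mat[OF rep_carrier[OF assms]] right_mult_one_mat[OF rep_carrier[OF assms]]
    by (intro conjI bexI[of _ "1\<^sub>m (degree_rep G \<rho>)"] ballI) simp_all
qed

lemma iso_repE:
  assumes \<rho>: "representation G \<rho>" and \<sigma>: "representation G \<sigma>" and iso: "iso_rep G \<rho> \<sigma>"
  obtains P Q where "P \<in> carrier_mat (degree_rep G \<sigma>) (degree_rep G \<sigma>)"
    "Q \<in> carrier_mat (degree_rep G \<sigma>) (degree_rep G \<sigma>)"
    "P * Q = 1\<^sub>m (degree_rep G \<sigma>)" "Q * P = 1\<^sub>m (degree_rep G \<sigma>)"
    "degree_rep G \<rho> = degree_rep G \<sigma>"
    "\<And>g. g \<in> carrier G \<Longrightarrow> P * \<rho> g = \<sigma> g * P"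
    "\<And>g. g \<in> carrier G \<Longrightarrow> \<rho> g = Q * \<sigma> g * P"
proof -
  define n where "n = degree_rep G \<sigma>"
  from iso obtain P where P: "P \<in> carrier_mat n n" "invertible_mat P"
    and deg: "degree_rep G \<rho> = n" and comm: "\<And>g. g \<in> carrier G \<Longrightarrow> P * \<rho> g = \<sigma> g * P"
    by (auto simp: iso_rep_def n_def)
  obtain Q where Q: "Q \<in> carrier_mat n n" "P * Q = 1\<^sub>m n" "Q * P = 1\<^sub>m n"
    using P by (elim invertible_matE)
  have "\<rho> g = Q * \<sigma> g * P" if g: "g \<in> carrier G" for g
  proof -
    note \<rho>c = rep_carrier[OF \<rho> g, unfolded deg] and \<sigma>c = rep_carrier[OF \<sigma> g, folded n_def]
    have "Q * \<sigma> g * P = Q * (P * \<rho> g)"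
      using assoc_mult_mat[OF Q(1) \<sigma>c P(1)] comm[OF g] by simp
    also have "\<dots> = Q * P * \<rho> g"
      by (rule assoc_mult_mat[OF Q(1) P(1) \<rho>c, symmetric])
    finally show ?thesis using Q \<rho>c by simp
  qed
  then show ?thesis using that[of P Q] P Q deg comm by (auto simp: n_def)
qed

text \<open>Both \<rho> and \<sigma> itself would represent the class of \<sigma>, against
  uniqueness.\<close>

lemma irrep_system_noniso:
  assumes "irrep_system G R" "\<rho> \<in> R" "\<sigma> \<in> R" "\<rho> \<noteq> \<sigma>"
  shows "\<not> iso_rep G \<sigma> \<rho>"
proof
  assume "iso_rep G \<sigma> \<rho>"
  moreover have "irreducible_rep G \<sigma>" using assms by (auto simp: irrep_system_def)
  moreover from this have "iso_rep G \<sigma> \<sigma>" by (intro iso_rep_refl irreducible_repD(1))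
  ultimately show False using assms unfolding irrep_system_def by blast
qed

text \<open>Of the diagonal entries in the trace only the one at \<open>k\<close> can pair with the
  coefficient \<open>(k, l)\<close>. Pairing a character with a single coefficient, rather than two
  characters, is what the Fourier matrices of a sum of characters require.\<close>

lemma sum_trace_coeff:
  assumes R: "irrep_system G R" "\<rho> \<in> R" "\<sigma> \<in> R" and kl: "k < degree_rep G \<sigma>" "l < degree_rep G \<sigma>"
  shows "(\<Sum>g\<in>carrier G. mat_trace (\<rho> (inv g)) * \<sigma> g $$ (k, l)) =
    (if \<rho> = \<sigma> \<and> k = l then of_nat (card (carrier G)) / of_nat (degree_rep G \<rho>) else 0)"
proof -
  have irr: "irreducible_rep G \<rho>" "irreducible_rep G \<sigma>" using R by (auto simp: irrep_system_def)
  let ?c = "of_nat (card (carrier G)) / of_nat (degree_rep G \<rho>) :: complex"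
  have "(\<Sum>g\<in>carrier G. mat_trace (\<rho> (inv g)) * \<sigma> g $$ (k, l)) =
      (\<Sum>g\<in>carrier G. \<Sum>i<degree_rep G \<rho>. \<sigma> g $$ (k, l) * \<rho> (inv g) $$ (i, i))"
    using irr by (intro sum.cong)
      (auto simp: mat_trace_eq[OF rep_carrier[OF irreducible_repD(1)]] sum_distrib_left mult.commute)
  also have "\<dots> = (\<Sum>i<degree_rep G \<rho>. \<Sum>g\<in>carrier G. \<sigma> g $$ (k, l) * \<rho> (inv g) $$ (i, i))"
    by (rule sum.swap)
  also have "\<dots> = (\<Sum>i<degree_rep G \<rho>. if i = k then (if \<rho> = \<sigma> \<and> k = l then ?c else 0) else 0)"
  proof (rule sum.cong[OF refl])
    fix i assume "i \<in> {..<degree_rep G \<rho>}"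
    then have i: "i < degree_rep G \<rho>" by simp
    show "(\<Sum>g\<in>carrier G. \<sigma> g $$ (k, l) * \<rho> (inv g) $$ (i, i)) =
        (if i = k then (if \<rho> = \<sigma> \<and> k = l then ?c else 0) else 0)"
    proof (cases "\<rho> = \<sigma>")
      case True
      then show ?thesis using matrix_coeff_orthogonal[OF irr(2) kl, of i i] i by auto
    next
      case False
      then have "\<not> iso_rep G \<rho> \<sigma>" using irrep_system_noniso[OF R(1,3,2)] by auto
      then show ?thesis
        using matrix_coeff_orthogonal_noniso[OF irr(2,1) _ kl i i] False by simp
    qed
  qed
  also have "\<dots> = (if \<rho> = \<sigma> \<and> k = l then ?c else 0)"
    using kl by auto
  finally show ?thesis .
qed

lemma sum_trace_trace:
  assumes R: "irrep_system G R" "\<rho> \<in> R" "\<sigma> \<in> R"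
  shows "(\<Sum>g\<in>carrier G. mat_trace (\<rho> (inv g)) * mat_trace (\<sigma> g)) =
    (if \<rho> = \<sigma> then of_nat (card (carrier G)) else 0)"
proof -
  have irr: "irreducible_rep G \<sigma>" using R by (auto simp: irrep_system_def)
  have "(\<Sum>g\<in>carrier G. mat_trace (\<rho> (inv g)) * mat_trace (\<sigma> g)) =
      (\<Sum>g\<in>carrier G. \<Sum>k<degree_rep G \<sigma>. mat_trace (\<rho> (inv g)) * \<sigma> g $$ (k, k))"
    using irr by (intro sum.cong)
      (auto simp: mat_trace_eq[OF rep_carrier[OF irreducible_repD(1)]] sum_distrib_left)
  also have "\<dots> = (\<Sum>k<degree_rep G \<sigma>. \<Sum>g\<in>carrier G. mat_trace (\<rho> (inv g)) * \<sigma> g $$ (k, k))"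
    by (rule sum.swap)
  also have "\<dots> = (if \<rho> = \<sigma> then of_nat (card (carrier G)) else 0)"
    using irreducible_repD(2)[OF irr] by (simp add: sum_trace_coeff[OF R])
  finally show ?thesis .
qed

text \<open>Bessel's inequality for the delta function at the unit bounds the sum of the squared degrees.\<close>

lemma finite_irrep_system:
  assumes fin: "finite (carrier G)" and R: "irrep_system G R"
  shows "finite R"
proof (rule ccontr)
  assume "infinite R"
  \<comment> \<open>One representation more than the group has elements is already too many, since
    every squared degree is at least 1.\<close>
  then obtain F where F: "F \<subseteq> R" "finite F" "card F = Suc (card (carrier G))"
    using infinite_arbitrarily_large by blast
  let ?d = "\<lambda>\<rho>. of_nat (degree_rep G \<rho>) :: complex"
  define N where "N = card (carrier G)"
  have N0: "N > 0" using fin by (auto simp: N_def card_gt_0_iff)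
  have irr: "irreducible_rep G \<rho>" if "\<rho> \<in> F" for \<rho> using that F R by (auto simp: irrep_system_def)
  \<comment> \<open>The part of the expansion of the delta function that involves only
    \<open>F\<close>.\<close>
  define f where "f g = (\<Sum>\<rho>\<in>F. ?d \<rho> / of_nat N * mat_trace (\<rho> g))" for g
  define \<delta> where "\<delta> g = (if g = \<one> then 1 else 0 :: complex)" for g
  define q where "q = (\<Sum>\<rho>\<in>F. ?d \<rho> ^ 2)"
  have cnjf: "cnj (f g) = f (inv g)" if "g \<in> carrier G" for g
    using rep_trace_inv[OF fin irreducible_repD(1)[OF irr] that] by (simp add: f_def)
  have f1: "f \<one> = q / of_nat N"
  proof -
    have "mat_trace (\<rho> \<one>) = ?d \<rho>" if "\<rho> \<in> F" for \<rho>
      using rep_one[OF irreducible_repD(1)[OF irr[OF that]]] by (simp add: mat_trace_def)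
    then show ?thesis
      by (simp add: f_def q_def sum_divide_distrib power2_eq_square)
  qed
  have "(\<Sum>g\<in>carrier G. f (inv g) * f g) =
      (\<Sum>g\<in>carrier G. \<Sum>\<rho>\<in>F. \<Sum>\<sigma>\<in>F. ?d \<rho> / of_nat N * (?d \<sigma> / of_nat N) *
         (mat_trace (\<rho> (inv g)) * mat_trace (\<sigma> g)))"
    unfolding f_def sum_product by (intro sum.cong refl) simp
  also have "\<dots> = (\<Sum>\<rho>\<in>F. \<Sum>g\<in>carrier G. \<Sum>\<sigma>\<in>F. ?d \<rho> / of_nat N * (?d \<sigma> / of_nat N) *
         (mat_trace (\<rho> (inv g)) * mat_trace (\<sigma> g)))"
    by (rule sum.swap)
  also have "\<dots> = (\<Sum>\<rho>\<in>F. \<Sum>\<sigma>\<in>F. \<Sum>g\<in>carrier G. ?d \<rho> / of_nat N * (?d \<sigma> / of_nat N) *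
         (mat_trace (\<rho> (inv g)) * mat_trace (\<sigma> g)))"
    by (intro sum.cong sum.swap refl)
  also have "\<dots> = (\<Sum>\<rho>\<in>F. \<Sum>\<sigma>\<in>F. if \<rho> = \<sigma> then ?d \<rho> ^ 2 / of_nat N else 0)"
  proof (intro sum.cong refl)
    fix \<rho> \<sigma> assume "\<rho> \<in> F" "\<sigma> \<in> F"
    then have "\<rho> \<in> R" "\<sigma> \<in> R" using F by auto
    then show "(\<Sum>g\<in>carrier G. ?d \<rho> / of_nat N * (?d \<sigma> / of_nat N) * (mat_trace (\<rho> (inv g)) * mat_trace (\<sigma> g)))
        = (if \<rho> = \<sigma> then ?d \<rho> ^ 2 / of_nat N else 0)"
      unfolding sum_distrib_left[symmetric] sum_trace_trace[OF R \<open>\<rho> \<in> R\<close> \<open>\<sigma> \<in> R\<close>]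
      using N0 by (auto simp: N_def[symmetric] power2_eq_square)
  qed
  also have "\<dots> = q / of_nat N"
    using F(2) by (simp add: q_def sum_divide_distrib)
  finally have ff: "(\<Sum>g\<in>carrier G. f (inv g) * f g) = q / of_nat N" .
  have \<delta>s: "(\<Sum>g\<in>carrier G. \<delta> g * h g) = h \<one>" for h
  proof -
    have "(\<Sum>g\<in>carrier G. \<delta> g * h g) = (\<Sum>g\<in>carrier G. if g = \<one> then h \<one> else 0)"
      by (intro sum.cong) (auto simp: \<delta>_def)
    then show ?thesis using fin by simp
  qed
  have cnj\<delta>: "cnj (\<delta> g) = \<delta> g" for g
    by (simp add: \<delta>_def)
  \<comment> \<open>Both mixed terms and the square of \<open>f\<close> have the value
    \<open>q / of_nat N\<close>, so the squared distance from \<delta> to \<open>f\<close> is 1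
    minus this number.\<close>
  have "of_real (\<Sum>g\<in>carrier G. (cmod (\<delta> g - f g))\<^sup>2) = (\<Sum>g\<in>carrier G. (\<delta> g - f g) * (\<delta> g - f (inv g)))"
    by (simp add: complex_norm_square cnjf cnj\<delta> del: of_real_power cong: sum.cong)
  also have "\<dots> = (\<Sum>g\<in>carrier G. \<delta> g * \<delta> g) - (\<Sum>g\<in>carrier G. \<delta> g * f (inv g)) -
      (\<Sum>g\<in>carrier G. \<delta> g * f g) + (\<Sum>g\<in>carrier G. f (inv g) * f g)"
    by (simp add: algebra_simps sum.distrib sum_subtractf)
  also have "\<dots> = 1 - q / of_nat N"
    unfolding \<delta>s ff by (simp add: f1 \<delta>_def)
  finally have "of_real (\<Sum>g\<in>carrier G. (cmod (\<delta> g - f g))\<^sup>2) = 1 - q / of_nat N" .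
  moreover have "q = of_real (\<Sum>\<rho>\<in>F. real (degree_rep G \<rho>) ^ 2)"
    by (simp add: q_def)
  ultimately have "of_real (\<Sum>g\<in>carrier G. (cmod (\<delta> g - f g))\<^sup>2) =
      (of_real (1 - (\<Sum>\<rho>\<in>F. real (degree_rep G \<rho>) ^ 2) / real N) :: complex)"
    by simp
  then have "(\<Sum>g\<in>carrier G. (cmod (\<delta> g - f g))\<^sup>2) = 1 - (\<Sum>\<rho>\<in>F. real (degree_rep G \<rho>) ^ 2) / real N"
    by (simp only: of_real_eq_iff)
  moreover have "(\<Sum>g\<in>carrier G. (cmod (\<delta> g - f g))\<^sup>2) \<ge> 0"
    by (intro sum_nonneg) auto
  ultimately have "(\<Sum>\<rho>\<in>F. real (degree_rep G \<rho>) ^ 2) / real N \<le> 1"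
    by linarith
  then have "(\<Sum>\<rho>\<in>F. real (degree_rep G \<rho>) ^ 2) \<le> real N"
    using N0 by (simp add: divide_le_eq)
  moreover have "(\<Sum>\<rho>\<in>F. 1) \<le> (\<Sum>\<rho>\<in>F. real (degree_rep G \<rho>) ^ 2)"
  proof (rule sum_mono)
    fix \<rho> assume "\<rho> \<in> F"
    then have "1 \<le> degree_rep G \<rho>" using irreducible_repD(2)[OF irr] by fastforce
    then show "1 \<le> real (degree_rep G \<rho>) ^ 2" by simp
  qed
  ultimately show False using F(3) by (simp add: N_def)
qed

text \<open>By orthogonality the two sides have the same Fourier matrices at the members of
  \<open>R\<close>. Every irreducible representation is conjugate to a member, so the Fourier
  matrices agree everywhere and injectivity applies.\<close>

theorem sum_degree_trace:
  assumes fin: "finite (carrier G)" and R: "irrep_system G R" and x: "x \<in> carrier G"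
  shows "(\<Sum>\<rho>\<in>R. of_nat (degree_rep G \<rho>) / of_nat (card (carrier G)) * mat_trace (\<rho> x)) =
    (if x = \<one> then 1 else 0)"
proof -
  let ?N = "of_nat (card (carrier G)) :: complex"
  let ?d = "\<lambda>\<rho>. of_nat (degree_rep G \<rho>) :: complex"
  have N0: "?N \<noteq> 0" using fin by (auto simp: card_gt_0_iff)
  have finR: "finite R" by (rule finite_irrep_system[OF fin R])
  \<comment> \<open>The trace is taken at \<open>inv g\<close> because orthogonality pairs
    \<open>\<rho> (inv g)\<close> with \<open>\<sigma> g\<close>; evaluating at \<open>inv x\<close>
    in the end undoes the inversion.\<close>
  define h where "h g = (if g \<in> carrier G then
    (if g = \<one> then 1 else 0) - (\<Sum>\<rho>\<in>R. ?d \<rho> / ?N * mat_trace (\<rho> (inv g))) else 0)" for g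
  have zero: "fourier \<sigma> h = 0\<^sub>m (degree_rep G \<sigma>) (degree_rep G \<sigma>)" if \<sigma>: "\<sigma> \<in> R" for \<sigma>
  proof -
    have irr: "irreducible_rep G \<sigma>" using \<sigma> R by (auto simp: irrep_system_def)
    note \<sigma>r = irreducible_repD(1)[OF irr]
    have d0: "?d \<sigma> \<noteq> 0" using irreducible_repD(2)[OF irr] by simp
    show ?thesis
      unfolding fourier_eq_0_iff[OF \<sigma>r]
    proof (intro allI impI)
      fix k l assume kl: "k < degree_rep G \<sigma>" "l < degree_rep G \<sigma>"
      have "(\<Sum>g\<in>carrier G. h g * \<sigma> g $$ (k, l)) =
          (\<Sum>g\<in>carrier G. (if g = \<one> then \<sigma> \<one> $$ (k, l) else 0) -
             (\<Sum>\<rho>\<in>R. ?d \<rho> / ?N * (mat_trace (\<rho> (inv g)) * \<sigma> g $$ (k, l))))"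
        by (intro sum.cong) (auto simp: h_def left_diff_distrib sum_distrib_right mult.assoc)
      also have "\<dots> = \<sigma> \<one> $$ (k, l) -
          (\<Sum>g\<in>carrier G. \<Sum>\<rho>\<in>R. ?d \<rho> / ?N * (mat_trace (\<rho> (inv g)) * \<sigma> g $$ (k, l)))"
        using fin by (simp add: sum_subtractf)
      also have "(\<Sum>g\<in>carrier G. \<Sum>\<rho>\<in>R. ?d \<rho> / ?N * (mat_trace (\<rho> (inv g)) * \<sigma> g $$ (k, l))) =
          (\<Sum>\<rho>\<in>R. ?d \<rho> / ?N * (\<Sum>g\<in>carrier G. mat_trace (\<rho> (inv g)) * \<sigma> g $$ (k, l)))"
        unfolding sum_distrib_left by (rule sum.swap)
      also have "\<dots> = (\<Sum>\<rho>\<in>R. if \<rho> = \<sigma> then (if k = l then 1 else 0) else 0)"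
      proof (rule sum.cong[OF refl])
        fix \<rho> assume "\<rho> \<in> R"
        then show "?d \<rho> / ?N * (\<Sum>g\<in>carrier G. mat_trace (\<rho> (inv g)) * \<sigma> g $$ (k, l)) =
            (if \<rho> = \<sigma> then (if k = l then 1 else 0) else 0)"
          unfolding sum_trace_coeff[OF R \<open>\<rho> \<in> R\<close> \<sigma> kl] using N0 d0 by auto
      qed
      also have "\<dots> = (if k = l then 1 else 0)"
        using finR \<sigma> by simp
      finally show "(\<Sum>g\<in>carrier G. h g * \<sigma> g $$ (k, l)) = 0"
        using rep_one[OF \<sigma>r] kl by simp
    qed
  qed
  have "h = (\<lambda>_. 0)"
  proof (rule fourier_injective[OF fin])
    show "h \<in> fun_alg (carrier G)" by (simp add: h_def fun_alg_def)
    fix \<tau> assume \<tau>: "irreducible_rep G \<tau>"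
    then obtain \<sigma> where \<sigma>: "\<sigma> \<in> R" "iso_rep G \<tau> \<sigma>" using R by (auto simp: irrep_system_def)
    have \<sigma>r: "representation G \<sigma>" using \<sigma> R by (auto simp: irrep_system_def irreducible_repD)
    from iso_repE[OF irreducible_repD(1)[OF \<tau>] \<sigma>r \<sigma>(2)] obtain P Q where
      P: "P \<in> carrier_mat (degree_rep G \<sigma>) (degree_rep G \<sigma>)" and
      Q: "Q \<in> carrier_mat (degree_rep G \<sigma>) (degree_rep G \<sigma>)" and
      deg: "degree_rep G \<tau> = degree_rep G \<sigma>" and
      sim: "\<And>g. g \<in> carrier G \<Longrightarrow> \<tau> g = Q * \<sigma> g * P"
      by metis
    show "fourier \<tau> h = 0\<^sub>m (degree_rep G \<tau>) (degree_rep G \<tau>)"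
      unfolding fourier_eq_0_iff[OF irreducible_repD(1)[OF \<tau>]] unfolding deg
    proof (intro allI impI)
      fix i j assume ij: "i < degree_rep G \<sigma>" "j < degree_rep G \<sigma>"
      have "(\<Sum>g\<in>carrier G. h g * \<tau> g $$ (i, j)) = (Q * fourier \<sigma> h * P) $$ (i, j)"
        by (simp add: sim fourier_sandwich[OF \<sigma>r Q P ij, symmetric])
      then show "(\<Sum>g\<in>carrier G. h g * \<tau> g $$ (i, j)) = 0"
        using zero[OF \<sigma>(1)] P Q ij by simp
    qed
  qed
  then have "h (inv x) = 0" by simp
  moreover have "inv x = \<one> \<longleftrightarrow> x = \<one>" using x by (metis inv_inv inv_one)
  ultimately show ?thesis using x by (simp add: h_def)
qed



section \<open>Conjugacy classes\<close>

lemma inv_mult_cancel: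
  assumes "g \<in> carrier G" "z \<in> carrier G"
  shows "inv g \<otimes> (g \<otimes> z) = z" "g \<otimes> (inv g \<otimes> z) = z"
  using assms by (simp_all add: m_assoc[symmetric])

text \<open>Naming a class by a member allows class functions to be summed over group
  elements.\<close>

definition conj_class :: "'a \<Rightarrow> 'a set"
  where "conj_class c = {g \<otimes> c \<otimes> inv g | g. g \<in> carrier G}"

lemma conj_class_in: "c \<in> carrier G \<Longrightarrow> conj_class c \<in> conj_classes G"
  unfolding conj_classes_def orbits_def orbit_def conj_class_def by auto

lemma conj_class_self: "c \<in> carrier G \<Longrightarrow> c \<in> conj_class c"
  unfolding conj_class_def by (auto intro!: exI[of _ \<one>])

lemma conj_class_subset: "c \<in> carrier G \<Longrightarrow> conj_class c \<subseteq> carrier G"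
  unfolding conj_class_def by auto

lemma conj_class_trans:
  assumes "c \<in> carrier G" "x \<in> conj_class c"
  shows "conj_class x = conj_class c"
proof -
  from assms obtain g where g: "g \<in> carrier G" "x = g \<otimes> c \<otimes> inv g" by (auto simp: conj_class_def)
  have "h \<otimes> x \<otimes> inv h = (h \<otimes> g) \<otimes> c \<otimes> inv (h \<otimes> g)" if "h \<in> carrier G" for h
    using that g assms(1) by (simp add: inv_mult_group m_assoc)
  moreover have "h \<otimes> c \<otimes> inv h = (h \<otimes> inv g) \<otimes> x \<otimes> inv (h \<otimes> inv g)" if "h \<in> carrier G" for h
    using that g assms(1) by (simp add: inv_mult_group m_assoc inv_mult_cancel)
  ultimately show ?thesis
    unfolding conj_class_def using g(1) by (blast intro: m_closed inv_closed)
qed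

lemma conj_classesE:
  assumes "C \<in> conj_classes G"
  obtains c where "c \<in> carrier G" "C = conj_class c"
  using assms unfolding conj_classes_def orbits_def orbit_def conj_class_def by auto

lemma conj_classes_eq:
  assumes "C \<in> conj_classes G" "c \<in> C"
  shows "C = conj_class c" "c \<in> carrier G"
  using assms conj_class_trans conj_class_subset by (metis conj_classesE subsetD)+

lemma conj_classes_nonempty: "C \<in> conj_classes G \<Longrightarrow> \<exists>c. c \<in> C"
  by (metis conj_classesE conj_class_self)

lemma conj_class_inv:
  assumes "c \<in> carrier G" "x \<in> conj_class c"
  shows "inv x \<in> conj_class (inv c)"
proof -
  from assms obtain g where "g \<in> carrier G" "x = g \<otimes> c \<otimes> inv g" by (auto simp: conj_class_def)
  then have "inv x = g \<otimes> inv c \<otimes> inv g" using assms(1) by (simp add: inv_mult_group m_assoc)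
  then show ?thesis using \<open>g \<in> carrier G\<close> by (auto simp: conj_class_def)
qed

lemma sym_part_subset: "sym_part G S \<subseteq> S"
  by (auto simp: sym_part_def)

lemma sym_part_class:
  assumes "C \<in> conj_classes G" "c \<in> C"
  shows "C \<subseteq> sym_part G S \<longleftrightarrow> c \<in> sym_part G S"
proof
  assume "c \<in> sym_part G S"
  then obtain D where D: "D \<in> conj_classes G" "D \<subseteq> S" "set_inv D \<subseteq> S" "c \<in> D"
    by (auto simp: sym_part_def)
  then have "D = C" using conj_classes_eq assms by metis
  then show "C \<subseteq> sym_part G S" using D by (auto simp: sym_part_def)
qed (use assms in auto)

text \<open>The class of \<open>inv c\<close> consists of the inverses of the class of
  \<open>c\<close>, so the two containments that define the symmetric part just change
  places.\<close>

lemma sym_part_inv: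
  assumes S: "\<exists>\<C>. \<C> \<subseteq> conj_classes G \<and> S = \<Union>\<C>" and c: "c \<in> sym_part G S"
  shows "inv c \<in> sym_part G S"
proof -
  from c obtain D where D: "D \<in> conj_classes G" "D \<subseteq> S" "set_inv D \<subseteq> S" "c \<in> D"
    by (auto simp: sym_part_def)
  have Dc: "D = conj_class c" and cG: "c \<in> carrier G" using conj_classes_eq[OF D(1,4)] by auto
  have "inv x \<in> S \<and> inv (inv x) \<in> S" if x: "x \<in> conj_class (inv c)" for x
  proof -
    have "inv x \<in> D" unfolding Dc using conj_class_inv[OF _ x] cG by simp
    then show ?thesis using D by (auto simp: SET_INV_def)
  qed
  moreover have "x \<in> carrier G" if "x \<in> conj_class (inv c)" for x
    using conj_class_subset[of "inv c"] cG that by auto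
  ultimately have "conj_class (inv c) \<subseteq> S" "set_inv (conj_class (inv c)) \<subseteq> S"
    by (auto simp: SET_INV_def)
  then show ?thesis
    using conj_class_in[of "inv c"] conj_class_self[of "inv c"] cG by (auto simp: sym_part_def)
qed

text \<open>The classes contained in the symmetric part partition it. The kernel is handled element
  by element while the conditions are stated class by class; this identity passes between
  them.\<close>

lemma sum_sym_part_classes:
  fixes F :: "'a set \<Rightarrow> complex"
  assumes fin: "finite (carrier G)" and S: "S \<subseteq> carrier G"
  shows "(\<Sum>C\<in>{C \<in> conj_classes G. C \<subseteq> sym_part G S}. F C * of_nat (card C)) =
    (\<Sum>c\<in>sym_part G S. F (conj_class c))"
proof -
  let ?A = "{C \<in> conj_classes G. C \<subseteq> sym_part G S}"
  have U: "sym_part G S = \<Union>?A"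
  proof (intro equalityI subsetI)
    fix c assume c: "c \<in> sym_part G S"
    then have cG: "c \<in> carrier G" using S sym_part_subset by blast
    then show "c \<in> \<Union>?A"
      using c sym_part_class[OF conj_class_in[OF cG] conj_class_self[OF cG], of S]
        conj_class_in[OF cG] conj_class_self[OF cG] by blast
  qed auto
  have finC: "finite C" if "C \<in> ?A" for C
  proof -
    have "C \<subseteq> carrier G" using that S sym_part_subset by blast
    then show ?thesis using fin finite_subset by blast
  qed
  have disj: "\<forall>A\<in>?A. \<forall>B\<in>?A. A \<noteq> B \<longrightarrow> A \<inter> B = {}"
    using conj_classes_eq(1) by blast
  have "(\<Sum>c\<in>sym_part G S. F (conj_class c)) = (\<Sum>c\<in>\<Union>?A. F (conj_class c))"
    by (simp only: U[symmetric])
  also have "\<dots> = (\<Sum>C\<in>?A. \<Sum>c\<in>C. F (conj_class c))"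
    using sum.Union_disjoint[of ?A "\<lambda>c. F (conj_class c)"] finC disj by (simp add: comp_def)
  also have "\<dots> = (\<Sum>C\<in>?A. F C * of_nat (card C))"
  proof (rule sum.cong[OF refl])
    fix C assume "C \<in> ?A"
    then have "(\<Sum>c\<in>C. F (conj_class c)) = (\<Sum>c\<in>C. F C)"
      using conj_classes_eq(1) by (intro sum.cong) auto
    then show "(\<Sum>c\<in>C. F (conj_class c)) = F C * of_nat (card C)" by (simp add: mult.commute)
  qed
  finally show ?thesis by simp
qed




section \<open>Operators diagonal on the matrix coefficients\<close>

lemma linear_on_fun_algD:
  assumes "linear_on_fun_alg G L"
  shows "L \<in> fun_alg (carrier G) \<rightarrow> fun_alg (carrier G)"
    and "\<And>a b. a \<in> fun_alg (carrier G) \<Longrightarrow> b \<in> fun_alg (carrier G) \<Longrightarrow>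
      L (\<lambda>x. a x + b x) = (\<lambda>x. L a x + L b x)"
    and "\<And>k a. a \<in> fun_alg (carrier G) \<Longrightarrow> L (\<lambda>x. k * a x) = (\<lambda>x. k * L a x)"
proof -
  note D = assms[unfolded linear_on_fun_alg_def]
  show "L \<in> fun_alg (carrier G) \<rightarrow> fun_alg (carrier G)"
    by (rule D[THEN conjunct1])
  show "L (\<lambda>x. a x + b x) = (\<lambda>x. L a x + L b x)"
    if "a \<in> fun_alg (carrier G)" "b \<in> fun_alg (carrier G)" for a b
    by (rule D[THEN conjunct2, THEN conjunct1, rule_format, OF that])
  show "L (\<lambda>x. k * a x) = (\<lambda>x. k * L a x)" if "a \<in> fun_alg (carrier G)" for k a
    by (rule D[THEN conjunct2, THEN conjunct2, rule_format, OF that])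
qed

lemma linear_on_fun_alg_sum:
  assumes L: "linear_on_fun_alg G L" and "finite I" and F: "\<And>i. i \<in> I \<Longrightarrow> F i \<in> fun_alg (carrier G)"
  shows "L (\<lambda>x. \<Sum>i\<in>I. k i * F i x) = (\<lambda>x. \<Sum>i\<in>I. k i * L (F i) x)"
  using \<open>finite I\<close> F
proof (induction I)
  case empty
  have "(\<lambda>_. 0) \<in> fun_alg (carrier G)" by (simp add: fun_alg_def)
  \<comment> \<open>The zero function is written as a multiple by 0, so that homogeneity yields its
    image.\<close>
  then have "L (\<lambda>x. 0 * (\<lambda>_. 0) x) = (\<lambda>x. 0 * L (\<lambda>_. 0) x)"
    by (rule linear_on_fun_algD(3)[OF L])
  then show ?case by simp
next
  case (insert i I)
  have kF: "(\<lambda>x. k i * F i x) \<in> fun_alg (carrier G)" "(\<lambda>x. \<Sum>j\<in>I. k j * F j x) \<in> fun_alg (carrier G)"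
    using insert.prems by (auto simp: fun_alg_def intro!: sum.neutral)
  have "L (\<lambda>x. \<Sum>j\<in>insert i I. k j * F j x) = L (\<lambda>x. k i * F i x + (\<Sum>j\<in>I. k j * F j x))"
    using insert.hyps by simp
  also have "\<dots> = (\<lambda>x. L (\<lambda>x. k i * F i x) x + L (\<lambda>x. \<Sum>j\<in>I. k j * F j x) x)"
    by (rule linear_on_fun_algD(2)[OF L kF])
  also have "L (\<lambda>x. k i * F i x) = (\<lambda>x. k i * L (F i) x)"
    by (rule linear_on_fun_algD(3)[OF L insert.prems[OF insertI1]])
  also have "L (\<lambda>x. \<Sum>j\<in>I. k j * F j x) = (\<lambda>x. \<Sum>j\<in>I. k j * L (F j) x)"
    using insert by simp
  finally show ?case using insert.hyps by simp
qed

text \<open>The convolution kernel \<psi>. The inverse appears because the delta function at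
  \<open>h\<close> is expanded in traces at \<open>inv h \<otimes> x\<close>, whereas the kernel is
  a function of \<open>inv x \<otimes> h\<close>.\<close>

definition multiplier :: "('a \<Rightarrow> complex mat) set \<Rightarrow> (('a \<Rightarrow> complex mat) \<Rightarrow> complex) \<Rightarrow> 'a \<Rightarrow> complex"
  where "multiplier R lam y =
    (\<Sum>\<rho>\<in>R. of_nat (degree_rep G \<rho>) / of_nat (card (carrier G)) * lam \<rho> * mat_trace (\<rho> (inv y)))"

text \<open>By linearity only delta functions matter. Each is a combination over \<rho> of
  translated characters, and a translated character of \<rho> is a combination of matrix
  coefficients of \<rho>, hence an eigenvector of \<open>L\<close> with eigenvalue
  \<open>lam \<rho>\<close>, or zero.\<close>

theorem diagonal_operator_is_convolution:
  assumes fin: "finite (carrier G)" and R: "irrep_system G R" and L: "linear_on_fun_alg G L"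
    and diag: "\<And>\<rho> i j. \<lbrakk>\<rho> \<in> R; i < degree_rep G \<rho>; j < degree_rep G \<rho>\<rbrakk> \<Longrightarrow>
           L (matrix_coeff G \<rho> i j) = (\<lambda>x. lam \<rho> * matrix_coeff G \<rho> i j x)"
    and f: "f \<in> fun_alg (carrier G)" and x: "x \<in> carrier G"
  shows "L f x = (\<Sum>h\<in>carrier G. f h * multiplier R lam (inv x \<otimes> h))"
proof -
  let ?c = "\<lambda>\<rho>. of_nat (degree_rep G \<rho>) / of_nat (card (carrier G)) :: complex"
  define T where "T \<rho> h x = (if x \<in> carrier G then mat_trace (\<rho> (inv h \<otimes> x)) else 0)" for \<rho> :: "'a \<Rightarrow> complex mat" and h x
  have Talg: "T \<rho> h \<in> fun_alg (carrier G)" for \<rho> h by (simp add: T_def fun_alg_def)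
  have LT: "L (T \<rho> h) = (\<lambda>x. lam \<rho> * T \<rho> h x)" if \<rho>: "\<rho> \<in> R" and h: "h \<in> carrier G" for \<rho> h
  proof -
    have \<rho>r: "representation G \<rho>" using \<rho> R by (auto simp: irrep_system_def irreducible_repD)
    let ?I = "{..<degree_rep G \<rho>} \<times> {..<degree_rep G \<rho>}"
    let ?F = "\<lambda>p. matrix_coeff G \<rho> (snd p) (fst p)"
    have Tsum: "T \<rho> h = (\<lambda>x. \<Sum>p\<in>?I. \<rho> (inv h) $$ p * ?F p x)"
    proof
      fix x
      show "T \<rho> h x = (\<Sum>p\<in>?I. \<rho> (inv h) $$ p * ?F p x)"
      proof (cases "x \<in> carrier G")
        case True
        have "T \<rho> h x = mat_trace (\<rho> (inv h) * \<rho> x)"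
          using True h by (simp add: T_def rep_mult[OF \<rho>r])
        also have "\<dots> = (\<Sum>i<degree_rep G \<rho>. (\<rho> (inv h) * \<rho> x) $$ (i, i))"
          using True h mult_carrier_mat[OF rep_carrier[OF \<rho>r] rep_carrier[OF \<rho>r]] by (intro mat_trace_eq) auto
        also have "\<dots> = (\<Sum>i<degree_rep G \<rho>. \<Sum>j<degree_rep G \<rho>. \<rho> (inv h) $$ (i, j) * \<rho> x $$ (j, i))"
          using True h by (intro sum.cong mat_mult_entry) (auto intro: rep_carrier[OF \<rho>r])
        also have "\<dots> = (\<Sum>p\<in>?I. \<rho> (inv h) $$ p * ?F p x)"
          using True by (simp add: sum.cartesian_product matrix_coeff_def split_def)
        finally show ?thesis .
      qed (simp add: T_def matrix_coeff_def)
    qed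
    have "L (T \<rho> h) = (\<lambda>x. \<Sum>p\<in>?I. \<rho> (inv h) $$ p * L (?F p) x)"
      unfolding Tsum by (rule linear_on_fun_alg_sum[OF L]) (auto simp: fun_alg_def matrix_coeff_def)
    also have "\<dots> = (\<lambda>x. \<Sum>p\<in>?I. lam \<rho> * (\<rho> (inv h) $$ p * ?F p x))"
      using diag[OF \<rho>] by (intro ext sum.cong) auto
    also have "\<dots> = (\<lambda>x. lam \<rho> * T \<rho> h x)"
      by (simp add: Tsum sum_distrib_left)
    finally show ?thesis .
  qed
  define \<delta> where "\<delta> h x = (\<Sum>\<rho>\<in>R. ?c \<rho> * T \<rho> h x)" for h x
  have \<delta>: "\<delta> h x = (if x = h then 1 else 0)" if "h \<in> carrier G" "x \<in> carrier G" for h x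
  proof -
    have "\<delta> h x = (if inv h \<otimes> x = \<one> then 1 else 0)"
      unfolding \<delta>_def using sum_degree_trace[OF fin R, of "inv h \<otimes> x"] that by (simp add: T_def)
    moreover have "inv h \<otimes> x = \<one> \<longleftrightarrow> x = h"
      using that by (metis inv_closed inv_equality inv_inv l_inv)
    ultimately show ?thesis by simp
  qed
  have \<delta>alg: "\<delta> h \<in> fun_alg (carrier G)" for h
    by (simp add: \<delta>_def fun_alg_def T_def)
  have "f y = (\<Sum>h\<in>carrier G. f h * \<delta> h y)" for y
  proof (cases "y \<in> carrier G")
    case True
    have "(\<Sum>h\<in>carrier G. f h * \<delta> h y) = (\<Sum>h\<in>carrier G. if h = y then f h else 0)"
      using True by (intro sum.cong) (auto simp: \<delta>)
    then show ?thesis using True fin by simp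
  next
    case False
    then show ?thesis using f \<delta>alg by (simp add: fun_alg_def)
  qed
  then have "f = (\<lambda>y. \<Sum>h\<in>carrier G. f h * \<delta> h y)" by (rule ext)
  then have "L f x = L (\<lambda>y. \<Sum>h\<in>carrier G. f h * \<delta> h y) x"
    by (rule arg_cong[where f = "\<lambda>f. L f x"])
  also have "\<dots> = (\<Sum>h\<in>carrier G. f h * L (\<delta> h) x)"
    by (simp add: linear_on_fun_alg_sum[OF L fin \<delta>alg])
  also have "\<dots> = (\<Sum>h\<in>carrier G. f h * multiplier R lam (inv x \<otimes> h))"
  proof (rule sum.cong[OF refl])
    fix h assume h: "h \<in> carrier G"
    have "L (\<delta> h) x = (\<Sum>\<rho>\<in>R. ?c \<rho> * L (T \<rho> h) x)"
      unfolding \<delta>_def by (simp only: linear_on_fun_alg_sum[OF L finite_irrep_system[OF fin R] Talg])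
    also have "\<dots> = (\<Sum>\<rho>\<in>R. ?c \<rho> * lam \<rho> * mat_trace (\<rho> (inv (inv x \<otimes> h))))"
      using h x by (intro sum.cong) (auto simp: LT T_def inv_mult_group)
    finally show "f h * L (\<delta> h) x = f h * multiplier R lam (inv x \<otimes> h)"
      by (simp add: multiplier_def)
  qed
  finally show ?thesis .
qed

lemma multiplier_conj:
  assumes R: "irrep_system G R" and g: "g \<in> carrier G" and y: "y \<in> carrier G"
  shows "multiplier R lam (inv g \<otimes> y \<otimes> g) = multiplier R lam y"
  unfolding multiplier_def
proof (intro sum.cong refl arg_cong2[of _ _ _ _ "(*)"])
  fix \<rho> assume "\<rho> \<in> R"
  then have \<rho>r: "representation G \<rho>" using R by (auto simp: irrep_system_def irreducible_repD)
  have "inv (inv g \<otimes> y \<otimes> g) = inv g \<otimes> inv y \<otimes> g"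
    using g y by (simp add: inv_mult_group m_assoc)
  then have "\<rho> (inv (inv g \<otimes> y \<otimes> g)) = \<rho> (inv g) * \<rho> (inv y) * \<rho> g"
    using g y by (simp add: rep_mult[OF \<rho>r])
  then show "mat_trace (\<rho> (inv (inv g \<otimes> y \<otimes> g))) = mat_trace (\<rho> (inv y))"
    using mat_trace_similar[OF rep_carrier[OF \<rho>r] rep_carrier[OF \<rho>r] rep_carrier[OF \<rho>r] rep_inv(2)[OF \<rho>r g]] g y
    by simp
qed

text \<open>A kernel in \<open>inv x \<otimes> h\<close> is unchanged when \<open>x\<close> and
  \<open>h\<close> are multiplied on the left by the same element, which is covariance in the second
  tensor factor. In the first factor the common multiplication is on the right and conjugates the
  argument, where the class property enters.\<close>

lemma class_convolution_bicovariant: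
  assumes fin: "finite (carrier G)"
    and L: "L \<in> fun_alg (carrier G) \<rightarrow> fun_alg (carrier G)"
    and conv: "\<And>f x. f \<in> fun_alg (carrier G) \<Longrightarrow> x \<in> carrier G \<Longrightarrow>
      L f x = (\<Sum>h\<in>carrier G. f h * \<psi> (inv x \<otimes> h))"
    and cls: "\<And>g y. g \<in> carrier G \<Longrightarrow> y \<in> carrier G \<Longrightarrow> \<psi> (inv g \<otimes> y \<otimes> g) = \<psi> y"
  shows "bicovariant G L"
  unfolding bicovariant_def
proof (intro ballI conjI ext; clarify)
  fix f x y assume f: "f \<in> fun_alg (carrier G)"
  have zero: "(\<lambda>_. 0) \<in> fun_alg (carrier G)" by (simp add: fun_alg_def)
  have L0: "L (\<lambda>_. 0) x = 0" for x
    using conv[OF zero, of x] L zero by (cases "x \<in> carrier G") (auto simp: fun_alg_def Pi_iff)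
  let ?l = "\<lambda>y'. coproduct G f (x, y')" and ?r = "\<lambda>x'. coproduct G f (x', y)"
  have alg: "?l \<in> fun_alg (carrier G)" "?r \<in> fun_alg (carrier G)"
    by (auto simp: fun_alg_def coproduct_def)
  have off: "L h z = 0" if "h \<in> fun_alg (carrier G)" "z \<notin> carrier G" for h z
    using L that by (auto simp: fun_alg_def Pi_iff)
  show "coproduct G (L f) (x, y) = tensor_id_left L (coproduct G f) (x, y)"
  proof (cases "x \<in> carrier G \<and> y \<in> carrier G")
    case True
    then have x: "x \<in> carrier G" and y: "y \<in> carrier G" by auto
    have "L f (x \<otimes> y) = (\<Sum>h\<in>carrier G. f (x \<otimes> h) * \<psi> (inv (x \<otimes> y) \<otimes> (x \<otimes> h)))"
      unfolding conv[OF f m_closed[OF x y]]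
      by (rule sum.reindex_bij_betw[OF bij_betw_mult_left[OF x], symmetric])
    also have "\<dots> = (\<Sum>h\<in>carrier G. ?l h * \<psi> (inv y \<otimes> h))"
    proof (rule sum.cong[OF refl])
      fix h assume h: "h \<in> carrier G"
      have "inv (x \<otimes> y) \<otimes> (x \<otimes> h) = inv y \<otimes> h"
        using x y h by (simp add: inv_mult_group m_assoc inv_mult_cancel)
      then show "f (x \<otimes> h) * \<psi> (inv (x \<otimes> y) \<otimes> (x \<otimes> h)) = ?l h * \<psi> (inv y \<otimes> h)"
        using x y h by (simp add: coproduct_def)
    qed
    also have "\<dots> = L ?l y" by (rule conv[OF alg(1) y, symmetric])
    finally show ?thesis using x y by (simp add: coproduct_def tensor_id_left_def)
  next
    case False
    show ?thesis
    proof (cases "x \<in> carrier G")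
      case True
      then show ?thesis using False off[OF alg(1), of y] by (simp add: coproduct_def tensor_id_left_def)
    next
      case False
      then show ?thesis using L0 by (simp add: coproduct_def tensor_id_left_def)
    qed
  qed
  show "coproduct G (L f) (x, y) = tensor_id_right L (coproduct G f) (x, y)"
  proof (cases "x \<in> carrier G \<and> y \<in> carrier G")
    case True
    then have x: "x \<in> carrier G" and y: "y \<in> carrier G" by auto
    have "L f (x \<otimes> y) = (\<Sum>h\<in>carrier G. f (h \<otimes> y) * \<psi> (inv (x \<otimes> y) \<otimes> (h \<otimes> y)))"
      unfolding conv[OF f m_closed[OF x y]]
      by (rule sum.reindex_bij_betw[OF bij_betw_mult_right[OF y], symmetric])
    also have "\<dots> = (\<Sum>h\<in>carrier G. ?r h * \<psi> (inv x \<otimes> h))"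
    proof (rule sum.cong[OF refl])
      fix h assume h: "h \<in> carrier G"
      have "inv (x \<otimes> y) \<otimes> (h \<otimes> y) = inv y \<otimes> (inv x \<otimes> h) \<otimes> y"
        using x y h by (simp add: inv_mult_group m_assoc)
      then show "f (h \<otimes> y) * \<psi> (inv (x \<otimes> y) \<otimes> (h \<otimes> y)) = ?r h * \<psi> (inv x \<otimes> h)"
        using x y h cls[OF y, of "inv x \<otimes> h"] by (simp add: coproduct_def)
    qed
    also have "\<dots> = L ?r x" by (rule conv[OF alg(2) x, symmetric])
    finally show ?thesis using x y by (simp add: coproduct_def tensor_id_right_def)
  next
    case False
    show ?thesis
    proof (cases "y \<in> carrier G")
      case True
      then show ?thesis using False off[OF alg(2), of x] by (simp add: coproduct_def tensor_id_right_def)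
    next
      case False
      then show ?thesis using L0 by (simp add: coproduct_def tensor_id_right_def)
    qed
  qed
qed




section \<open>Second order Laplacians\<close>

lemma bimodule_inner_productD:
  assumes "bimodule_inner_product G S ip"
  shows "\<And>\<omega> \<eta>. \<omega> \<in> one_forms G S \<Longrightarrow> \<eta> \<in> one_forms G S \<Longrightarrow> ip \<omega> \<eta> \<in> fun_alg (carrier G)"
    and "\<And>\<omega> \<omega>' \<eta>. \<omega> \<in> one_forms G S \<Longrightarrow> \<omega>' \<in> one_forms G S \<Longrightarrow> \<eta> \<in> one_forms G S \<Longrightarrow>
      ip (\<lambda>c x. \<omega> c x + \<omega>' c x) \<eta> = (\<lambda>x. ip \<omega> \<eta> x + ip \<omega>' \<eta> x)"
    and "\<And>\<omega> \<omega>' \<eta>. \<omega> \<in> one_forms G S \<Longrightarrow> \<omega>' \<in> one_forms G S \<Longrightarrow> \<eta> \<in> one_forms G S \<Longrightarrow>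
      ip \<eta> (\<lambda>c x. \<omega> c x + \<omega>' c x) = (\<lambda>x. ip \<eta> \<omega> x + ip \<eta> \<omega>' x)"
    and "\<And>f \<omega> \<eta>. f \<in> fun_alg (carrier G) \<Longrightarrow> \<omega> \<in> one_forms G S \<Longrightarrow> \<eta> \<in> one_forms G S \<Longrightarrow>
      ip (right_mult G \<omega> f) \<eta> = ip \<omega> (left_mult f \<eta>)"
    and "\<And>f \<omega> \<eta>. f \<in> fun_alg (carrier G) \<Longrightarrow> \<omega> \<in> one_forms G S \<Longrightarrow> \<eta> \<in> one_forms G S \<Longrightarrow>
      ip (left_mult f \<omega>) \<eta> = (\<lambda>x. f x * ip \<omega> \<eta> x)"
    and "\<And>f \<omega> \<eta>. f \<in> fun_alg (carrier G) \<Longrightarrow> \<omega> \<in> one_forms G S \<Longrightarrow> \<eta> \<in> one_forms G S \<Longrightarrow>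
      ip \<omega> (right_mult G \<eta> f) = (\<lambda>x. ip \<omega> \<eta> x * f x)"
proof -
  note D = assms[unfolded bimodule_inner_product_def]
  note D1 = D[THEN conjunct1, rule_format] and D2 = D[THEN conjunct2, THEN conjunct1, rule_format]
  show "ip \<omega> \<eta> \<in> fun_alg (carrier G)" if "\<omega> \<in> one_forms G S" "\<eta> \<in> one_forms G S" for \<omega> \<eta>
    by (rule D1[OF that])
  fix \<omega> \<omega>' \<eta> assume f: "\<omega> \<in> one_forms G S" "\<omega>' \<in> one_forms G S" "\<eta> \<in> one_forms G S"
  show "ip (\<lambda>c x. \<omega> c x + \<omega>' c x) \<eta> = (\<lambda>x. ip \<omega> \<eta> x + ip \<omega>' \<eta> x)"
    "ip \<eta> (\<lambda>c x. \<omega> c x + \<omega>' c x) = (\<lambda>x. ip \<eta> \<omega> x + ip \<eta> \<omega>' x)"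
    by (rule D2[OF f, THEN conjunct1], rule D2[OF f, THEN conjunct2])
next
  note D3 = assms[unfolded bimodule_inner_product_def, THEN conjunct2, THEN conjunct2, rule_format]
  fix f \<omega> \<eta> assume f: "f \<in> fun_alg (carrier G)" "\<omega> \<in> one_forms G S" "\<eta> \<in> one_forms G S"
  show "ip (right_mult G \<omega> f) \<eta> = ip \<omega> (left_mult f \<eta>)"
    by (rule D3[OF f, THEN conjunct1])
  show "ip (left_mult f \<omega>) \<eta> = (\<lambda>x. f x * ip \<omega> \<eta> x)"
    by (rule D3[OF f, THEN conjunct2, THEN conjunct1])
  show "ip \<omega> (right_mult G \<eta> f) = (\<lambda>x. ip \<omega> \<eta> x * f x)"
    by (rule D3[OF f, THEN conjunct2, THEN conjunct2])
qed

lemma inner_product_sums: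
  assumes ip: "bimodule_inner_product G S ip" and "finite I"
    and W: "\<And>c. c \<in> I \<Longrightarrow> W c \<in> one_forms G S" and \<eta>: "\<eta> \<in> one_forms G S"
  shows "ip (\<lambda>d x. \<Sum>c\<in>I. W c d x) \<eta> = (\<lambda>x. \<Sum>c\<in>I. ip (W c) \<eta> x)" (is ?left)
    and "ip \<eta> (\<lambda>d x. \<Sum>c\<in>I. W c d x) = (\<lambda>x. \<Sum>c\<in>I. ip \<eta> (W c) x)" (is ?right)
proof -
  have 0: "(\<lambda>_. 0) \<in> fun_alg (carrier G)" by (simp add: fun_alg_def)
  have "?left \<and> ?right"
    using \<open>finite I\<close> W
  proof (induction I)
    case empty
    \<comment> \<open>The empty sum is the zero form; it is realised as 0 times \<eta>, on the side
      where the module property applies.\<close>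
    have "ip (left_mult (\<lambda>_. 0) \<eta>) \<eta> = (\<lambda>x. 0 * ip \<eta> \<eta> x)"
      "ip \<eta> (right_mult G \<eta> (\<lambda>_. 0)) = (\<lambda>x. ip \<eta> \<eta> x * 0)"
      using bimodule_inner_productD(5,6)[OF ip 0 \<eta> \<eta>] .
    then show ?case by (simp add: left_mult_def right_mult_def shift_def)
  next
    case (insert c I)
    have s: "(\<lambda>d x. \<Sum>c\<in>I. W c d x) \<in> one_forms G S"
      using insert.prems by (auto simp: one_forms_def fun_alg_def fun_eq_iff intro!: sum.neutral)
    have "ip (\<lambda>d x. W c d x + (\<Sum>c\<in>I. W c d x)) \<eta> = (\<lambda>x. ip (W c) \<eta> x + ip (\<lambda>d x. \<Sum>c\<in>I. W c d x) \<eta> x)"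
      "ip \<eta> (\<lambda>d x. W c d x + (\<Sum>c\<in>I. W c d x)) = (\<lambda>x. ip \<eta> (W c) x + ip \<eta> (\<lambda>d x. \<Sum>c\<in>I. W c d x) x)"
      using bimodule_inner_productD(2,3)[OF ip insert.prems[OF insertI1] s \<eta>] .
    then show ?case using insert by simp
  qed
  then show ?left ?right by auto
qed

lemma basis_form_one_forms: "c \<in> S \<Longrightarrow> basis_form G c \<in> one_forms G S"
  by (auto simp: one_forms_def basis_form_def fun_alg_def)

lemma left_mult_one_forms: "\<omega> \<in> one_forms G S \<Longrightarrow> left_mult f \<omega> \<in> one_forms G S"
  by (auto simp: one_forms_def left_mult_def fun_alg_def)

lemma shift_fun_alg: "shift G c f \<in> fun_alg (carrier G)"
  by (simp add: shift_def fun_alg_def)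

lemma exterior_d_one_forms:
  "f \<in> fun_alg (carrier G) \<Longrightarrow> exterior_d G S f \<in> one_forms G S"
  by (auto simp: one_forms_def exterior_d_def fun_alg_def shift_def)

lemma exterior_d_eq_sum:
  assumes "finite S" and f: "f \<in> fun_alg (carrier G)"
  shows "exterior_d G S f =
    (\<lambda>d x. \<Sum>c\<in>S. left_mult (\<lambda>y. shift G c f y - f y) (basis_form G c) d x)"
proof (intro ext)
  fix d x
  have "(\<Sum>c\<in>S. left_mult (\<lambda>y. shift G c f y - f y) (basis_form G c) d x) =
      (\<Sum>c\<in>S. if c = d then (shift G d f x - f x) * indicator (carrier G) x else 0)"
    by (intro sum.cong) (auto simp: left_mult_def basis_form_def)
  also have "\<dots> = exterior_d G S f d x"
    using assms by (auto simp: exterior_d_def fun_alg_def shift_def indicator_def)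
  finally show "exterior_d G S f d x =
    (\<Sum>c\<in>S. left_mult (\<lambda>y. shift G c f y - f y) (basis_form G c) d x)" by simp
qed

text \<open>Balancedness carries \<open>h\<close> across the tensor sign to the right of the form of
  \<open>c\<close>, and the commutation rule of the calculus turns it into
  \<open>shift G c h\<close> on the left.\<close>

lemma inner_product_basis:
  assumes ip: "bimodule_inner_product G S ip" and cd: "c \<in> S" "d \<in> S"
    and f: "f \<in> fun_alg (carrier G)" and h: "h \<in> fun_alg (carrier G)"
  shows "ip (left_mult f (basis_form G c)) (left_mult h (basis_form G d)) x =
    f x * shift G c h x * ip (basis_form G c) (basis_form G d) x"
proof -
  note c = basis_form_one_forms[OF cd(1)] and d = basis_form_one_forms[OF cd(2)]
  have r: "right_mult G (basis_form G c) h = left_mult (shift G c h) (basis_form G c)"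
    by (auto simp: right_mult_def left_mult_def basis_form_def shift_def fun_eq_iff)
  have "ip (left_mult f (basis_form G c)) (left_mult h (basis_form G d)) =
      (\<lambda>x. f x * ip (basis_form G c) (left_mult h (basis_form G d)) x)"
    by (rule bimodule_inner_productD(5)[OF ip f c left_mult_one_forms[OF d]])
  also have "ip (basis_form G c) (left_mult h (basis_form G d)) =
      ip (right_mult G (basis_form G c) h) (basis_form G d)"
    by (rule bimodule_inner_productD(4)[OF ip h c d, symmetric])
  also have "\<dots> = (\<lambda>x. shift G c h x * ip (basis_form G c) (basis_form G d) x)"
    unfolding r by (rule bimodule_inner_productD(5)[OF ip shift_fun_alg c d])
  finally show ?thesis by simp
qed

text \<open>Expanding both differentials in basis forms leaves a double sum, in which
  \<open>c\<close> in the symmetric part meets only \<open>d = inv c\<close>; closure under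
  inversion ensures that this \<open>d\<close> occurs in the sum over \<open>S\<close>.\<close>

lemma inner_product_exterior_d:
  assumes fin: "finite (carrier G)" and S: "S \<subseteq> carrier G"
    and classes: "\<exists>\<C>. \<C> \<subseteq> conj_classes G \<and> S = \<Union>\<C>"
    and ip: "bimodule_inner_product G S ip" and data: "given_by_data G S l ip"
    and a: "a \<in> fun_alg (carrier G)" and b: "b \<in> fun_alg (carrier G)" and x: "x \<in> carrier G"
  shows "ip (exterior_d G S a) (exterior_d G S b) x =
    - (\<Sum>c\<in>sym_part G S. l (conj_class c) * (a (x \<otimes> c) - a x) * (b (x \<otimes> c) - b x))"
proof -
  have finS: "finite S" using fin S finite_subset by blast
  define A where "A f c = (\<lambda>y. shift G c f y - f y)" for f :: "'a \<Rightarrow> complex" and c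
  have Aalg: "A f c \<in> fun_alg (carrier G)" if "f \<in> fun_alg (carrier G)" for f c
    using that by (simp add: A_def fun_alg_def shift_def)
  have Aform: "left_mult (A f c) (basis_form G c) \<in> one_forms G S" if "c \<in> S" for f c
    using that by (intro left_mult_one_forms basis_form_one_forms)
  have "ip (exterior_d G S a) (exterior_d G S b) x =
      (\<Sum>c\<in>S. ip (left_mult (A a c) (basis_form G c)) (exterior_d G S b) x)"
    unfolding exterior_d_eq_sum[OF finS a] A_def[symmetric]
    using inner_product_sums(1)[OF ip finS Aform exterior_d_one_forms[OF b]] by simp
  also have "\<dots> = (\<Sum>c\<in>S. \<Sum>d\<in>S.
      ip (left_mult (A a c) (basis_form G c)) (left_mult (A b d) (basis_form G d)) x)"
    unfolding exterior_d_eq_sum[OF finS b] A_def[symmetric]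
    using inner_product_sums(2)[OF ip finS Aform Aform] by (intro sum.cong) auto
  also have "\<dots> = (\<Sum>c\<in>S. \<Sum>d\<in>S. A a c x * shift G c (A b d) x * ip (basis_form G c) (basis_form G d) x)"
    by (intro sum.cong inner_product_basis[OF ip] Aalg a b refl)
  also have "\<dots> = (\<Sum>c\<in>S. if c \<in> sym_part G S then
      - (l (conj_class c) * (a (x \<otimes> c) - a x) * (b (x \<otimes> c) - b x)) else 0)"
  proof (rule sum.cong[OF refl])
    fix c assume c: "c \<in> S"
    then have cG: "c \<in> carrier G" using S by auto
    show "(\<Sum>d\<in>S. A a c x * shift G c (A b d) x * ip (basis_form G c) (basis_form G d) x) =
      (if c \<in> sym_part G S then
      - (l (conj_class c) * (a (x \<otimes> c) - a x) * (b (x \<otimes> c) - b x)) else 0)"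
    proof (cases "c \<in> sym_part G S")
      case True
      have sub: "conj_class c \<subseteq> sym_part G S"
        using sym_part_class[OF conj_class_in[OF cG] conj_class_self[OF cG]] True by simp
      have ipc: "ip (basis_form G c) (basis_form G d) x = (if c = inv d then l (conj_class c) else 0)"
        if "d \<in> S" for d
      proof -
        have "ip (basis_form G c) (basis_form G d) =
            (\<lambda>x. if c = inv d then l (conj_class c) * indicator (carrier G) x else 0)"
          using data that sub conj_class_in[OF cG] conj_class_self[OF cG]
          unfolding given_by_data_def by blast
        then show ?thesis using x by simp
      qed
      have invc: "inv c \<in> S"
        using sym_part_inv[OF classes True] sym_part_subset by blast
      have "(\<Sum>d\<in>S. A a c x * shift G c (A b d) x * ip (basis_form G c) (basis_form G d) x) =
          (\<Sum>d\<in>S. if d = inv c then A a c x * shift G c (A b (inv c)) x * l (conj_class c) else 0)"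
      proof (rule sum.cong[OF refl])
        fix d assume "d \<in> S"
        then have "c = inv d \<longleftrightarrow> d = inv c" using cG S by (metis inv_inv subsetD)
        then show "A a c x * shift G c (A b d) x * ip (basis_form G c) (basis_form G d) x =
            (if d = inv c then A a c x * shift G c (A b (inv c)) x * l (conj_class c) else 0)"
          by (auto simp: ipc[OF \<open>d \<in> S\<close>])
      qed
      also have "\<dots> = A a c x * shift G c (A b (inv c)) x * l (conj_class c)"
        using finS invc by simp
      \<comment> \<open>The difference of \<open>b\<close> in direction \<open>inv c\<close>,
        shifted by \<open>c\<close>, is \<open>b x - b (x \<otimes> c)\<close>: the sign comes from
        here.\<close>
      also have "\<dots> = - (l (conj_class c) * (a (x \<otimes> c) - a x) * (b (x \<otimes> c) - b x))"
        using x cG by (simp add: A_def shift_def m_assoc algebra_simps)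
      finally show ?thesis using True by simp
    next
      case False
      have "ip (basis_form G c) (basis_form G d) = (\<lambda>_. 0)" if "d \<in> S" for d
        using data c False that unfolding given_by_data_def by blast
      then show ?thesis using False by simp
    qed
  qed
  also have "\<dots> = (\<Sum>c\<in>sym_part G S. - (l (conj_class c) * (a (x \<otimes> c) - a x) * (b (x \<otimes> c) - b x)))"
    by (rule sum.mono_neutral_cong_right[OF finS sym_part_subset]) auto
  finally show ?thesis by (simp add: sum_negf)
qed

text \<open>Testing on \<open>a = b = indicator {y}\<close> at the unit isolates the value of both sides at \<open>y\<close>.\<close>

theorem laplacian_iff_multiplier:
  assumes fin: "finite (carrier G)" and S: "S \<subseteq> carrier G - {\<one>}"
    and classes: "\<exists>\<C>. \<C> \<subseteq> conj_classes G \<and> S = \<Union>\<C>"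
    and ip: "bimodule_inner_product G S ip" and data: "given_by_data G S l ip"
    and L: "linear_on_fun_alg G L"
    and conv: "\<And>f x. f \<in> fun_alg (carrier G) \<Longrightarrow> x \<in> carrier G \<Longrightarrow>
      L f x = (\<Sum>h\<in>carrier G. f h * \<psi> (inv x \<otimes> h))"
    and sum0: "(\<Sum>y\<in>carrier G. \<psi> y) = 0"
  shows "second_order_laplacian G S ip L \<longleftrightarrow>
    (\<forall>y\<in>carrier G - {\<one>}. \<psi> y = (if y \<in> sym_part G S then - 2 * l (conj_class y) else 0))"
proof -
  have SG: "S \<subseteq> carrier G" using S by auto
  define m where "m y = (if y \<in> sym_part G S then - 2 * l (conj_class y) else 0)" for y
  have conv': "L f x = (\<Sum>y\<in>carrier G. f (x \<otimes> y) * \<psi> y)"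
    if f: "f \<in> fun_alg (carrier G)" and x: "x \<in> carrier G" for f x
  proof -
    have "L f x = (\<Sum>y\<in>carrier G. f (x \<otimes> y) * \<psi> (inv x \<otimes> (x \<otimes> y)))"
      unfolding conv[OF f x] by (rule sum.reindex_bij_betw[OF bij_betw_mult_left[OF x], symmetric])
    then show ?thesis using x by (simp add: m_assoc[symmetric] cong: sum.cong)
  qed
  have mult_alg: "(\<lambda>x. a x * b x) \<in> fun_alg (carrier G)" if "a \<in> fun_alg (carrier G)" for a b
    using that by (simp add: fun_alg_def)
  have lhs: "L (\<lambda>x. a x * b x) x - L a x * b x - a x * L b x =
      (\<Sum>y\<in>carrier G. \<psi> y * (a (x \<otimes> y) - a x) * (b (x \<otimes> y) - b x))"
    if a: "a \<in> fun_alg (carrier G)" and b: "b \<in> fun_alg (carrier G)" and x: "x \<in> carrier G" for a b x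
  proof -
    \<comment> \<open>Completing to a product of differences adds \<open>a x * b x\<close> times the
      total mass of \<psi>, which is zero.\<close>
    have "(\<Sum>y\<in>carrier G. \<psi> y * (a (x \<otimes> y) - a x) * (b (x \<otimes> y) - b x)) =
        (\<Sum>y\<in>carrier G. a (x \<otimes> y) * b (x \<otimes> y) * \<psi> y - a (x \<otimes> y) * \<psi> y * b x
           - a x * (b (x \<otimes> y) * \<psi> y) + a x * b x * \<psi> y)"
      by (intro sum.cong) (auto simp: algebra_simps)
    also have "\<dots> = L (\<lambda>x. a x * b x) x - L a x * b x - a x * L b x + a x * b x * (\<Sum>y\<in>carrier G. \<psi> y)"
      unfolding conv'[OF mult_alg[OF a] x] conv'[OF a x] conv'[OF b x]
      by (simp only: sum.distrib sum_subtractf sum_distrib_left sum_distrib_right)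
    finally show ?thesis by (simp add: sum0)
  qed
  have rhs: "2 * ip (exterior_d G S a) (exterior_d G S b) x =
      (\<Sum>y\<in>carrier G. m y * (a (x \<otimes> y) - a x) * (b (x \<otimes> y) - b x))"
    if a: "a \<in> fun_alg (carrier G)" and b: "b \<in> fun_alg (carrier G)" and x: "x \<in> carrier G" for a b x
  proof -
    have "(\<Sum>y\<in>carrier G. m y * (a (x \<otimes> y) - a x) * (b (x \<otimes> y) - b x)) =
        (\<Sum>y\<in>sym_part G S. m y * (a (x \<otimes> y) - a x) * (b (x \<otimes> y) - b x))"
      using SG sym_part_subset[of S] by (intro sum.mono_neutral_right[OF fin]) (auto simp: m_def)
    also have "\<dots> = (\<Sum>y\<in>sym_part G S. - 2 * (l (conj_class y) * (a (x \<otimes> y) - a x) * (b (x \<otimes> y) - b x)))"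
      by (intro sum.cong) (auto simp: m_def)
    finally show ?thesis
      unfolding inner_product_exterior_d[OF fin SG classes ip data a b x]
      by (simp add: sum_distrib_left sum_negf)
  qed
  show ?thesis
    unfolding m_def[symmetric]
  proof
    assume lap: "second_order_laplacian G S ip L"
    show "\<forall>y\<in>carrier G - {\<one>}. \<psi> y = m y"
    proof
      fix y assume y: "y \<in> carrier G - {\<one>}"
      define a :: "'a \<Rightarrow> complex" where "a = indicator {y}"
      have a: "a \<in> fun_alg (carrier G)" using y by (auto simp: a_def fun_alg_def indicator_def)
      have "L (\<lambda>x. a x * a x) = (\<lambda>x. L a x * a x + a x * L a x +
          2 * ip (exterior_d G S a) (exterior_d G S a) x)"
        using lap a unfolding second_order_laplacian_def by blast
      then have "L (\<lambda>x. a x * a x) \<one> - L a \<one> * a \<one> - a \<one> * L a \<one> =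
          2 * ip (exterior_d G S a) (exterior_d G S a) \<one>" by simp
      then have eq: "(\<Sum>z\<in>carrier G. \<psi> z * (a (\<one> \<otimes> z) - a \<one>) * (a (\<one> \<otimes> z) - a \<one>)) =
          (\<Sum>z\<in>carrier G. m z * (a (\<one> \<otimes> z) - a \<one>) * (a (\<one> \<otimes> z) - a \<one>))"
        unfolding lhs[OF a a one_closed] rhs[OF a a one_closed] .
      \<comment> \<open>Since \<open>y\<close> is not the unit, \<open>a \<one> = 0\<close>, and
        only the summand at \<open>y\<close> survives.\<close>
      have pick: "(\<Sum>z\<in>carrier G. \<phi> z * (a (\<one> \<otimes> z) - a \<one>) * (a (\<one> \<otimes> z) - a \<one>)) = \<phi> y" for \<phi>
      proof -
        have "(\<Sum>z\<in>carrier G. \<phi> z * (a (\<one> \<otimes> z) - a \<one>) * (a (\<one> \<otimes> z) - a \<one>)) =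
            (\<Sum>z\<in>carrier G. if z = y then \<phi> y else 0)"
          using y by (intro sum.cong) (auto simp: a_def indicator_def)
        then show ?thesis using fin y by simp
      qed
      show "\<psi> y = m y" using eq unfolding pick .
    qed
  next
    assume \<psi>: "\<forall>y\<in>carrier G - {\<one>}. \<psi> y = m y"
    show "second_order_laplacian G S ip L"
      unfolding second_order_laplacian_def
    proof (intro conjI ballI ext L)
      fix a b x assume a: "a \<in> fun_alg (carrier G)" and b: "b \<in> fun_alg (carrier G)"
      show "L (\<lambda>x. a x * b x) x = L a x * b x + a x * L b x +
          2 * ip (exterior_d G S a) (exterior_d G S b) x"
      proof (cases "x \<in> carrier G")
        case True
        have "(\<Sum>y\<in>carrier G. \<psi> y * (a (x \<otimes> y) - a x) * (b (x \<otimes> y) - b x)) =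
            (\<Sum>y\<in>carrier G. m y * (a (x \<otimes> y) - a x) * (b (x \<otimes> y) - b x))"
        proof (rule sum.cong[OF refl])
          \<comment> \<open>At the unit both differences vanish, so the value of \<psi> there does
            not matter.\<close>
          fix y assume "y \<in> carrier G"
          then show "\<psi> y * (a (x \<otimes> y) - a x) * (b (x \<otimes> y) - b x) =
              m y * (a (x \<otimes> y) - a x) * (b (x \<otimes> y) - b x)"
            using \<psi> True by (cases "y = \<one>") auto
        qed
        then have "L (\<lambda>x. a x * b x) x - L a x * b x - a x * L b x =
            2 * ip (exterior_d G S a) (exterior_d G S b) x"
          by (simp only: lhs[OF a b True] rhs[OF a b True])
        then show ?thesis by (simp add: algebra_simps)
      next
        case False
        have "L (\<lambda>x. a x * b x) x = 0"
          using L mult_alg[OF a] False by (auto simp: linear_on_fun_alg_def fun_alg_def Pi_iff)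
        moreover have "ip (exterior_d G S a) (exterior_d G S b) \<in> fun_alg (carrier G)"
          by (rule bimodule_inner_productD(1)[OF ip exterior_d_one_forms[OF a] exterior_d_one_forms[OF b]])
        ultimately show ?thesis using a b False by (simp add: fun_alg_def)
      qed
    qed
  qed
qed




section \<open>The conditions in terms of characters\<close>

lemma irreducible_trivial_rep: "irreducible_rep G trivial_rep"
proof -
  have deg: "degree_rep G trivial_rep = 1" by (simp add: degree_rep_def trivial_rep_def)
  show ?thesis
    unfolding irreducible_rep_def deg
  proof (intro conjI allI impI)
    show "representation G trivial_rep"
      unfolding representation_def deg by (simp add: trivial_rep_def)
    fix W :: "complex vec set"
    assume "VectorSpace.subspace class_ring W (module_vec TYPE(complex) 1) \<and>
      (\<forall>g\<in>carrier G. \<forall>w\<in>W. trivial_rep g *\<^sub>v w \<in> W)"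
    then have W: "W \<subseteq> carrier_vec 1" "0\<^sub>v 1 \<in> W" "\<And>c v. v \<in> W \<Longrightarrow> c \<cdot>\<^sub>v v \<in> W"
      unfolding subspace_module_vec_iff by blast+
    show "W = {0\<^sub>v 1} \<or> W = carrier_vec 1"
    proof (cases "W = {0\<^sub>v 1}")
      case False
      then obtain v where v: "v \<in> W" "v \<noteq> 0\<^sub>v 1" using W(2) by blast
      have v1: "v \<in> carrier_vec 1" using v W(1) by blast
      have v0: "v $ 0 \<noteq> 0"
      proof
        assume "v $ 0 = 0"
        then have "v = 0\<^sub>v 1" using v1 by (intro eq_vecI) auto
        then show False using v by simp
      qed
      have "w \<in> W" if w: "w \<in> carrier_vec 1" for w
      proof -
        have "w = (w $ 0 / v $ 0) \<cdot>\<^sub>v v"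
          using w v1 v0 by (intro eq_vecI) auto
        then show ?thesis using W(3)[OF v(1), of "w $ 0 / v $ 0"] by simp
      qed
      then show ?thesis using W(1) by blast
    qed simp
  qed simp
qed

text \<open>Conjugating the identity gives the identity, so the chosen representative of the trivial
  class is not merely isomorphic to \<open>trivial_rep\<close> but equal to it on the group.\<close>

lemma irrep_system_trivial:
  assumes R: "irrep_system G R"
  obtains \<rho> where "\<rho> \<in> R" "iso_rep G \<rho> trivial_rep" "degree_rep G \<rho> = 1"
    "\<And>g. g \<in> carrier G \<Longrightarrow> \<rho> g = 1\<^sub>m 1"
proof -
  obtain \<rho> where \<rho>: "\<rho> \<in> R" "iso_rep G trivial_rep \<rho>"
    using R irreducible_trivial_rep by (auto simp: irrep_system_def)
  have tdeg: "degree_rep G trivial_rep = 1" by (simp add: degree_rep_def trivial_rep_def)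
  have \<rho>r: "representation G \<rho>" using \<rho> R by (auto simp: irrep_system_def irreducible_repD)
  from iso_repE[OF irreducible_repD(1)[OF irreducible_trivial_rep] \<rho>r \<rho>(2)] obtain P Q where
    P: "P \<in> carrier_mat (degree_rep G \<rho>) (degree_rep G \<rho>)" and
    Q: "Q \<in> carrier_mat (degree_rep G \<rho>) (degree_rep G \<rho>)" and
    PQ: "P * Q = 1\<^sub>m (degree_rep G \<rho>)" and deg: "degree_rep G trivial_rep = degree_rep G \<rho>" and
    comm: "\<And>g. g \<in> carrier G \<Longrightarrow> P * trivial_rep g = \<rho> g * P"
    by metis
  have deg: "degree_rep G \<rho> = 1" using deg tdeg by simp
  have one: "\<rho> g = 1\<^sub>m 1" if g: "g \<in> carrier G" for g
  proof -
    have "\<rho> g = \<rho> g * (P * Q)" unfolding PQ using right_mult_one_mat[OF rep_carrier[OF \<rho>r g]] by simp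
    also have "\<dots> = \<rho> g * P * Q" by (rule assoc_mult_mat[OF rep_carrier[OF \<rho>r g] P Q, symmetric])
    also have "\<rho> g * P = P" using comm[OF g] P by (simp add: trivial_rep_def deg)
    finally show ?thesis using PQ by (simp add: deg)
  qed
  \<comment> \<open>The system supplies an isomorphism in the other direction; as both
    representations agree on the group, reflexivity gives the one that is wanted.\<close>
  have "iso_rep G \<rho> \<rho>" by (rule iso_rep_refl[OF \<rho>r])
  then have "iso_rep G \<rho> trivial_rep"
    unfolding iso_rep_def tdeg deg by (auto simp: one trivial_rep_def)
  then show ?thesis using that \<rho> deg one by blast
qed


section \<open>Character sums as values of the kernel, and eigenvalues as its transforms\<close>

lemma norm_char_trace:
  assumes "representation G \<rho>" "C \<in> conj_classes G" "c \<in> C"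
  shows "norm_char G \<rho> C = mat_trace (\<rho> c) / of_nat (degree_rep G \<rho>)"
  using norm_char_eq[OF assms] mat_trace_eq[OF rep_carrier[OF assms(1) conj_classes_eq(2)[OF assms(2,3)]]]
  by simp

text \<open>One factor of the squared degree cancels the normalisation of the character. The kernel
  contains the trace at the inverse, so the plain character belongs to its value at
  \<open>inv c\<close>.\<close>

lemma sum_norm_char:
  assumes R: "irrep_system G R" and C: "C \<in> conj_classes G" "c \<in> C"
  shows "(\<Sum>\<rho>\<in>R. of_nat (degree_rep G \<rho>) ^ 2 / of_nat (card (carrier G)) * lam \<rho> * norm_char G \<rho> C) =
    multiplier R lam (inv c)"
  unfolding multiplier_def
proof (rule sum.cong[OF refl])
  fix \<rho> assume "\<rho> \<in> R"
  then have irr: "irreducible_rep G \<rho>" using R by (auto simp: irrep_system_def)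
  show "of_nat (degree_rep G \<rho>) ^ 2 / of_nat (card (carrier G)) * lam \<rho> * norm_char G \<rho> C =
      of_nat (degree_rep G \<rho>) / of_nat (card (carrier G)) * lam \<rho> * mat_trace (\<rho> (inv (inv c)))"
    using irreducible_repD(2)[OF irr] conj_classes_eq(2)[OF C]
    by (simp add: norm_char_trace[OF irreducible_repD(1)[OF irr] C] power2_eq_square)
qed

text \<open>The bar replaces the trace at \<open>c\<close> by the trace at \<open>inv c\<close>,
  which is the one in the kernel at \<open>c\<close> itself.\<close>

lemma sum_cnj_norm_char:
  assumes fin: "finite (carrier G)" and R: "irrep_system G R" and C: "C \<in> conj_classes G" "c \<in> C"
  shows "(\<Sum>\<rho>\<in>R. of_nat (degree_rep G \<rho>) ^ 2 / of_nat (card (carrier G)) * lam \<rho> * cnj (norm_char G \<rho> C)) =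
    multiplier R lam c"
  unfolding multiplier_def
proof (rule sum.cong[OF refl])
  fix \<rho> assume "\<rho> \<in> R"
  then have irr: "irreducible_rep G \<rho>" using R by (auto simp: irrep_system_def)
  show "of_nat (degree_rep G \<rho>) ^ 2 / of_nat (card (carrier G)) * lam \<rho> * cnj (norm_char G \<rho> C) =
      of_nat (degree_rep G \<rho>) / of_nat (card (carrier G)) * lam \<rho> * mat_trace (\<rho> (inv c))"
    using irreducible_repD(2)[OF irr] rep_trace_inv[OF fin irreducible_repD(1)[OF irr] conj_classes_eq(2)[OF C]]
    by (simp add: norm_char_trace[OF irreducible_repD(1)[OF irr] C] power2_eq_square)
qed

text \<open>\<open>L\<close> applied to a diagonal coefficient is evaluated at the unit twice: as a
  convolution, and by diagonality, where that coefficient has the value 1.\<close>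

lemma sum_multiplier_coeff:
  assumes fin: "finite (carrier G)" and R: "irrep_system G R" and L: "linear_on_fun_alg G L"
    and diag: "\<And>\<rho> i j. \<lbrakk>\<rho> \<in> R; i < degree_rep G \<rho>; j < degree_rep G \<rho>\<rbrakk> \<Longrightarrow>
           L (matrix_coeff G \<rho> i j) = (\<lambda>x. lam \<rho> * matrix_coeff G \<rho> i j x)"
    and \<rho>: "\<rho> \<in> R" and i: "i < degree_rep G \<rho>"
  shows "(\<Sum>y\<in>carrier G. multiplier R lam y * \<rho> y $$ (i, i)) = lam \<rho>"
proof -
  have \<rho>r: "representation G \<rho>" using \<rho> R by (auto simp: irrep_system_def irreducible_repD)
  have alg: "matrix_coeff G \<rho> i i \<in> fun_alg (carrier G)" by (simp add: matrix_coeff_def fun_alg_def)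
  have "(\<Sum>y\<in>carrier G. multiplier R lam y * \<rho> y $$ (i, i)) =
      (\<Sum>h\<in>carrier G. matrix_coeff G \<rho> i i h * multiplier R lam (inv \<one> \<otimes> h))"
    by (intro sum.cong) (auto simp: matrix_coeff_def)
  also have "\<dots> = L (matrix_coeff G \<rho> i i) \<one>"
    by (rule diagonal_operator_is_convolution[OF fin R L diag alg one_closed, symmetric])
  also have "\<dots> = lam \<rho>"
    unfolding diag[OF \<rho> i i] using i by (simp add: matrix_coeff_def rep_one[OF \<rho>r])
  finally show ?thesis .
qed

lemma sum_multiplier_trace:
  assumes fin: "finite (carrier G)" and R: "irrep_system G R" and L: "linear_on_fun_alg G L"
    and diag: "\<And>\<rho> i j. \<lbrakk>\<rho> \<in> R; i < degree_rep G \<rho>; j < degree_rep G \<rho>\<rbrakk> \<Longrightarrow>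
           L (matrix_coeff G \<rho> i j) = (\<lambda>x. lam \<rho> * matrix_coeff G \<rho> i j x)"
    and \<rho>: "\<rho> \<in> R"
  shows "(\<Sum>y\<in>carrier G. multiplier R lam y * mat_trace (\<rho> y)) = of_nat (degree_rep G \<rho>) * lam \<rho>"
proof -
  have \<rho>r: "representation G \<rho>" using \<rho> R by (auto simp: irrep_system_def irreducible_repD)
  have "(\<Sum>y\<in>carrier G. multiplier R lam y * mat_trace (\<rho> y)) =
      (\<Sum>y\<in>carrier G. \<Sum>i<degree_rep G \<rho>. multiplier R lam y * \<rho> y $$ (i, i))"
    by (intro sum.cong) (auto simp: mat_trace_eq[OF rep_carrier[OF \<rho>r]] sum_distrib_left)
  also have "\<dots> = (\<Sum>i<degree_rep G \<rho>. \<Sum>y\<in>carrier G. multiplier R lam y * \<rho> y $$ (i, i))"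
    by (rule sum.swap)
  also have "\<dots> = (\<Sum>i<degree_rep G \<rho>. lam \<rho>)"
    by (intro sum.cong sum_multiplier_coeff[OF fin R L diag \<rho>]) auto
  finally show ?thesis by simp
qed

text \<open>The total mass of the kernel is the eigenvalue of \<open>L\<close> at the constant
  functions, that is, at the coefficient of the trivial representation.\<close>

lemma sum_multiplier:
  assumes fin: "finite (carrier G)" and R: "irrep_system G R" and L: "linear_on_fun_alg G L"
    and diag: "\<And>\<rho> i j. \<lbrakk>\<rho> \<in> R; i < degree_rep G \<rho>; j < degree_rep G \<rho>\<rbrakk> \<Longrightarrow>
           L (matrix_coeff G \<rho> i j) = (\<lambda>x. lam \<rho> * matrix_coeff G \<rho> i j x)"
    and triv: "\<And>\<rho>. \<lbrakk>\<rho> \<in> R; iso_rep G \<rho> trivial_rep\<rbrakk> \<Longrightarrow> lam \<rho> = 0"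
  shows "(\<Sum>y\<in>carrier G. multiplier R lam y) = 0"
proof -
  obtain \<rho> where \<rho>: "\<rho> \<in> R" "iso_rep G \<rho> trivial_rep" "degree_rep G \<rho> = 1"
    and one: "\<And>g. g \<in> carrier G \<Longrightarrow> \<rho> g = 1\<^sub>m 1"
    using irrep_system_trivial[OF R] by metis
  have "(\<Sum>y\<in>carrier G. multiplier R lam y) = (\<Sum>y\<in>carrier G. multiplier R lam y * \<rho> y $$ (0, 0))"
    by (intro sum.cong) (auto simp: one)
  also have "\<dots> = lam \<rho>"
    by (rule sum_multiplier_coeff[OF fin R L diag \<rho>(1)]) (auto simp: \<rho>(3))
  finally show ?thesis using triv[OF \<rho>(1,2)] by simp
qed

end

theorem proposition4p20:
  fixes G (structure)
    and S :: "'a set"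
    and Irr :: "('a \<Rightarrow> complex mat) set"
    and L :: "('a \<Rightarrow> complex) \<Rightarrow> ('a \<Rightarrow> complex)"
    and lam :: "('a \<Rightarrow> complex mat) \<Rightarrow> complex"
    and l :: "'a set \<Rightarrow> complex"
    and ip :: "('a \<Rightarrow> 'a \<Rightarrow> complex) \<Rightarrow> ('a \<Rightarrow> 'a \<Rightarrow> complex) \<Rightarrow> 'a \<Rightarrow> complex"
  assumes "group G" and "finite (carrier G)"
    and "S \<subseteq> carrier G - {\<one>}"
    and "\<exists>\<C>. \<C> \<subseteq> conj_classes G \<and> S = \<Union>\<C>"
    and "irrep_system G Irr"
    and "linear_on_fun_alg G L"
    and "\<And>\<rho> i j. \<lbrakk>\<rho> \<in> Irr; i < degree_rep G \<rho>; j < degree_rep G \<rho>\<rbrakk> \<Longrightarrow>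
           L (matrix_coeff G \<rho> i j) = (\<lambda>x. lam \<rho> * matrix_coeff G \<rho> i j x)"
    and "\<And>\<rho>. \<lbrakk>\<rho> \<in> Irr; iso_rep G \<rho> trivial_rep\<rbrakk> \<Longrightarrow> lam \<rho> = 0"
    and "bimodule_inner_product G S ip"
    and "given_by_data G S l ip"
  shows
    "(second_order_laplacian G S ip L \<and> bicovariant G L \<longleftrightarrow>
        (\<forall>C\<in>conj_classes G. C \<subseteq> carrier G - {\<one>} \<and> \<not> C \<subseteq> sym_part G S \<longrightarrow>
           (\<Sum>\<rho>\<in>Irr. of_nat (degree_rep G \<rho>) ^ 2 / of_nat (card (carrier G)) * lam \<rho> * norm_char G \<rho> C) = 0) \<and>
        (\<Sum>\<rho>\<in>Irr. of_nat (degree_rep G \<rho>) ^ 2 / of_nat (card (carrier G)) * lam \<rho> *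
           (1 + (\<Sum>C\<in>{C \<in> conj_classes G. C \<subseteq> sym_part G S}. norm_char G \<rho> C * of_nat (card C)))) = 0 \<and>
        (\<forall>C\<in>conj_classes G. C \<subseteq> sym_part G S \<longrightarrow>
           l C = - (1 / 2) * (\<Sum>\<rho>\<in>Irr. of_nat (degree_rep G \<rho>) ^ 2 / of_nat (card (carrier G)) * lam \<rho> *
                                   cnj (norm_char G \<rho> C)))) \<and>
     (second_order_laplacian G S ip L \<and> bicovariant G L \<longrightarrow>
        (\<forall>\<rho>\<in>Irr. lam \<rho> =
           2 * (\<Sum>C\<in>{C \<in> conj_classes G. C \<subseteq> sym_part G S}.
                  l C * (1 - norm_char G \<rho> C) * of_nat (card C))))"
proof -
  interpret group G by fact
  note fin = assms(2) and S = assms(3) and classes = assms(4) and R = assms(5) and L = assms(6)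
    and diag = assms(7) and triv = assms(8) and ip = assms(9) and data = assms(10)
  define \<psi> where "\<psi> = multiplier Irr lam"
  let ?P = "sym_part G S"
  let ?w = "\<lambda>\<rho>. of_nat (degree_rep G \<rho>) ^ 2 / of_nat (card (carrier G)) * lam \<rho>"
  have SG: "S \<subseteq> carrier G" using S by auto
  have PG: "?P \<subseteq> carrier G - {\<one>}" using S sym_part_subset by blast
  note conv = diagonal_operator_is_convolution[OF fin R L diag, folded \<psi>_def]
  have sum0: "(\<Sum>y\<in>carrier G. \<psi> y) = 0"
    unfolding \<psi>_def by (rule sum_multiplier[OF fin R L diag triv])
  have bic: "bicovariant G L"
    by (rule class_convolution_bicovariant[OF fin linear_on_fun_algD(1)[OF L] conv])
       (simp_all add: \<psi>_def multiplier_conj[OF R])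
  have lap: "second_order_laplacian G S ip L \<longleftrightarrow>
      (\<forall>y\<in>carrier G - {\<one>}. \<psi> y = (if y \<in> ?P then - 2 * l (conj_class y) else 0))"
    by (rule laplacian_iff_multiplier[OF fin S classes ip data L conv sum0])
  \<comment> \<open>This serves both the second condition and the eigenvalue formula.\<close>
  have \<psi>_sum: "\<psi> \<one> = - (\<Sum>y\<in>?P. \<psi> y)" if "\<And>y. y \<in> carrier G - {\<one>} \<Longrightarrow> y \<notin> ?P \<Longrightarrow> \<psi> y = 0"
  proof -
    have "0 = \<psi> \<one> + (\<Sum>y\<in>carrier G - {\<one>}. \<psi> y)"
      using sum0 sum.remove[OF fin one_closed, of \<psi>] by simp
    also have "(\<Sum>y\<in>carrier G - {\<one>}. \<psi> y) = (\<Sum>y\<in>?P. \<psi> y)"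
      using fin PG that by (intro sum.mono_neutral_right) auto
    finally show ?thesis by (simp add: eq_neg_iff_add_eq_0)
  qed
  have cond1: "(\<forall>C\<in>conj_classes G. C \<subseteq> carrier G - {\<one>} \<and> \<not> C \<subseteq> ?P \<longrightarrow>
      (\<Sum>\<rho>\<in>Irr. ?w \<rho> * norm_char G \<rho> C) = 0) \<longleftrightarrow>
      (\<forall>y\<in>carrier G - {\<one>}. y \<notin> ?P \<longrightarrow> \<psi> y = 0)" (is "?l \<longleftrightarrow> ?r")
  proof
    assume l: ?l
    show ?r
    proof (intro ballI impI)
      fix y assume y: "y \<in> carrier G - {\<one>}" and nP: "y \<notin> ?P"
      \<comment> \<open>The sum for a class is the kernel at the inverse of its members, so the
        class to be tested for \<open>y\<close> is that of \<open>inv y\<close>.\<close>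
      let ?C = "conj_class (inv y)"
      have C: "?C \<in> conj_classes G" "inv y \<in> ?C"
        using y by (auto intro: conj_class_in conj_class_self)
      have "inv y \<notin> ?P" using sym_part_inv[OF classes, of "inv y"] y nP by auto
      then have "\<not> ?C \<subseteq> ?P" using C(2) by blast
      moreover have "\<one> \<notin> ?C"
      proof
        assume "\<one> \<in> ?C"
        then have "?C = conj_class \<one>" using conj_classes_eq(1)[OF C(1)] by simp
        also have "\<dots> = {\<one>}" by (auto simp: conj_class_def intro!: exI[of _ \<one>])
        finally show False using C(2) y by (auto simp: inv_eq_1_iff)
      qed
      moreover have "?C \<subseteq> carrier G" using y by (auto intro!: conj_class_subset)
      ultimately have "(\<Sum>\<rho>\<in>Irr. ?w \<rho> * norm_char G \<rho> ?C) = 0" using l C(1) by blast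
      then show "\<psi> y = 0" using sum_norm_char[OF R C, of lam] y by (simp add: \<psi>_def)
    qed
  next
    assume r: ?r
    show ?l
    proof (intro ballI impI)
      fix C assume C: "C \<in> conj_classes G" and C': "C \<subseteq> carrier G - {\<one>} \<and> \<not> C \<subseteq> ?P"
      obtain c where c: "c \<in> C" using conj_classes_nonempty[OF C] by blast
      have cG: "c \<in> carrier G" "c \<noteq> \<one>" "c \<notin> ?P"
        using c C' sym_part_class[OF C c, of S] by auto
      have "inv c \<in> carrier G - {\<one>}" using cG by (auto simp: inv_eq_1_iff)
      moreover have "inv c \<notin> ?P" using sym_part_inv[OF classes, of "inv c"] cG by auto
      ultimately have "\<psi> (inv c) = 0" using r by blast
      then show "(\<Sum>\<rho>\<in>Irr. ?w \<rho> * norm_char G \<rho> C) = 0"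
        using sum_norm_char[OF R C c, of lam] by (simp add: \<psi>_def)
    qed
  qed
  have cond3: "(\<forall>C\<in>conj_classes G. C \<subseteq> ?P \<longrightarrow>
      l C = - (1 / 2) * (\<Sum>\<rho>\<in>Irr. ?w \<rho> * cnj (norm_char G \<rho> C))) \<longleftrightarrow>
      (\<forall>y\<in>?P. \<psi> y = - 2 * l (conj_class y))" (is "?l \<longleftrightarrow> ?r")
  proof
    assume l: ?l
    show ?r
    proof
      fix y assume y: "y \<in> ?P"
      then have yG: "y \<in> carrier G" using PG by blast
      note C = conj_class_in[OF yG] conj_class_self[OF yG]
      have "conj_class y \<subseteq> ?P" using sym_part_class[OF C] y by simp
      then have "l (conj_class y) = - (1 / 2) * (\<Sum>\<rho>\<in>Irr. ?w \<rho> * cnj (norm_char G \<rho> (conj_class y)))"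
        using l C(1) by blast
      then show "\<psi> y = - 2 * l (conj_class y)"
        unfolding sum_cnj_norm_char[OF fin R C] \<psi>_def by simp
    qed
  next
    assume r: ?r
    show ?l
    proof (intro ballI impI)
      fix C assume C: "C \<in> conj_classes G" "C \<subseteq> ?P"
      obtain c where c: "c \<in> C" using conj_classes_nonempty[OF C(1)] by blast
      have "\<psi> c = - 2 * l C" using r c C conj_classes_eq(1)[OF C(1) c] by blast
      then show "l C = - (1 / 2) * (\<Sum>\<rho>\<in>Irr. ?w \<rho> * cnj (norm_char G \<rho> C))"
        unfolding sum_cnj_norm_char[OF fin R C(1) c] \<psi>_def by simp
    qed
  qed
  \<comment> \<open>The 1 in the bracket is the normalised character of the class of the unit. The
    sum is thus \<psi> at the unit plus the values at all \<open>inv c\<close>, and inversion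
    permutes \<open>?P\<close>.\<close>
  have cond2: "(\<Sum>\<rho>\<in>Irr. ?w \<rho> *
      (1 + (\<Sum>C\<in>{C \<in> conj_classes G. C \<subseteq> ?P}. norm_char G \<rho> C * of_nat (card C)))) = 0"
    if z: "\<forall>y\<in>carrier G - {\<one>}. y \<notin> ?P \<longrightarrow> \<psi> y = 0"
  proof -
    note C1 = conj_class_in[OF one_closed] conj_class_self[OF one_closed]
    have "(\<Sum>\<rho>\<in>Irr. ?w \<rho> *
        (1 + (\<Sum>C\<in>{C \<in> conj_classes G. C \<subseteq> ?P}. norm_char G \<rho> C * of_nat (card C)))) =
        (\<Sum>\<rho>\<in>Irr. ?w \<rho> * norm_char G \<rho> (conj_class \<one>) + (\<Sum>c\<in>?P. ?w \<rho> * norm_char G \<rho> (conj_class c)))"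
    proof (rule sum.cong[OF refl])
      fix \<rho> assume "\<rho> \<in> Irr"
      then have irr: "irreducible_rep G \<rho>" using R by (auto simp: irrep_system_def)
      have "norm_char G \<rho> (conj_class \<one>) = 1"
        using irreducible_repD(2)[OF irr]
        by (simp add: norm_char_trace[OF irreducible_repD(1)[OF irr] C1] rep_one[OF irreducible_repD(1)[OF irr]]
            mat_trace_def)
      then show "?w \<rho> * (1 + (\<Sum>C\<in>{C \<in> conj_classes G. C \<subseteq> ?P}. norm_char G \<rho> C * of_nat (card C))) =
          ?w \<rho> * norm_char G \<rho> (conj_class \<one>) + (\<Sum>c\<in>?P. ?w \<rho> * norm_char G \<rho> (conj_class c))"
        by (simp only: sum_sym_part_classes[OF fin SG] distrib_left sum_distrib_left)
    qed
    also have "\<dots> = (\<Sum>\<rho>\<in>Irr. ?w \<rho> * norm_char G \<rho> (conj_class \<one>)) +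
        (\<Sum>c\<in>?P. \<Sum>\<rho>\<in>Irr. ?w \<rho> * norm_char G \<rho> (conj_class c))"
      unfolding sum.distrib by (simp only: sum.swap[of _ Irr ?P])
    also have "\<dots> = \<psi> \<one> + (\<Sum>c\<in>?P. \<psi> (inv c))"
      unfolding sum_norm_char[OF R C1] inv_one \<psi>_def
      using PG by (intro arg_cong2[of _ _ _ _ "(+)"] refl sum.cong sum_norm_char[OF R])
        (auto intro: conj_class_in conj_class_self)
    also have "(\<Sum>c\<in>?P. \<psi> (inv c)) = (\<Sum>c\<in>?P. \<psi> c)"
    proof (rule sum.reindex_bij_betw[of "\<lambda>c. inv c" ?P ?P])
      show "bij_betw (\<lambda>c. inv c) ?P ?P"
        by (rule bij_betw_byWitness[where f' = "\<lambda>c. inv c"]) (use PG sym_part_inv[OF classes] in auto)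
    qed
    also have "\<psi> \<one> + (\<Sum>c\<in>?P. \<psi> c) = 0"
      using \<psi>_sum z by simp
    finally show ?thesis .
  qed
  have split: "(\<forall>y\<in>carrier G - {\<one>}. \<psi> y = (if y \<in> ?P then - 2 * l (conj_class y) else 0)) \<longleftrightarrow>
      (\<forall>y\<in>carrier G - {\<one>}. y \<notin> ?P \<longrightarrow> \<psi> y = 0) \<and> (\<forall>y\<in>?P. \<psi> y = - 2 * l (conj_class y))"
    using PG by (auto split: if_splits)
  have eigen: "lam \<rho> = 2 * (\<Sum>C\<in>{C \<in> conj_classes G. C \<subseteq> ?P}.
      l C * (1 - norm_char G \<rho> C) * of_nat (card C))"
    if \<psi>: "\<forall>y\<in>carrier G - {\<one>}. y \<notin> ?P \<longrightarrow> \<psi> y = 0" "\<forall>y\<in>?P. \<psi> y = - 2 * l (conj_class y)"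
      and \<rho>: "\<rho> \<in> Irr" for \<rho>
  proof -
    have irr: "irreducible_rep G \<rho>" using \<rho> R by (auto simp: irrep_system_def)
    let ?d = "of_nat (degree_rep G \<rho>) :: complex"
    have d0: "?d \<noteq> 0" using irreducible_repD(2)[OF irr] by simp
    have nc: "norm_char G \<rho> (conj_class y) * ?d = mat_trace (\<rho> y)" if "y \<in> carrier G" for y
      using norm_char_trace[OF irreducible_repD(1)[OF irr] conj_class_in[OF that] conj_class_self[OF that]] d0
      by simp
    have "?d * lam \<rho> = (\<Sum>y\<in>carrier G. \<psi> y * mat_trace (\<rho> y))"
      unfolding \<psi>_def by (rule sum_multiplier_trace[OF fin R L diag \<rho>, symmetric])
    also have "\<dots> = \<psi> \<one> * ?d + (\<Sum>y\<in>carrier G - {\<one>}. \<psi> y * mat_trace (\<rho> y))"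
      by (simp add: sum.remove[OF fin one_closed] rep_one[OF irreducible_repD(1)[OF irr]] mat_trace_def)
    also have "(\<Sum>y\<in>carrier G - {\<one>}. \<psi> y * mat_trace (\<rho> y)) = (\<Sum>y\<in>?P. \<psi> y * mat_trace (\<rho> y))"
      using fin PG \<psi>(1) by (intro sum.mono_neutral_right) auto
    \<comment> \<open>Eliminating the value at the unit replaces each trace by its difference from
      the degree; division by the degree then leaves 1 minus the normalised character.\<close>
    also have "\<psi> \<one> * ?d + \<dots> = (\<Sum>y\<in>?P. \<psi> y * mat_trace (\<rho> y) - \<psi> y * ?d)"
      using \<psi>_sum \<psi>(1) by (simp add: sum_subtractf sum_distrib_right)
    also have "\<dots> = (\<Sum>y\<in>?P. ?d * (2 * (l (conj_class y) * (1 - norm_char G \<rho> (conj_class y)))))"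
    proof (rule sum.cong[OF refl])
      fix y assume y: "y \<in> ?P"
      then have "y \<in> carrier G" using PG by blast
      then show "\<psi> y * mat_trace (\<rho> y) - \<psi> y * ?d =
          ?d * (2 * (l (conj_class y) * (1 - norm_char G \<rho> (conj_class y))))"
        using \<psi>(2) y by (simp add: nc[symmetric] algebra_simps)
    qed
    also have "\<dots> = ?d * (2 * (\<Sum>y\<in>?P. l (conj_class y) * (1 - norm_char G \<rho> (conj_class y))))"
      by (simp only: sum_distrib_left)
    finally show ?thesis
      unfolding sum_sym_part_classes[OF fin SG] using d0 by simp
  qed
  have main: "second_order_laplacian G S ip L \<and> bicovariant G L \<longleftrightarrow>
      (\<forall>y\<in>carrier G - {\<one>}. y \<notin> ?P \<longrightarrow> \<psi> y = 0) \<and> (\<forall>y\<in>?P. \<psi> y = - 2 * l (conj_class y))"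
    unfolding lap split using bic by iprover
  \<comment> \<open>Propositional glue: \<open>C\<close> is the second condition, supplied by
    \<open>cond2\<close> from the first, and \<open>E\<close> is the eigenvalue formula.\<close>
  have combine: "(X \<longleftrightarrow> A \<and> C \<and> B) \<and> (X \<longrightarrow> E)"
    if "X \<longleftrightarrow> A \<and> B" "A \<Longrightarrow> C" "A \<Longrightarrow> B \<Longrightarrow> E" for A B C E X
    using that by blast
  show ?thesis
    unfolding cond1 cond3 by (rule combine[OF main cond2 ballI[OF eigen]])
qed

end
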